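(* Let $\epsilon>1$, let $a,c$ be finite constants, and let $x=1/\epsilon$. Then, as $\lambda\to+\infty$, $$F_1(\lambda;x)\sim\frac{G(\lambda)e^{-\lambda\psi(\epsilon)}}{2x}\,f(\epsilon)\left\{1-\frac{2}{\sqrt{2\pi|\psi''(\epsilon)|}}\sum_{k\geq 0}\mathcal{D}_{2k}\,\frac{(\frac12)_k}{\lambda^{k+\frac12}}\right\},$$ where the coefficients $\mathcal{D}_{2k}$ (defined for all $k\ge 0$ in the context) have the following first three values: $$\mathcal{D}_0=F_1-\tfrac16\Psi_3,$$ $$\mathcal{D}_2=\frac{1}{\psi''(\epsilon)}\left\{\tfrac13F_3-\tfrac12F_2\Psi_3+\tfrac14F_1\left(\tfrac53\Psi_3^2-\Psi_4\right)-\tfrac14\left(\tfrac{35}{54}\Psi_3^3-\tfrac56\Psi_3\Psi_4+\tfrac15\Psi_5\right)\right\},$$ $$\begin{aligned}\mathcal{D}_4=\frac{1}{(\psi''(\epsilon))^2}\Big\{&\tfrac1{30}F_5-\tfrac5{36}F_4\Psi_3+\tfrac5{36}F_3\left(\tfrac73\Psi_3^2-\Psi_4\right)+\tfrac1{12}F_2\left(-\tfrac{35}6\Psi_3^3+\tfrac{35}6\Psi_3\Psi_4-\Psi_5\right)\\&+\tfrac1{36}F_1\left(\tfrac{385}{24}\Psi_3^4-\tfrac{105}4\Psi_3^2\Psi_4+7\Psi_3\Psi_5+\tfrac{35}8\Psi_4^2-\Psi_6\right)\\&-\tfrac1{48}\Big(\tfrac{1001}{108}\Psi_3^5-\tfrac{385}{18}\Psi_3^3\Psi_4+\tfrac{35}4\Psi_3\left(\Psi_4^2+\tfrac45\Psi_3\Psi_5\right)-\tfrac73\left(\Psi_4\Psi_5+\tfrac23\Psi_3\Psi_6\right)+\tfrac4{21}\Psi_7\Big)\Big\}.\end{aligned}$$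 Here $\Psi_k=\psi^{(k)}(\epsilon)/\psi''(\epsilon)$ and $F_k=f^{(k)}(\epsilon)/f(\epsilon)$.
   Context: $F_1(\lambda;x)={}_2F_1(a+\epsilon\lambda,1;c+\lambda;x)$ is the Gauss hypergeometric function (not to be confused with the constant $F_1=f'(\epsilon)/f(\epsilon)$ appearing in the coefficients), $\Gamma$ is the gamma function and $(y)_k=\Gamma(y+k)/\Gamma(y)$ is the Pochhammer symbol. Notation: $$\psi(t)=(\epsilon-1)\log(t-1)-\epsilon\log t,\qquad f(t)=t^{a-1}(t-1)^{c-a-1},$$ with logarithms and powers real/principal for $t>1$, and $$G(\lambda)=\frac{\Gamma(c+\lambda)\,\Gamma(1+a-c+(\epsilon-1)\lambda)}{\Gamma(a+\epsilon\lambda)}.$$ One has $\psi'(\epsilon)=0$ and $\psi''(\epsilon)=-\epsilon^{-1}(\epsilon-1)^{-1}<0$. Definition of $\mathcal{D}_{2k}$ for all $k\ge0$: with $\Psi_j=\psi^{(j)}(\epsilon)/\psi''(\epsilon)$ $(j\ge3)$ and $F_j=f^{(j)}(\epsilon)/f(\epsilon)$ $(j\ge1)$, let $D_s(k)$ $(s\ge1)$ be the coefficients in the power series expansion in $\delta$ near $\delta=0$ $$\frac{1+\sum_{j\ge1}F_j\,\delta^j/j!}{\left\{1+\sum_{j\ge3}2\Psi_j\,\delta^{j-2}/j!\right\}^{k+\frac12}}=1+\sum_{s=1}^\infty D_s(k)\,\delta^s .$$ Then $\mathcal{D}_{2k}=\left(\dfrac{2}{\psi''(\epsilon)}\right)^{k}D_{2k+1}(k)$.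 The symbol $\sim$ is understood in the Poincaré sense: for each $N\ge0$, truncating the sum after the terms $k<N$ leaves an error $O(\lambda^{-N-1/2})$ inside the braces as $\lambda\to+\infty$. *)

theory Defs
  imports "HOL-Complex_Analysis.Complex_Analysis" "HOL-Library.Landau_Symbols"
begin

text \<open>The Gauss series; only used for \<open>norm z < 1\<close>.\<close>

definition Gauss_2F1 :: "complex \<Rightarrow> complex \<Rightarrow> complex \<Rightarrow> complex \<Rightarrow> complex" where
  "Gauss_2F1 a b c z = eval_fps (fps_hypergeo [a, b] [c] 1) z"

lemma Gauss_2F1_series:
  "Gauss_2F1 a b c z =
     (\<Sum>n. pochhammer a n * pochhammer b n / (pochhammer c n * fact n) * z ^ n)"
  by (simp add: Gauss_2F1_def eval_fps_def)

text \<open>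
  The phase and amplitude functions are real-analytic on the real half-line \<open>t > 1\<close>. They are
  defined here on the complex plane with principal logarithms and powers, so that \<open>deriv\<close> applies;
  on \<open>t > 1\<close> the complex derivatives are the ordinary ones. The parameters \<open>a\<close>, \<open>c\<close> may be complex.
\<close>

definition psi :: "real \<Rightarrow> complex \<Rightarrow> complex" where
  "psi \<epsilon> t = (of_real \<epsilon> - 1) * Ln (t - 1) - of_real \<epsilon> * Ln t"

definition famp :: "complex \<Rightarrow> complex \<Rightarrow> complex \<Rightarrow> complex" where
  "famp a c t = t powr (a - 1) * (t - 1) powr (c - a - 1)"

definition Gfactor :: "real \<Rightarrow> complex \<Rightarrow> complex \<Rightarrow> real \<Rightarrow> complex" where
  "Gfactor \<epsilon> a c l =
     Gamma (c + of_real l) * Gamma (1 + a - c + (of_real \<epsilon> - 1) * of_real l)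
       / Gamma (a + of_real \<epsilon> * of_real l)"

definition psi2 :: "real \<Rightarrow> complex" where
  "psi2 \<epsilon> = (deriv ^^ 2) (psi \<epsilon>) (of_real \<epsilon>)"

definition Psi_ratio :: "real \<Rightarrow> nat \<Rightarrow> complex" where
  "Psi_ratio \<epsilon> j = (deriv ^^ j) (psi \<epsilon>) (of_real \<epsilon>) / psi2 \<epsilon>"

definition F_ratio :: "real \<Rightarrow> complex \<Rightarrow> complex \<Rightarrow> nat \<Rightarrow> complex" where
  "F_ratio \<epsilon> a c j = (deriv ^^ j) (famp a c) (of_real \<epsilon>) / famp a c (of_real \<epsilon>)"

text \<open>
  The series over \<open>j \<ge> 1\<close> and \<open>j \<ge> 3\<close> are reindexed by \<open>j = i + 1\<close> and \<open>j = i + 3\<close>. Both converge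
  near \<open>\<delta> = 0\<close>, where the base of the power is close to 1, so the principal power is the intended one.
\<close>

definition D_gen :: "real \<Rightarrow> complex \<Rightarrow> complex \<Rightarrow> nat \<Rightarrow> complex \<Rightarrow> complex" where
  "D_gen \<epsilon> a c k \<delta> =
     (1 + (\<Sum>i. F_ratio \<epsilon> a c (i + 1) * \<delta> ^ (i + 1) / fact (i + 1)))
       / (1 + (\<Sum>i. 2 * Psi_ratio \<epsilon> (i + 3) * \<delta> ^ (i + 1) / fact (i + 3)))
           powr (of_nat k + 1 / 2)"

definition D_coeff :: "real \<Rightarrow> complex \<Rightarrow> complex \<Rightarrow> nat \<Rightarrow> nat \<Rightarrow> complex" where
  "D_coeff \<epsilon> a c s k = fps_nth (fps_expansion (D_gen \<epsilon> a c k) 0) s"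

text \<open>\<open>D_even \<epsilon> a c k\<close> is the coefficient with index \<open>2 * k\<close>.\<close>

definition D_even :: "real \<Rightarrow> complex \<Rightarrow> complex \<Rightarrow> nat \<Rightarrow> complex" where
  "D_even \<epsilon> a c k = (2 / psi2 \<epsilon>) ^ k * D_coeff \<epsilon> a c (2 * k + 1) k"

end

theory Submission
  imports Defs "HOL-Probability.Probability" "HOL-Real_Asymp.Real_Asymp"
begin

text \<open>
  With \<open>C = c + \<lambda>\<close>, \<open>B = 1 + a - c + (\<epsilon> - 1)\<lambda>\<close> one has
  \<open>F\<^sub>1 = (C - 1) x\<^bsup>1-C\<^esup> (1 - x)\<^bsup>-B\<^esup> J\<^sub>2\<close>, where \<open>J\<^sub>2\<close> and \<open>J\<^sub>1\<close> are the parts over \<open>[0, x]\<close> and \<open>[x, 1]\<close> of the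
  beta integral \<open>J\<^sub>1 + J\<^sub>2 = G / (C - 1)\<close>. Its integrand peaks exactly at the endpoint \<open>x = 1 / \<epsilon>\<close>, so the
  expression in braces is \<open>1 - (J\<^sub>1 - J\<^sub>2) / (J\<^sub>1 + J\<^sub>2)\<close>. To expand this quotient without dividing asymptotic
  series, consider the Cauchy transform \<open>\<integral> f e\<^bsup>-\<lambda>\<psi>\<^esup> / (1 - t y) dt\<close> along a short steepest descent path
  through \<open>\<epsilon>\<close>. Up to exponentially small boundary terms it solves the first-order equation of the
  hypergeometric function, so its one-sided limits at \<open>y = x\<close> are proportional to \<open>J\<^sub>2\<close> and \<open>- J\<^sub>1\<close>
  with the same factor. Their difference is \<open>2 \<pi> \<i>\<close> times a residue, and their sum is a principal value
  integral, whose expansion follows from Watson's lemma; the coefficients are residues, and a change of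
  variable gives their form in the coordinate \<open>\<delta>\<close>.
\<close>

section \<open>Formal power series\<close>

text \<open>As \<open>psi2 \<epsilon>\<close> is negative, exp(-l psi) is smallest at \<epsilon>
  along the real axis and largest along the vertical direction; hence the parameter w = \<i> v, in
  which the weight becomes exactly exp(-l psi(\<epsilon>)) exp(-l \<mu> v^2) with \<mu> =
  -psi''(\<epsilon>)/2. The inverse map from w to t is only local, so the path is cut at |v| = r.
  The differential equation survives the cut because it comes from an identity for the integrand
  alone; the price is boundary terms that are smaller by the factor exp(-\<mu> r^2 l) and so lie
  behind every power of l. The normalising factor \<open>beta_p l * mass l\<close> is never
  computed: both halves share it, it cancels in the quotient, and the denominator becomes 2 pi \<i>
  up to an exponentially small error, which is why no series has to be divided. Index 2k+1 and
  exponent k+1/2 of the coefficients: the coefficient of w^(2k+1) in K is the residue of K dw /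
  w^(2k+2). With w = \<delta> u, where u^2 is the phase series Q, and K dw = u A d\<delta>, where A
  is the amplitude series, it equals the coefficient of \<delta>^(2k+1) in A / u^(2k+1) = A /
  Q^(k+1/2).\<close>

text \<open>In residue language with \<phi> = X u: \<phi>' / \<phi>^(p+1) is, up to the factor -1/p,
  the derivative of \<phi>^(-p), and a derivative has no residue. The power X^(p+1) is cleared so
  that only power series occur.\<close>

lemma fps_nth_Lagrange_vanish:
  fixes u :: "'a :: field_char_0 fps"
  assumes "fps_nth u 0 \<noteq> 0" "p > 0"
  shows "fps_nth (fps_deriv (fps_X * u) * inverse u ^ Suc p) p = 0"
proof -
  define v where "v = inverse u"
  have uv: "u * v = 1" using assms by (simp add: v_def inverse_mult_eq_1')
  have dv: "fps_deriv v = - fps_deriv u * v\<^sup>2"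
    using assms unfolding v_def by (simp add: fps_inverse_deriv)
  have "fps_const (of_nat p) * (fps_deriv (fps_X * u) * v ^ Suc p) = fps_const (of_nat p) * v ^ p
      * (u * v) + fps_const (of_nat p) * fps_X * fps_deriv u * v ^ Suc p"
    by (simp add: algebra_simps)
  also have "fps_const (of_nat p) * fps_X * fps_deriv u * v ^ Suc p = - fps_X *
      (fps_const (of_nat p) * fps_deriv v * v ^ (p - 1))"
    using \<open>p > 0\<close> by (cases p) (simp_all add: dv power2_eq_square algebra_simps)
  also have "fps_const (of_nat p) * fps_deriv v * v ^ (p - 1) = fps_deriv (v ^ p)"
    by (simp add: fps_deriv_power fps_of_nat mult_ac)
  \<comment> \<open>Both terms on the right have the same coefficient at p, because X d/dX
    multiplies that coefficient by p.\<close>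
  finally have eq: "fps_const (of_nat p) * (fps_deriv (fps_X * u) * v ^ Suc p) = fps_const
      (of_nat p) * v ^ p - fps_X * fps_deriv (v ^ p)"
    by (simp add: uv)
  have "fps_nth (fps_const (of_nat p) * (fps_deriv (fps_X * u) * v ^ Suc p)) p = 0"
    unfolding eq using \<open>p > 0\<close> gr0_conv_Suc[of p] by (auto simp del: power_Suc simp flip: of_nat_Suc)
  then show ?thesis using \<open>p > 0\<close>
    by (simp add: v_def)
qed

text \<open>Residues are invariant under the substitution \<open>\<delta> \<mapsto> \<delta> u(\<delta>)\<close>.\<close>

lemma fps_compose_residue:
  fixes u k :: "'a :: field_char_0 fps"
  assumes u0: "fps_nth u 0 = 1"
  shows "fps_nth (fps_compose k (fps_X * u) * fps_deriv (fps_X * u) * inverse u ^ Suc n) n = fps_nth k n"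
proof -
  define v where "v = inverse u"
  have uv: "u * v = 1" using assms by (simp add: v_def inverse_mult_eq_1')
  define W where "W = fps_deriv (fps_X * u) * v ^ Suc n"
  \<comment> \<open>Residue of \<phi>^(m-n-1) \<phi>' with \<phi> = X u: it is 1 for m = n, and 0
    for m < n by the preceding lemma with p = n - m.\<close>
  have pow_nth: "fps_nth ((fps_X * u) ^ m * W) n = (if m = n then 1 else 0)" if "m \<le> n" for m
  proof -
    have "(fps_X * u) ^ m * W = fps_X ^ m * (fps_deriv (fps_X * u) * (u ^ m * v ^ m) * v ^ Suc (n - m))"
      using that by (simp add: W_def power_mult_distrib mult_ac flip: power_add)
    also have "u ^ m * v ^ m = 1" by (simp add: uv flip: power_mult_distrib)
    finally have "fps_nth ((fps_X * u) ^ m * W) n = fps_nth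
        (fps_deriv (fps_X * u) * v ^ Suc (n - m)) (n - m)"
      using that by (simp add: fps_X_power_mult_nth)
    also have "\<dots> = (if m = n then 1 else 0)"
    proof (cases "m = n")
      case True
      then show ?thesis using u0 by (simp add: v_def)
    next
      case False
      then show ?thesis using fps_nth_Lagrange_vanish[of u "n - m"] that u0 by (simp add: v_def)
    qed
    finally show ?thesis .
  qed
  have "fps_nth (fps_compose k (fps_X * u) * W) n = (\<Sum>i\<le>n. fps_nth (fps_compose k (fps_X * u)) i *
      fps_nth W (n - i))"
    by (simp add: fps_mult_nth atLeast0AtMost)
  \<comment> \<open>(X u)^m starts at degree m, so extending the inner sum from m \<le> i to m \<le>
    n adds only zeros and makes the two sums interchangeable.\<close>
  also have "\<dots> = (\<Sum>i\<le>n. (\<Sum>m\<le>n. fps_nth k m * fps_nth ((fps_X * u) ^ m) i) * fps_nth W (n - i))"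
  proof (intro sum.cong refl arg_cong2[of _ _ _ _ "(*)"])
    fix i assume "i \<in> {..n}"
    show "fps_nth (fps_compose k (fps_X * u)) i = (\<Sum>m\<le>n. fps_nth k m * fps_nth ((fps_X * u) ^ m) i)"
      unfolding fps_compose_nth atLeast0AtMost using \<open>i \<in> {..n}\<close>
      by (intro sum.mono_neutral_left) (auto simp: power_mult_distrib fps_X_power_mult_nth)
  qed
  also have "\<dots> = (\<Sum>m\<le>n. fps_nth k m * (\<Sum>i\<le>n. fps_nth ((fps_X * u) ^ m) i * fps_nth W (n - i)))"
    by (simp add: sum_distrib_left sum_distrib_right mult.assoc) (rule sum.swap)
  also have "\<dots> = (\<Sum>m\<le>n. fps_nth k m * fps_nth ((fps_X * u) ^ m * W) n)"
    by (simp add: fps_mult_nth atLeast0AtMost)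
  also have "\<dots> = (\<Sum>m\<le>n. if m = n then fps_nth k m else 0)"
    by (intro sum.cong refl) (simp add: pow_nth)
  finally show ?thesis by (simp add: W_def v_def mult.assoc)
qed

text \<open>\<open>V\<close> is the formal power Q^\<alpha>, written through the root
  \<open>U\<close> because \<alpha> is a half-integer. Comparing coefficients in Q V' = \<alpha> Q'
  V gives a recurrence in which the coefficients of \<open>U\<close> no longer appear.\<close>

lemma fps_nth_half_power_rec:
  fixes Q U :: "complex fps" and k :: nat
  defines "V \<equiv> inverse U ^ (2 * k + 1)" and "\<alpha> \<equiv> - (of_nat k + 1/2 :: complex)"
  assumes sq: "U\<^sup>2 = Q" and U0: "fps_nth U 0 = 1"
  shows "of_nat (Suc n) * fps_nth V (Suc n) =
           (\<Sum>j\<le>n. (\<alpha> * of_nat (Suc j) - of_nat (n - j)) * fps_nth Q (Suc j) * fps_nth V (n - j))"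
proof -
  define W where "W = inverse U"
  have UW: "U * W = 1" using U0 by (simp add: W_def inverse_mult_eq_1')
  have "fps_deriv (U * W) = 0" unfolding UW by simp
  then have dW: "U * fps_deriv W = - fps_deriv U * W" by (simp add: algebra_simps add_eq_0_iff)
  have dV: "W * fps_deriv V = fps_const (of_nat (2 * k + 1)) * fps_deriv W * V"
    unfolding V_def W_def[symmetric] by (simp add: fps_deriv_power mult_ac del: power_Suc)
        (simp add: mult_ac)
  have dQ: "fps_deriv Q = 2 * U * fps_deriv U" unfolding sq[symmetric] by (simp add: power2_eq_square)
  have "Q * fps_deriv V = U\<^sup>2 * (U * W) * fps_deriv V" by (simp add: UW sq)
  also have "\<dots> = U ^ 3 * (W * fps_deriv V)" by (simp add: algebra_simps power3_eq_cube power2_eq_square)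
  also have "\<dots> = fps_const (of_nat (2 * k + 1)) * U\<^sup>2 * (U * fps_deriv W) * V"
    unfolding dV by (simp add: power3_eq_cube power2_eq_square mult_ac)
  also have "\<dots> = - fps_const (of_nat (2 * k + 1)) * U * (U * W) * fps_deriv U * V"
    unfolding dW by (simp add: power2_eq_square mult_ac del: fps_const_neg)
  also have "\<dots> = fps_const (\<alpha> * 2) * (U * fps_deriv U * V)"
    by (simp add: UW \<alpha>_def mult_ac)
  also have "\<dots> = fps_const \<alpha> * (fps_deriv Q * V)"
    unfolding dQ fps_const_mult[symmetric] by (simp add: fps_numeral_fps_const mult_ac)
  finally have "fps_nth (Q * fps_deriv V) n = \<alpha> * fps_nth (fps_deriv Q * V) n"
    by simp
  moreover have "fps_nth (Q * fps_deriv V) n = of_nat (Suc n) * fps_nth V (Suc n)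
       + (\<Sum>j\<le>n. of_nat (n - j) * fps_nth Q (Suc j) * fps_nth V (n - j))"
  proof -
    have "fps_nth (Q * fps_deriv V) n = (\<Sum>i\<le>n. fps_nth Q i *
        (of_nat (Suc (n - i)) * fps_nth V (Suc (n - i))))"
      by (simp add: fps_mult_nth atLeast0AtMost)
    also have "\<dots> = fps_nth Q 0 * (of_nat (Suc n) * fps_nth V (Suc n))
       + (\<Sum>j<n. fps_nth Q (Suc j) * (of_nat (Suc (n - Suc j)) * fps_nth V (Suc (n - Suc j))))"
      by (subst sum.atMost_shift) simp
    also have "(\<Sum>j<n. fps_nth Q (Suc j) * (of_nat (Suc (n - Suc j)) * fps_nth V (Suc (n - Suc j)))) =
       (\<Sum>j<n. of_nat (n - j) * fps_nth Q (Suc j) * fps_nth V (n - j))"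
      by (intro sum.cong refl) (simp add: Suc_diff_Suc del: of_nat_Suc)
    also have "\<dots> = (\<Sum>j\<le>n. of_nat (n - j) * fps_nth Q (Suc j) * fps_nth V (n - j))"
      by (intro sum.mono_neutral_left) auto
    also have "fps_nth Q 0 = 1" using U0 by (simp add: fps_power_zeroth flip: sq)
    finally show ?thesis by simp
  qed
  moreover have "\<alpha> * fps_nth (fps_deriv Q * V) n = (\<Sum>j\<le>n. \<alpha> * of_nat (Suc j) * fps_nth Q (Suc j) *
      fps_nth V (n - j))"
    unfolding fps_mult_nth by (simp add: atLeast0AtMost sum_distrib_left mult.assoc)
  moreover have "(\<Sum>j\<le>n. (\<alpha> * of_nat (Suc j) - of_nat (n - j)) * fps_nth Q (Suc j) * fps_nth V (n - j))
     = (\<Sum>j\<le>n. \<alpha> * of_nat (Suc j) * fps_nth Q (Suc j) * fps_nth V (n - j))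
       - (\<Sum>j\<le>n. of_nat (n - j) * fps_nth Q (Suc j) * fps_nth V (n - j))"
    by (simp only: left_diff_distrib sum_subtractf)
  ultimately show ?thesis by algebra
qed

text \<open>The recurrence is run up to order 5 for k = 0, 1, 2, that is \<alpha> = -1/2, -3/2,
  -5/2, and the result is convolved with the coefficients of \<open>A\<close>. The left factors 2
  and 4 are the 2^k contained in \<open>D_even\<close>.\<close>

lemma
  fixes Q U A :: "complex fps"
  assumes sq: "U\<^sup>2 = Q" and U0: "fps_nth U 0 = 1" and A0: "fps_nth A 0 = 1"
    and Q: "\<And>n. fps_nth Q n = 2 * P (n + 2) / fact (n + 2)"
    and A: "\<And>n. fps_nth A n = F n / fact n"
  shows half_power_coeff_1: "fps_nth (A * inverse U ^ (2 * 0 + 1)) (2 * 0 + 1) = F 1 - 1/6 * P 3"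
    and half_power_coeff_3: "2 * fps_nth (A * inverse U ^ (2 * 1 + 1)) (2 * 1 + 1) =
              (1/3 * F 3 - 1/2 * F 2 * P 3 + 1/4 * F 1 * (5/3 * P 3 ^ 2 - P 4)
               - 1/4 * (35/54 * P 3 ^ 3 - 5/6 * P 3 * P 4 + 1/5 * P 5))"
    and half_power_coeff_5: "4 * fps_nth (A * inverse U ^ (2 * 2 + 1)) (2 * 2 + 1) =
              (1/30 * F 5 - 5/36 * F 4 * P 3 + 5/36 * F 3 * (7/3 * P 3 ^ 2 - P 4)
               + 1/12 * F 2 * (- 35/6 * P 3 ^ 3 + 35/6 * P 3 * P 4 - P 5)
               + 1/36 * F 1 * (385/24 * P 3 ^ 4 - 105/4 * P 3 ^ 2 * P 4 + 7 * P 3 * P 5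
                               + 35/8 * P 4 ^ 2 - P 6)
               - 1/48 * (1001/108 * P 3 ^ 5 - 385/18 * P 3 ^ 3 * P 4
                         + 35/4 * P 3 * (P 4 ^ 2 + 4/5 * P 3 * P 5)
                         - 7/3 * (P 4 * P 5 + 2/3 * P 3 * P 6) + 4/21 * P 7))"
proof -
  have q: "fps_nth Q 1 = P 3 / 3" "fps_nth Q 2 = P 4 / 12" "fps_nth Q 3 = P 5 / 60" "fps_nth Q 4 =
      P 6 / 360" "fps_nth Q 5 = P 7 / 2520"
    by (simp_all add: Q fact_numeral del: One_nat_def add_2_eq_Suc add_2_eq_Suc')
  have F0: "F 0 = 1" using A[of 0] A0 by simp
  have a: "fps_nth A 0 = 1" "fps_nth A 1 = F 1" "fps_nth A 2 = F 2 / 2" "fps_nth A 3 = F 3 / 6"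
      "fps_nth A 4 = F 4 / 24" "fps_nth A 5 = F 5 / 120"
    by (simp_all add: A F0 fact_numeral)
  have rec:
     "v 1 = \<alpha> * fps_nth Q 1"
     "v 2 = ((\<alpha> - 1) * fps_nth Q 1 * v 1 + 2 * \<alpha> * fps_nth Q 2) / 2"
     "v 3 = ((\<alpha> - 2) * fps_nth Q 1 * v 2 + (2 * \<alpha> - 1) * fps_nth Q 2 * v 1 + 3 * \<alpha> * fps_nth Q 3) / 3"
     "v 4 = ((\<alpha> - 3) * fps_nth Q 1 * v 3 + (2 * \<alpha> - 2) * fps_nth Q 2 * v 2 + (3 * \<alpha> - 1) * fps_nth
         Q 3 * v 1 + 4 * \<alpha> * fps_nth Q 4) / 4"
     "v 5 = ((\<alpha> - 4) * fps_nth Q 1 * v 4 + (2 * \<alpha> - 3) * fps_nth Q 2 * v 3 + (3 * \<alpha> - 2) * fps_nth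
         Q 3 * v 2 + (4 * \<alpha> - 1) * fps_nth Q 4 * v 1 + 5 * \<alpha> * fps_nth Q 5) / 5"
     if "v = fps_nth (inverse U ^ (2 * k + 1))" "\<alpha> = - (of_nat k + 1/2)" for v \<alpha> k
  proof -
    have v0: "v 0 = 1" using U0 by (simp add: that fps_power_zeroth)
    note R = fps_nth_half_power_rec[OF sq U0, where k = k, folded that]
    show "v 1 = \<alpha> * fps_nth Q 1" using R[of 0] v0 by simp
    have r2: "2 * v 2 = (\<alpha> - 1) * fps_nth Q 1 * v 1 + 2 * \<alpha> * fps_nth Q 2"
      using R[of 1] v0 by (simp add: numeral_eq_Suc algebra_simps)
    have r3: "3 * v 3 = (\<alpha> - 2) * fps_nth Q 1 * v 2 + (2 * \<alpha> - 1) * fps_nth Q 2 * v 1 + 3 * \<alpha> *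
        fps_nth Q 3"
      using R[of 2] v0 by (simp add: numeral_eq_Suc algebra_simps)
    have r4: "4 * v 4 = (\<alpha> - 3) * fps_nth Q 1 * v 3 + (2 * \<alpha> - 2) * fps_nth Q 2 * v 2 +
        (3 * \<alpha> - 1) * fps_nth Q 3 * v 1 + 4 * \<alpha> * fps_nth Q 4"
      using R[of 3] v0 by (simp add: numeral_eq_Suc algebra_simps)
    have r5: "5 * v 5 = (\<alpha> - 4) * fps_nth Q 1 * v 4 + (2 * \<alpha> - 3) * fps_nth Q 2 * v 3 +
        (3 * \<alpha> - 2) * fps_nth Q 3 * v 2 + (4 * \<alpha> - 1) * fps_nth Q 4 * v 1 + 5 * \<alpha> * fps_nth Q 5"
      using R[of 4] v0 by (simp add: numeral_eq_Suc algebra_simps)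
    show "v 2 = ((\<alpha> - 1) * fps_nth Q 1 * v 1 + 2 * \<alpha> * fps_nth Q 2) / 2" "v 3 =
        ((\<alpha> - 2) * fps_nth Q 1 * v 2 + (2 * \<alpha> - 1) * fps_nth Q 2 * v 1 + 3 * \<alpha> * fps_nth Q 3) / 3"
        "v 4 = ((\<alpha> - 3) * fps_nth Q 1 * v 3 + (2 * \<alpha> - 2) * fps_nth Q 2 * v 2 + (3 * \<alpha> - 1) *
        fps_nth Q 3 * v 1 + 4 * \<alpha> * fps_nth Q 4) / 4" "v 5 =
        ((\<alpha> - 4) * fps_nth Q 1 * v 4 + (2 * \<alpha> - 3) * fps_nth Q 2 * v 3 + (3 * \<alpha> - 2) * fps_nth Q 3
        * v 2 + (4 * \<alpha> - 1) * fps_nth Q 4 * v 1 + 5 * \<alpha> * fps_nth Q 5) / 5"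
      using r2 r3 r4 r5 by (simp_all add: eq_divide_eq mult.commute)
  qed
  have v0: "fps_nth (inverse U ^ n) 0 = 1" for n using U0 by (simp add: fps_power_zeroth)
  define v where "v k = fps_nth (inverse U ^ (2 * k + 1))" for k
  show "fps_nth (A * inverse U ^ (2 * 0 + 1)) (2 * 0 + 1) = F 1 - 1/6 * P 3"
  proof -
    have "fps_nth (A * inverse U ^ (2 * 0 + 1)) (2 * 0 + 1) = fps_nth A 0 * v 0 1 + fps_nth A 1 * v 0 0"
      unfolding v_def fps_mult_nth by (simp add: numeral_eq_Suc)
    also have "v 0 1 = - 1/6 * P 3"
      using rec(1)[OF v_def refl, of 0] by (simp only: q) simp
    also have "v 0 0 = 1" unfolding v_def by (rule v0)
    finally show ?thesis by (simp only: a) simp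
  qed
  show "2 * fps_nth (A * inverse U ^ (2 * 1 + 1)) (2 * 1 + 1) =
              (1/3 * F 3 - 1/2 * F 2 * P 3 + 1/4 * F 1 * (5/3 * P 3 ^ 2 - P 4)
               - 1/4 * (35/54 * P 3 ^ 3 - 5/6 * P 3 * P 4 + 1/5 * P 5))"
  proof -
    have "fps_nth (A * inverse U ^ (2 * 1 + 1)) (2 * 1 + 1)
       = fps_nth A 0 * v 1 3 + fps_nth A 1 * v 1 2 + fps_nth A 2 * v 1 1 + fps_nth A 3 * v 1 0"
      unfolding v_def fps_mult_nth by (simp add: numeral_eq_Suc)
    moreover have "v 1 0 = 1" unfolding v_def by (rule v0)
    moreover have v1: "v 1 1 = - 1/2 * P 3"
      using rec(1)[OF v_def refl, of 1] by (simp only: q) simp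
    moreover have v2: "v 1 2 = 5/24 * P 3 ^ 2 - 1/8 * P 4"
      unfolding rec(2)[OF v_def refl, of 1] by (simp only: q v1) (simp add: field_simps power2_eq_square)
    moreover have v3: "v 1 3 = - 35/432 * P 3 ^ 3 + 5/48 * P 3 * P 4 - 1/40 * P 5"
      unfolding rec(3)[OF v_def refl, of 1] by (simp only: q v1 v2)
          (simp add: field_simps power2_eq_square power3_eq_cube)
    ultimately show ?thesis by (simp only: a) (simp add: field_simps)
  qed
  show "4 * fps_nth (A * inverse U ^ (2 * 2 + 1)) (2 * 2 + 1) =
              (1/30 * F 5 - 5/36 * F 4 * P 3 + 5/36 * F 3 * (7/3 * P 3 ^ 2 - P 4)
               + 1/12 * F 2 * (- 35/6 * P 3 ^ 3 + 35/6 * P 3 * P 4 - P 5)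
               + 1/36 * F 1 * (385/24 * P 3 ^ 4 - 105/4 * P 3 ^ 2 * P 4 + 7 * P 3 * P 5
                               + 35/8 * P 4 ^ 2 - P 6)
               - 1/48 * (1001/108 * P 3 ^ 5 - 385/18 * P 3 ^ 3 * P 4
                         + 35/4 * P 3 * (P 4 ^ 2 + 4/5 * P 3 * P 5)
                         - 7/3 * (P 4 * P 5 + 2/3 * P 3 * P 6) + 4/21 * P 7))"
  proof -
    have "fps_nth (A * inverse U ^ (2 * 2 + 1)) (2 * 2 + 1)
       = fps_nth A 0 * v 2 5 + fps_nth A 1 * v 2 4 + fps_nth A 2 * v 2 3 + fps_nth A 3 * v 2 2 +
           fps_nth A 4 * v 2 1 + fps_nth A 5 * v 2 0"
      unfolding v_def fps_mult_nth by (simp add: numeral_eq_Suc)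
    moreover have "v 2 0 = 1" unfolding v_def by (rule v0)
    moreover have v1: "v 2 1 = - 5/6 * P 3"
      using rec(1)[OF v_def refl, of 2] by (simp only: q) simp
    moreover have v2: "v 2 2 = 5/24 * (7/3 * P 3 ^ 2 - P 4)"
      unfolding rec(2)[OF v_def refl, of 2] by (simp only: q v1) (simp add: field_simps power2_eq_square)
    moreover have v3: "v 2 3 = 1/24 * (- 35/6 * P 3 ^ 3 + 35/6 * P 3 * P 4 - P 5)"
      unfolding rec(3)[OF v_def refl, of 2] by (simp only: q v1 v2)
          (simp add: field_simps power2_eq_square power3_eq_cube)
    moreover have v4: "v 2 4 = 1/144 * (385/24 * P 3 ^ 4 - 105/4 * P 3 ^ 2 * P 4 + 7 * P 3 * P 5
                               + 35/8 * P 4 ^ 2 - P 6)"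
      unfolding rec(4)[OF v_def refl, of 2] by (simp only: q v1 v2 v3)
          (simp add: field_simps power2_eq_square power3_eq_cube power4_eq_xxxx)
    moreover have v5: "v 2 5 = - 1/192 * (1001/108 * P 3 ^ 5 - 385/18 * P 3 ^ 3 * P 4
                         + 35/4 * P 3 * (P 4 ^ 2 + 4/5 * P 3 * P 5)
                         - 7/3 * (P 4 * P 5 + 2/3 * P 3 * P 6) + 4/21 * P 7)"
      unfolding rec(5)[OF v_def refl, of 2] by (simp only: q v1 v2 v3 v4)
          (simp add: field_simps power2_eq_square power3_eq_cube power4_eq_xxxx eval_nat_numeral)
    ultimately show ?thesis by (simp only: a) (simp add: field_simps)
  qed
qed

section \<open>Taylor remainders on a closed disc\<close>

lemma continuous_on_punctured:
  assumes "isCont f x" "continuous_on (S - {x}) f"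
  shows "continuous_on S f"
  unfolding continuous_on_eq_continuous_within
proof
  fix y assume y: "y \<in> S"
  show "continuous (at y within S) f"
  proof (cases "y = x")
    case True
    then show ?thesis using assms(1) continuous_at_imp_continuous_at_within by blast
  next
    case False
    then have "continuous (at y within S - {x}) f"
      using assms(2) y by (auto simp: continuous_on_eq_continuous_within)
    moreover have "at y within S - {x} = at y within S"
      using False by (intro at_within_nhd[of _ "- {x}"]) auto
    ultimately show ?thesis by simp
  qed
qed

text \<open>The remainder divided by w^m has a removable singularity at 0 and is continuous on a
  compact disc, hence bounded there. Analyticity near 0 and continuity elsewhere thus give a bound
  on the whole disc.\<close>

lemma has_fps_expansion_remainder_bound:
  fixes L :: "complex \<Rightarrow> complex"
  assumes exp: "L has_fps_expansion F" and cont: "continuous_on (cball 0 r) L" and r: "r > 0"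
  shows "\<exists>C. \<forall>w\<in>cball 0 r. norm (L w - (\<Sum>n<m. fps_nth F n * w ^ n)) \<le> C * norm w ^ m"
proof -
  define P where "P w = (\<Sum>n<m. fps_nth F n * w ^ n)" for w
  define F' where "F' = F - (\<Sum>n<m. fps_const (fps_nth F n) * fps_X ^ n)"
  have F': "(\<lambda>w. L w - P w) has_fps_expansion F'"
    unfolding F'_def P_def by (intro fps_expansion_intros exp)
  have nth: "fps_nth F' n = 0" if "n < m" for n
    using that by (simp add: F'_def fps_sum_nth if_distrib cong: if_cong)
  have "(\<lambda>w. if w = 0 then fps_nth F' m else (L w - P w) / w ^ m) has_fps_expansion fps_shift m F'"
  \<comment> \<open>The zero series is treated apart: its subdegree is 0 by convention, so
    \<open>m \<le> subdegree F'\<close> may fail for it.\<close>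
  proof (cases "F' = 0")
    case True
    have "\<forall>\<^sub>F w in nhds 0. L w - P w = 0"
      using F' unfolding True by (simp add: has_fps_expansion_0_iff)
    then have "\<forall>\<^sub>F w in nhds 0. (if w = 0 then fps_nth F' m else (L w - P w) / w ^ m) = 0"
      by eventually_elim (simp add: True)
    then show ?thesis by (simp add: True has_fps_expansion_0_iff)
  next
    case False
    then have "m \<le> subdegree F'" by (intro subdegree_geI) (auto simp: nth)
    then show ?thesis by (intro has_fps_expansion_shift F') auto
  qed
  define H where "H w = (if w = 0 then fps_nth F' m else (L w - P w) / w ^ m)" for w
  have H0: "isCont H 0"
    using has_fps_expansion_imp_continuous[of H "fps_shift m F'" UNIV] \<open>_ has_fps_expansion
        fps_shift m F'\<close>
    unfolding H_def[abs_def] by blast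
  have "continuous_on (cball 0 r - {0}) (\<lambda>w. (L w - P w) / w ^ m)"
    unfolding P_def by (intro continuous_intros continuous_on_subset[OF cont]) auto
  then have cont': "continuous_on (cball 0 r - {0}) H"
    by (rule continuous_on_cong[THEN iffD1, rotated 2]) (auto simp: H_def)
  have "continuous_on (cball 0 r) H"
    by (rule continuous_on_punctured[OF H0 cont'])
  then have "bounded (H ` cball 0 r)"
    by (intro compact_imp_bounded compact_continuous_image) auto
  then obtain C where C: "\<And>w. w \<in> cball 0 r \<Longrightarrow> norm (H w) \<le> C" unfolding bounded_iff by blast
  have "norm (L w - P w) \<le> C * norm w ^ m" if w: "w \<in> cball 0 r" for w
  proof (cases "w = 0")
    case True
    have "L 0 - P 0 = fps_nth F' 0" using has_fps_expansion_imp_0_eq_fps_nth_0[OF F'] by simp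
    then show ?thesis using True nth[of 0] C[OF w] by (cases "m = 0") (auto simp: H_def zero_power)
  next
    case False
    then have "norm (L w - P w) = norm (H w) * norm w ^ m"
      by (simp add: H_def norm_divide norm_power)
    then show ?thesis using C[OF w] by (simp add: mult_right_mono)
  qed
  then show ?thesis unfolding P_def by blast
qed

section \<open>Gaussian Laplace integrals\<close>

text \<open>The factorials in the moments of exp(-x^2) are values of Gamma at half-integers; the
  substitution x = sqrt(s) v then brings in the power of s.\<close>

lemma has_integral_gaussian_moment:
  fixes s :: real
  assumes "s > 0"
  shows "((\<lambda>v. v ^ (2 * k) * exp (- s * v\<^sup>2)) has_integral
           Gamma (real k + 1/2) * s powr (- real k - 1/2)) UNIV"
proof -
  have G: "sqrt pi * (fact (2 * k) / (2 ^ (2 * k) * fact k)) = Gamma (real k + 1/2)"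
  proof (induction k)
    case 0 then show ?case by (simp add: Gamma_one_half_real)
  next
    case (Suc k)
    have "real k + 1/2 \<notin> \<int>\<^sub>\<le>\<^sub>0" by (auto elim!: nonpos_Ints_cases)
    then have "Gamma (real (Suc k) + 1/2) = (real k + 1/2) * Gamma (real k + 1/2)"
      using Gamma_plus1[of "real k + 1/2"] by (simp add: add_ac)
    then show ?case unfolding Suc[symmetric] by (simp only:)
        (simp add: divide_simps, simp add: algebra_simps)
  qed
  have "has_bochner_integral lborel (\<lambda>x::real. exp (-x\<^sup>2)*x^(2 * k)) (Gamma (real k + 1/2))"
    using has_bochner_integral_even_function[OF gaussian_moment_even_pos[where k=k]] by (simp flip: G)
  then have "has_bochner_integral lborel (\<lambda>x::real. exp (-(sqrt s * x)\<^sup>2)*(sqrt s * x)^(2 * k))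
               (Gamma (real k + 1/2) /\<^sub>R \<bar>sqrt s\<bar>)"
    using lborel_has_bochner_integral_real_affine_iff[of "sqrt s" "\<lambda>x::real. exp (-x\<^sup>2)*x^(2 * k)"
        "Gamma (real k + 1/2)" 0] assms
    by simp
  from has_bochner_integral_mult_left[OF this, of "1 / s ^ k"]
  have "has_bochner_integral lborel (\<lambda>x::real. exp (-(sqrt s * x)\<^sup>2)*(sqrt s * x)^(2 * k) * (1 / s ^ k))
          (Gamma (real k + 1/2) /\<^sub>R \<bar>sqrt s\<bar> * (1 / s ^ k))" .
  also have "(\<lambda>x::real. exp (-(sqrt s * x)\<^sup>2)*(sqrt s * x)^(2 * k) * (1 / s ^ k))
           = (\<lambda>v. v ^ (2 * k) * exp (- s * v\<^sup>2))"
    using assms by (simp add: power_mult_distrib power_mult fun_eq_iff)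
  also have "Gamma (real k + 1/2) /\<^sub>R \<bar>sqrt s\<bar> * (1 / s ^ k) = Gamma (real k + 1/2) * s powr
      (- real k - 1/2)"
    using assms by (simp only: powr_diff powr_minus powr_realpow powr_half_sqrt) (simp add: field_simps)
  finally have "has_bochner_integral lborel (\<lambda>v. v ^ (2 * k) * exp (- s * v\<^sup>2))
          (Gamma (real k + 1/2) * s powr (- real k - 1/2))" .
  then show ?thesis
    using has_integral_integral_lborel[of "\<lambda>v. v ^ (2 * k) * exp (- s * v\<^sup>2)"]
    by (simp add: has_bochner_integral_iff)
qed

text \<open>Outside [-r, r] the factor (v/r)^(2(N-k)) is at least 1, so the tail of the k-th moment
  is at most r^(-2(N-k)) times the full N-th moment. This power bound already has the order of the
  remainder sought and holds for every s > 0.\<close>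

lemma truncated_gaussian_moment:
  fixes r s :: real
  assumes "r > 0" "s > 0" "k \<le> N"
  shows "\<bar>integral {-r..r} (\<lambda>v. v ^ (2 * k) * exp (- s * v\<^sup>2))
            - Gamma (real k + 1/2) * s powr (- real k - 1/2)\<bar>
          \<le> inverse r ^ (2 * (N - k)) * (Gamma (real N + 1/2) * s powr (- real N - 1/2))"
proof -
  let ?f = "\<lambda>k v. v ^ (2 * k) * exp (- s * v\<^sup>2)"
  let ?I = "integral {-r..r} (?f k)"
  have "(?f k has_integral ?I) {-r..r}"
    by (intro integrable_integral integrable_continuous_real continuous_intros)
  then have "((\<lambda>v. if v \<in> {-r..r} then ?f k v else 0) has_integral ?I) UNIV"
    by (simp only: has_integral_restrict_UNIV)
  from has_integral_diff[OF has_integral_gaussian_moment[OF \<open>s > 0\<close>] this, of k]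
  have w: "((\<lambda>v. if v \<in> {-r..r} then 0 else ?f k v) has_integral
               (Gamma (real k + 1/2) * s powr (- real k - 1/2) - ?I)) UNIV"
    by (rule has_integral_cong[THEN iffD1, rotated]) auto
  have "0 \<le> Gamma (real k + 1/2) * s powr (- real k - 1/2) - ?I"
    by (rule has_integral_nonneg[OF w]) auto
  moreover have "Gamma (real k + 1/2) * s powr (- real k - 1/2) - ?I
      \<le> inverse r ^ (2 * (N - k)) * (Gamma (real N + 1/2) * s powr (- real N - 1/2))"
  proof (rule has_integral_le[OF w has_integral_mult_right[OF has_integral_gaussian_moment[OF \<open>s > 0\<close>]]])
    fix v :: real
    show "(if v \<in> {-r..r} then 0 else ?f k v) \<le> inverse r ^ (2 * (N - k)) * ?f N v"
    proof (cases "v \<in> {-r..r}")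
      case False
      then have "r\<^sup>2 \<le> v\<^sup>2"
        using assms power_mono[of r "\<bar>v\<bar>" 2] by auto
      then have "1 \<le> (v\<^sup>2 / r\<^sup>2) ^ (N - k)"
        using assms by (intro one_le_power) (simp add: field_simps)
      also have "\<dots> = inverse r ^ (2 * (N - k)) * v ^ (2 * (N - k))"
        unfolding power_mult power_divide by (simp add: divide_inverse power_inverse mult_ac)
      finally have "1 \<le> inverse r ^ (2 * (N - k)) * v ^ (2 * (N - k))" .
      then have "v ^ (2 * k) * exp (- s * v\<^sup>2) * 1
          \<le> v ^ (2 * k) * exp (- s * v\<^sup>2) * (inverse r ^ (2 * (N - k)) * v ^ (2 * (N - k)))"
        by (intro mult_left_mono) auto
      also have "\<dots> = inverse r ^ (2 * (N - k)) * (v ^ (2 * k + 2 * (N - k)) * exp (- s * v\<^sup>2))"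
        by (simp only: power_add mult_ac)
      also have "2 * k + 2 * (N - k) = 2 * N" using \<open>k \<le> N\<close> by simp
      finally show ?thesis using False by (simp only: if_False mult_1_right)
    qed (use assms in auto)
  qed
  ultimately show ?thesis by linarith
qed

text \<open>Watson's lemma for a two-sided Gaussian: the Taylor polynomial is integrated termwise
  and each truncated moment is completed. Both errors have the order of the N-th moment.\<close>

lemma gaussian_Watson:
  fixes G :: "real \<Rightarrow> complex" and g :: "nat \<Rightarrow> complex"
  assumes r: "r > 0" and cont: "continuous_on {-r..r} G"
    and bound: "\<And>v. v \<in> {-r..r} \<Longrightarrow> norm (G v - (\<Sum>k<N. g k * of_real v ^ (2 * k))) \<le> C * v ^ (2 * N)"
  shows "\<exists>D. \<forall>s>0. norm (integral {-r..r} (\<lambda>v. of_real (exp (- s * v\<^sup>2)) * G v)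
              - (\<Sum>k<N. g k * of_real (Gamma (real k + 1/2) * s powr (- real k - 1/2))))
            \<le> D * s powr (- real N - 1/2)"
proof -
  \<comment> \<open>The doubled \<bar>C\<bar> comes from bounding the truncated N-th moment by twice
    the full one, which is the case k = N of the preceding lemma; the sum collects the
    tails.\<close>
  define D where "D = (\<bar>C\<bar> + \<bar>C\<bar>) * Gamma (real N + 1/2)
     + (\<Sum>k<N. norm (g k) * (inverse r ^ (2 * (N - k)) * Gamma (real N + 1/2)))"
  have "norm (integral {-r..r} (\<lambda>v. of_real (exp (- s * v\<^sup>2)) * G v)
              - (\<Sum>k<N. g k * of_real (Gamma (real k + 1/2) * s powr (- real k - 1/2))))
            \<le> D * s powr (- real N - 1/2)" if "s > 0" for s
  proof -
    let ?e = "\<lambda>v. complex_of_real (exp (- s * v\<^sup>2))"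
    let ?P = "\<lambda>v::real. \<Sum>k<N. g k * of_real v ^ (2 * k)"
    let ?m = "\<lambda>k. integral {-r..r} (\<lambda>v. v ^ (2 * k) * exp (- s * v\<^sup>2))"
    have m: "((\<lambda>v. v ^ (2 * k) * exp (- s * v\<^sup>2)) has_integral ?m k) {-r..r}" for k
      by (intro integrable_integral integrable_continuous_real continuous_intros)
    have "((\<lambda>v. \<Sum>k<N. g k * of_real (v ^ (2 * k) * exp (- s * v\<^sup>2))) has_integral
        (\<Sum>k<N. g k * of_real (?m k))) {-r..r}"
      by (intro has_integral_sum has_integral_mult_right has_integral_of_real m) auto
    then have P: "((\<lambda>v. ?e v * ?P v) has_integral (\<Sum>k<N. g k * of_real (?m k))) {-r..r}"
      by (rule has_integral_cong[THEN iffD1, rotated]) (simp add: sum_distrib_left mult_ac)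
    have I: "((\<lambda>v. ?e v * G v) has_integral integral {-r..r} (\<lambda>v. ?e v * G v)) {-r..r}"
      by (intro integrable_integral integrable_continuous_real continuous_intros cont)
    have "norm (integral {-r..r} (\<lambda>v. ?e v * G v) - (\<Sum>k<N. g k * of_real (?m k)))
            \<le> \<bar>C\<bar> * ?m N"
      unfolding has_integral_diff[OF I P, THEN integral_unique, symmetric]
        integral_unique[OF has_integral_mult_right[OF m], symmetric]
    proof (rule integral_norm_bound_integral)
      fix v assume v: "v \<in> {-r..r}"
      have "norm (?e v * G v - ?e v * ?P v) = exp (- s * v\<^sup>2) * norm (G v - ?P v)"
        by (simp add: norm_mult flip: right_diff_distrib)
      also have "\<dots> \<le> exp (- s * v\<^sup>2) * (\<bar>C\<bar> * v ^ (2 * N))"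
      proof (intro mult_left_mono order.trans[OF bound[OF v]] mult_right_mono)
      qed auto
      finally show "norm (?e v * G v - ?e v * ?P v) \<le> \<bar>C\<bar> * (v ^ (2 * N) * exp (- s * v\<^sup>2))"
        by (simp add: mult_ac)
    qed (use has_integral_diff[OF I P] has_integral_mult_right[OF m] in blast)+
    also have "\<dots> \<le> \<bar>C\<bar> * (2 * (Gamma (real N + 1/2) * s powr (- real N - 1/2)))"
      using truncated_gaussian_moment[OF r that order.refl[of N]] by (intro mult_left_mono) auto
    finally have 1: "norm (integral {-r..r} (\<lambda>v. ?e v * G v) - (\<Sum>k<N. g k * of_real (?m k)))
            \<le> \<bar>C\<bar> * (2 * (Gamma (real N + 1/2) * s powr (- real N - 1/2)))" .
    have 2: "norm ((\<Sum>k<N. g k * of_real (?m k)) - (\<Sum>k<N. g k * of_real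
        (Gamma (real k + 1/2) * s powr (- real k - 1/2))))
      \<le> (\<Sum>k<N. norm (g k) * (inverse r ^ (2 * (N - k)) *
          (Gamma (real N + 1/2) * s powr (- real N - 1/2))))"
      unfolding sum_subtractf[symmetric] right_diff_distrib[symmetric] of_real_diff[symmetric]
    proof (rule sum_norm_le)
      fix k assume "k \<in> {..<N}"
      then show "norm (g k * complex_of_real (?m k - Gamma (real k + 1/2) * s powr (- real k - 1/2)))
         \<le> norm (g k) * (inverse r ^ (2 * (N - k)) * (Gamma (real N + 1/2) * s powr (- real N - 1/2)))"
        unfolding norm_mult norm_of_real
        by (intro mult_left_mono truncated_gaussian_moment r that) auto
    qed
    from norm_triangle_mono[OF 1 2] show ?thesis
      by (simp add: D_def algebra_simps sum_distrib_left sum_distrib_right)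
  qed
  then show ?thesis by blast
qed

section \<open>Incomplete beta integrals\<close>

text \<open>One-sided limits of the primitive at the ends are enough. This covers the endpoints 0
  and 1 of the beta kernel as well as the jump of the Cauchy transform at 1/\<epsilon>.\<close>

lemma has_integral_FTC_limits:
  fixes F :: "real \<Rightarrow> 'a :: euclidean_space"
  assumes "a < b"
    and der: "\<And>x. a < x \<Longrightarrow> x < b \<Longrightarrow> (F has_vector_derivative f x) (at x)"
    and A: "(F \<longlongrightarrow> A) (at_right a)" and B: "(F \<longlongrightarrow> B) (at_left b)"
  shows "(f has_integral (B - A)) {a..b}"
proof -
  define H where "H x = (if x = a then A else if x = b then B else F x)" for x
  have der': "(H has_vector_derivative f x) (at x)" if "x \<in> {a<..<b}" for x
    by (rule has_vector_derivative_transform_within_open[OF der, of x "{a<..<b}"])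
       (use that in \<open>auto simp: H_def\<close>)
  have "continuous_on {a..b} H"
  proof (rule continuous_on_IccI)
    show "(H \<longlongrightarrow> H a) (at_right a)"
      using A assms(1) by (auto simp: H_def elim!: Lim_transform_eventually intro!:
          eventually_at_rightI[of a b])
    show "(H \<longlongrightarrow> H b) (at_left b)"
      using B assms(1) by (auto simp: H_def elim!: Lim_transform_eventually intro!:
          eventually_at_leftI[of a b])
    show "H \<midarrow>x\<rightarrow> H x" if "a < x" "x < b" for x
      using der'[of x] that has_vector_derivative_continuous isContD by fastforce
  qed (use assms in auto)
  from fundamental_theorem_of_calculus_interior[OF less_imp_le[OF \<open>a < b\<close>] this der']
  show ?thesis using \<open>a < b\<close> by (simp add: H_def)
qed

lemma nonpos_Ints_Re: "z \<in> \<int>\<^sub>\<le>\<^sub>0 \<Longrightarrow> Re z \<le> 0"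
  by (auto elim!: nonpos_Ints_cases)

text \<open>Since one numerator parameter is 1, its Pochhammer symbol cancels n! and the
  coefficients satisfy (C + n) s_(n+1) = (A + n) s_n. This two-term recurrence is a differential
  equation of first order instead of second.\<close>

lemma eval_hypergeo_one_ode:
  fixes A C z :: complex
  assumes "norm z < 1" "Re A > 0" "Re C > 0"
  shows "fps_conv_radius (fps_hypergeo [A, 1] [C] 1) = 1" (is "fps_conv_radius ?S = 1")
    and "z * (1 - z) * eval_fps (fps_deriv (fps_hypergeo [A, 1] [C] 1)) z
           + (C - 1 - A * z) * Gauss_2F1 A 1 C z = C - 1"
proof -
  have nz: "A + of_nat n \<noteq> 0" "C + of_nat n \<noteq> 0" for n
    using assms by (auto simp: complex_eq_iff)
  have rec: "(C + of_nat n) * fps_nth ?S (Suc n) = (A + of_nat n) * fps_nth ?S n" for n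
    unfolding fps_hypergeo_rec using nz(2)[of n] of_nat_neq_0[of n, where ?'a=complex]
    by (simp add: add_ac del: fps_hypergeo_nth)
  have nth0: "fps_nth ?S 0 = 1" by (rule fps_hypergeo_0)
  have nthnz: "fps_nth ?S n \<noteq> 0" for n
  proof (induction n)
    case (Suc n) then show ?case using rec[of n] nz[of n] by auto
  qed (simp add: nth0)
  have "(\<lambda>n. (C + of_nat n) / (A + of_nat n)) \<longlonglongrightarrow> 1"
  proof -
    have "(\<lambda>n. (C / of_nat n + 1) / (A / of_nat n + 1)) \<longlonglongrightarrow> (0 + 1) / (0 + 1)"
      by (intro tendsto_intros lim_const_over_n) auto
    then have "(\<lambda>n. (C / of_nat n + 1) / (A / of_nat n + 1)) \<longlonglongrightarrow> 1" by simp
    moreover have "\<forall>\<^sub>F n in sequentially. (C / of_nat n + 1) / (A / of_nat n + 1) = (C + of_nat n)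
        / (A + of_nat n)"
      using eventually_gt_at_top[of 0]
    proof eventually_elim
      case (elim n)
      then have "C / of_nat n + 1 = (C + of_nat n) / of_nat n" "A / of_nat n + 1 = (A + of_nat n)
          / of_nat n"
        by (simp_all add: add_divide_distrib)
      then show ?case using elim by simp
    qed
    ultimately show ?thesis by (rule Lim_transform_eventually)
  qed
  then have "(\<lambda>n. norm ((C + of_nat n) / (A + of_nat n))) \<longlonglongrightarrow> norm (1::complex)"
    by (rule tendsto_norm)
  also have "(\<lambda>n. norm ((C + of_nat n) / (A + of_nat n))) =
      (\<lambda>n. norm (fps_nth ?S n) / norm (fps_nth ?S (Suc n)))"
  proof
    fix n
    have "(C + of_nat n) / (A + of_nat n) = fps_nth ?S n / fps_nth ?S (Suc n)"
      using rec[of n] nz[of n] nthnz[of "Suc n"]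
      by (simp add: frac_eq_eq mult_ac del: fps_hypergeo_nth)
    then show "norm ((C + of_nat n) / (A + of_nat n)) = norm (fps_nth ?S n) / norm (fps_nth ?S (Suc n))"
      by (simp only: norm_divide)
  qed
  finally show radius: "fps_conv_radius ?S = 1"
    unfolding fps_conv_radius_def using conv_radius_ratio_limit_nonzero[of 1 1 "fps_nth ?S"] nthnz
    by (simp add: one_ereal_def)
  have eq: "fps_X * (1 - fps_X) * fps_deriv ?S + (fps_const (C - 1) - fps_const A * fps_X) * ?S =
      fps_const (C - 1)"
  proof (rule fps_ext)
    fix n
    show "fps_nth (fps_X * (1 - fps_X) * fps_deriv ?S + (fps_const (C - 1) - fps_const A * fps_X)
        * ?S) n = fps_nth (fps_const (C - 1)) n"
    proof (cases n)
      case 0 then show ?thesis using nth0 by (simp add: mult.assoc del: fps_hypergeo_nth)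
    next
      case (Suc m)
      have "fps_nth (fps_X * (1 - fps_X) * fps_deriv ?S) (Suc m) = of_nat (Suc m) * fps_nth ?S
          (Suc m) - of_nat m * fps_nth ?S m"
        by (cases m) (simp_all add: algebra_simps fps_X_mult_nth del: fps_hypergeo_nth)
      then show ?thesis using rec[of m]
        by (simp add: Suc algebra_simps del: fps_hypergeo_nth)
    qed
  qed
  have z: "ereal (norm z) < fps_conv_radius ?S"
    using assms by (simp add: radius)
  then have z': "ereal (norm z) < fps_conv_radius (fps_deriv ?S)"
    by (rule less_le_trans[OF _ fps_conv_radius_deriv])
  have R1: "fps_conv_radius (1 - fps_X :: complex fps) = \<infinity>" "fps_conv_radius
      (fps_X * (1 - fps_X) :: complex fps) = \<infinity>"
    using fps_conv_radius_diff[of 1 "fps_X :: complex fps"]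
        fps_conv_radius_mult[of fps_X "1 - fps_X :: complex fps"] by simp_all
  have R2: "fps_conv_radius (fps_const A * fps_X) = \<infinity>" "fps_conv_radius
      (fps_const (C - 1) - fps_const A * fps_X) = \<infinity>"
    using fps_conv_radius_diff[of "fps_const (C - 1)" "fps_const A * fps_X"]
        fps_conv_radius_mult[of "fps_const A" fps_X] by simp_all
  have "C - 1 = eval_fps (fps_X * (1 - fps_X) * fps_deriv ?S +
      (fps_const (C - 1) - fps_const A * fps_X) * ?S) z"
    unfolding eq by simp
  also have "eval_fps (fps_X * (1 - fps_X) * fps_deriv ?S +
      (fps_const (C - 1) - fps_const A * fps_X) * ?S) z
     = eval_fps (fps_X * (1 - fps_X)) z * eval_fps (fps_deriv ?S) z + eval_fps
         (fps_const (C - 1) - fps_const A * fps_X) z * eval_fps ?S z"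
  proof -
    have R: "ereal (norm z) < fps_conv_radius (fps_X * (1 - fps_X) * fps_deriv ?S)"
      "ereal (norm z) < fps_conv_radius ((fps_const (C - 1) - fps_const A * fps_X) * ?S)"
      by (rule less_le_trans[OF _ fps_conv_radius_mult]; use z z' R1 R2 in simp)+
    show ?thesis
      unfolding eval_fps_add[OF R] using z z' R1 R2 by (simp add: eval_fps_mult)
  qed
  also have "eval_fps (fps_X * (1 - fps_X)) z = z * (1 - z)"
    by (subst eval_fps_mult; (subst eval_fps_diff)?) (simp_all add: R1)
  also have "eval_fps (fps_const (C - 1) - fps_const A * fps_X) z = C - 1 - A * z"
    by (subst eval_fps_diff; (subst eval_fps_mult)?) (simp_all add: R2)
  finally show "z * (1 - z) * eval_fps (fps_deriv ?S) z + (C - 1 - A * z) * Gauss_2F1 A 1 C z = C - 1"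
    by (simp add: Gauss_2F1_def)
qed

text \<open>A power of 0 is 0 in HOL whatever the exponent, so the kernel vanishes at y = 0 and y =
  1.\<close>

definition beta_kernel :: "complex \<Rightarrow> complex \<Rightarrow> real \<Rightarrow> complex" where
  "beta_kernel p q y = of_real y powr (p - 1) * of_real (1 - y) powr (q - 1)"

text \<open>y^p (1-y)^q is an integrating factor of the equation in the last assumption. It serves
  twice: for the hypergeometric function, where R is constant, and for the Cauchy transform, where R
  also contains the boundary terms.\<close>

lemma beta_kernel_ode:
  assumes "(M has_vector_derivative M') (at y)" "0 < y" "y < 1"
    and "of_real (y * (1 - y)) * M' + (p - (p + q) * of_real y) * M y = R"
  shows "((\<lambda>y. of_real y powr p * of_real (1 - y) powr q * M y) has_vector_derivative beta_kernel
      p q y * R) (at y)"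
proof -
  have 1: "((\<lambda>y. of_real y powr p) has_vector_derivative p * of_real y powr (p - 1)) (at y)"
    using has_vector_derivative_real_field[OF has_field_derivative_powr[of "of_real y" p]] assms
    by (simp add: complex_nonpos_Reals_iff)
  have "((\<lambda>z. (1 - z) powr q) has_field_derivative - q * (1 - of_real y) powr (q - 1))
      (at (complex_of_real y))"
    using assms by (auto intro!: derivative_eq_intros simp: complex_nonpos_Reals_iff)
  from has_vector_derivative_real_field[OF this]
  have 2: "((\<lambda>y. of_real (1 - y) powr q) has_vector_derivative - q * of_real (1 - y) powr (q - 1))
      (at y)"
    by simp
  have A: "complex_of_real y powr p = of_real y * of_real y powr (p - 1)"
    using assms by (simp add: powr_diff)
  have B: "complex_of_real (1 - y) powr q = of_real (1 - y) * of_real (1 - y) powr (q - 1)"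
    using assms by (simp add: powr_diff)
  show ?thesis
  proof (rule has_vector_derivative_eq_rhs[OF has_vector_derivative_mult[OF
        has_vector_derivative_mult[OF 1 2] assms(1)]])
  qed (unfold A B beta_kernel_def assms(4)[symmetric], simp add: algebra_simps)
qed

lemma tendsto_powr_0:
  assumes "Re p > 0"
  shows "((\<lambda>y. of_real y powr p) \<longlongrightarrow> 0) (at_right 0)"
proof (rule tendsto_norm_zero_cancel)
  have "((\<lambda>y. y powr Re p) \<longlongrightarrow> 0) (at_right 0)"
    using assms by real_asymp
  then show "((\<lambda>y. norm (complex_of_real y powr p)) \<longlongrightarrow> 0) (at_right 0)"
    by (rule Lim_transform_eventually) (auto simp: norm_powr_real_powr eventually_at_filter
        intro!: always_eventually)
qed

text \<open>The integrating factor with p = C - 1 and q = A - C + 1, so that p + q = A, makes the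
  left integrand an exact derivative; Re C > 1 makes the primitive vanish at 0.\<close>

lemma Gauss_2F1_has_integral:
  fixes A C :: complex
  assumes x: "0 < x" "x < 1" and "Re A > 0" "Re C > 1"
  shows "((\<lambda>y. beta_kernel (C - 1) (A - C + 1) y * (C - 1)) has_integral
           of_real x powr (C - 1) * of_real (1 - x) powr (A - C + 1) * Gauss_2F1 A 1 C
               (of_real x)) {0..x}"
proof -
  let ?S = "fps_hypergeo [A, 1] [C] 1"
  let ?Z = "\<lambda>y. of_real y powr (C - 1) * of_real (1 - y) powr (A - C + 1) * Gauss_2F1 A 1 C (of_real y)"
  have der: "((\<lambda>y. Gauss_2F1 A 1 C (of_real y)) has_vector_derivative eval_fps (fps_deriv ?S)
      (of_real y)) (at y)"
    if "\<bar>y\<bar> < 1" for y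
    unfolding Gauss_2F1_def
    using has_vector_derivative_real_field[OF has_field_derivative_eval_fps[of "of_real y" ?S UNIV]]
      eval_hypergeo_one_ode(1)[of 0 A C] that assms by simp
  then have cont: "isCont (\<lambda>y. Gauss_2F1 A 1 C (of_real y)) y" if "\<bar>y\<bar> < 1" for y
    using has_vector_derivative_continuous that by blast
  have "((\<lambda>y. beta_kernel (C - 1) (A - C + 1) y * (C - 1)) has_integral ?Z x - 0) {0..x}"
  proof (rule has_integral_FTC_limits)
    show "(?Z has_vector_derivative beta_kernel (C - 1) (A - C + 1) y * (C - 1)) (at y)" if "0 <
        y" "y < x" for y
      using that x assms eval_hypergeo_one_ode(2)[of "of_real y" A C]
      by (intro beta_kernel_ode[OF der]) (auto simp: algebra_simps)
    have "(?Z \<longlongrightarrow> 0 * of_real (1 - 0) powr (A - C + 1) * Gauss_2F1 A 1 C (of_real 0)) (at_right 0)"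
      using cont[of 0] assms
      by (intro tendsto_intros tendsto_powr_0) (auto simp: continuous_at_imp_continuous_at_within
          complex_nonpos_Reals_iff isCont_def intro: tendsto_within_subset)
    then show "(?Z \<longlongrightarrow> 0) (at_right 0)" by simp
    show "(?Z \<longlongrightarrow> ?Z x) (at_left x)"
      using cont[of x] assms
      by (intro tendsto_intros) (auto simp: complex_nonpos_Reals_iff isCont_def intro:
          tendsto_within_subset)
  qed (use assms in auto)
  then show ?thesis by simp
qed

section \<open>The beta integral with complex parameters\<close>

lemma norm_beta_kernel:
  assumes "0 < y" "y < 1"
  shows "norm (beta_kernel p q y) = y powr (Re p - 1) * (1 - y) powr (Re q - 1)"
  using assms by (simp add: beta_kernel_def norm_mult norm_powr_real_powr)

lemma continuous_on_beta_kernel [continuous_intros]: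
  "continuous_on {0<..<1} (beta_kernel p q)"
  unfolding beta_kernel_def by (auto intro!: continuous_intros simp: complex_nonpos_Reals_iff)

lemma absolutely_integrable_beta_kernel:
  assumes "Re p > 0" "Re q > 0"
  shows "beta_kernel p q absolutely_integrable_on {0<..<1}"
proof (rule measurable_bounded_by_integrable_imp_absolutely_integrable)
  show "beta_kernel p q \<in> borel_measurable (lebesgue_on {0<..<1})"
    by (intro continuous_imp_measurable_on_sets_lebesgue continuous_on_beta_kernel) auto
  show "(\<lambda>y. y powr (Re p - 1) * (1 - y) powr (Re q - 1)) integrable_on {0<..<1}"
    using integrable_Beta'[OF assms] by (simp add: integrable_on_Icc_iff_Ioo)
  show "norm (beta_kernel p q y) \<le> y powr (Re p - 1) * (1 - y) powr (Re q - 1)" if "y \<in> {0<..<1}" for y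
    using that by (simp add: norm_beta_kernel)
qed auto

text \<open>Analytic continuation along a complex line through a real point \<open>(p, q)\<close> reduces
  the complex beta integral to the real one.\<close>

lemma holomorphic_beta_integral:
  fixes p q :: "complex \<Rightarrow> complex" and p1 p2 q1 q2 :: complex
  defines "p \<equiv> \<lambda>z. p1 + z * p2" and "q \<equiv> \<lambda>z. q1 + z * q2"
  defines "S \<equiv> {z. Re (p z) > 0 \<and> Re (q z) > 0}"
  shows "(\<lambda>z. integral {0<..<1} (beta_kernel (p z) (q z))) holomorphic_on S"
proof (rule holomorphic_uniform_sequence)
  have "S = {z. Re (p z) > 0} \<inter> {z. Re (q z) > 0}" by (auto simp: S_def)
  then show S: "open S"
    unfolding p_def q_def by (auto intro!: open_Int open_Collect_less continuous_intros)
  \<comment> \<open>Integrals over compact subintervals are holomorphic by differentiation under the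
    integral. The shift by 3 keeps the interval nondegenerate for every n, including 0.\<close>
  define f where "f n z = integral {1 / (real n + 3)..1 - 1 / (real n + 3)}
      (beta_kernel (p z) (q z))" for n z
  show "f n holomorphic_on S" for n
  proof -
    define \<alpha> \<beta> where "\<alpha> = 1 / (real n + 3)" and "\<beta> = 1 - 1 / (real n + 3)"
    have ab: "\<alpha> > 0" "\<beta> < 1" by (simp_all add: \<alpha>_def \<beta>_def)
    have "(\<lambda>z. integral (cbox \<alpha> \<beta>) (\<lambda>y. beta_kernel (p z) (q z) y)) holomorphic_on UNIV"
    proof (rule leibniz_rule_holomorphic)
      show "((\<lambda>z. beta_kernel (p z) (q z) y) has_field_derivative
              beta_kernel (p z) (q z) y * (p2 * Ln (of_real y) + q2 * Ln (of_real (1 - y))))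
                  (at z within UNIV)"
        if "y \<in> cbox \<alpha> \<beta>" for z y
        using ab that unfolding beta_kernel_def p_def q_def
        by (auto intro!: derivative_eq_intros simp: algebra_simps powr_def)
      show "beta_kernel (p z) (q z) integrable_on cbox \<alpha> \<beta>" for z
        using ab by (intro integrable_continuous continuous_on_subset[OF continuous_on_beta_kernel]) auto
      show "continuous_on (UNIV \<times> cbox \<alpha> \<beta>)
          (\<lambda>(z, y). beta_kernel (p z) (q z) y * (p2 * Ln (of_real y) + q2 * Ln (of_real (1 - y))))"
        unfolding beta_kernel_def p_def q_def case_prod_beta using ab
        by (auto intro!: continuous_intros simp: complex_nonpos_Reals_iff mem_Times_iff)
    qed auto
    then show ?thesis by (auto simp: f_def[abs_def] \<alpha>_def \<beta>_def intro: holomorphic_on_subset)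
  qed
  fix z assume "z \<in> S"
  then obtain d where d: "d > 0" "cball z d \<subseteq> S" using S open_contains_cball by blast
  \<comment> \<open>Compactness of the disc gives positive lower bounds for the real parts of both
    parameters, hence one integrable majorant \<open>h\<close> for all of its points.\<close>
  have "\<exists>\<mu>>0. \<forall>w\<in>cball z d. \<mu> \<le> Re (p w)"
  proof -
    have "compact ((\<lambda>w. Re (p w)) ` cball z d)"
      unfolding p_def by (intro compact_continuous_image continuous_intros) auto
    then obtain w0 where "w0 \<in> cball z d" "\<forall>w\<in>cball z d. Re (p w0) \<le> Re (p w)"
      using compact_attains_inf[of "(\<lambda>w. Re (p w)) ` cball z d"] d(1) by auto
    then show ?thesis using d(2) by (intro exI[of _ "Re (p w0)"]) (auto simp: S_def)
  qed
  moreover have "\<exists>\<mu>>0. \<forall>w\<in>cball z d. \<mu> \<le> Re (q w)"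
  proof -
    have "compact ((\<lambda>w. Re (q w)) ` cball z d)"
      unfolding q_def by (intro compact_continuous_image continuous_intros) auto
    then obtain w0 where "w0 \<in> cball z d" "\<forall>w\<in>cball z d. Re (q w0) \<le> Re (q w)"
      using compact_attains_inf[of "(\<lambda>w. Re (q w)) ` cball z d"] d(1) by auto
    then show ?thesis using d(2) by (intro exI[of _ "Re (q w0)"]) (auto simp: S_def)
  qed
  ultimately obtain \<mu> \<nu> where mn: "\<mu> > 0" "\<nu> > 0" "\<And>w. w \<in> cball z d \<Longrightarrow> \<mu> \<le> Re (p w)" "\<And>w. w \<in>
      cball z d \<Longrightarrow> \<nu> \<le> Re (q w)"
    by blast
  define h where "h y = y powr (\<mu> - 1) * (1 - y) powr (\<nu> - 1)" for y :: real
  have h: "h integrable_on {0<..<1}"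
    using integrable_Beta'[OF mn(1,2)] by (simp add: integrable_on_Icc_iff_Ioo h_def[abs_def])
  define I where "I n = {1 / (real n + 3)..1 - 1 / (real n + 3)}" for n :: nat
  have I_sub: "I n \<subseteq> {0<..<1}" for n
  proof
    fix y assume y: "y \<in> I n"
    have "1 / (real n + 3) > 0" by simp
    then show "y \<in> {0<..<1}" using y unfolding I_def atLeastAtMost_iff greaterThanLessThan_iff by
        linarith
  qed
  have restr: "((\<lambda>y. if y \<in> I n then F y else 0) has_integral integral (I n) F) {0<..<1}"
    if "F integrable_on {0<..<1}" for F :: "real \<Rightarrow> 'b :: euclidean_space" and n
    unfolding has_integral_restrict[OF I_sub] using that I_sub[of n]
    by (auto simp: I_def intro!: integrable_integral integrable_on_subinterval[OF that])
  \<comment> \<open>The error of the n-th approximation is at most the integral of \<open>h\<close>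
    outside \<open>I n\<close>, which does not depend on w; this gives uniform convergence on the
    disc.\<close>
  have bound: "norm (integral {0<..<1} (beta_kernel (p w) (q w)) - f n w) \<le>
      integral {0<..<1} h - integral (I n) h" if w: "w \<in> cball z d" for w n
  proof -
    let ?k = "beta_kernel (p w) (q w)"
    have k: "?k integrable_on {0<..<1}"
      using absolutely_integrable_beta_kernel[of "p w" "q w"] mn(1,2) mn(3,4)[OF w]
      by (intro set_lebesgue_integral_eq_integral) auto
    note dk = has_integral_diff[OF integrable_integral[OF k] restr[OF k]]
    note dh = has_integral_diff[OF integrable_integral[OF h] restr[OF h]]
    have "norm (integral {0<..<1} ?k - integral (I n) ?k) \<le> integral {0<..<1} h - integral (I n) h"
      unfolding dk[THEN integral_unique, symmetric] dh[THEN integral_unique, symmetric]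
    proof (rule integral_norm_bound_integral)
      fix y :: real assume y: "y \<in> {0<..<1}"
      have "norm (?k y) \<le> h y"
        unfolding h_def using y mn(3,4)[OF w] by (auto simp: norm_beta_kernel intro!: mult_mono
            powr_mono')
      then show "norm (?k y - (if y \<in> I n then ?k y else 0)) \<le> h y - (if y \<in> I n then h y else 0)"
        by simp
    qed (use dk dh in blast)+
    then show ?thesis by (simp add: f_def I_def)
  qed
  have lim: "(\<lambda>n. integral {0<..<1} h - integral (I n) h) \<longlonglongrightarrow> 0"
  proof -
    have "(\<lambda>n. integral {0<..<1} (\<lambda>y. if y \<in> I n then h y else 0)) \<longlonglongrightarrow> integral {0<..<1} h"
    proof (rule dominated_convergence[OF _ h])
      show "(\<lambda>y. if y \<in> I n then h y else 0) integrable_on {0<..<1}" for n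
        using restr[OF h] by blast
      show "norm (if y \<in> I n then h y else 0) \<le> h y" for y n by (auto simp: h_def)
      fix y :: real assume y: "y \<in> {0<..<1}"
      have "(\<lambda>n. 1 / (real n + 3)) \<longlonglongrightarrow> 0" by real_asymp
      then have "\<forall>\<^sub>F n in sequentially. 1 / (real n + 3) < min y (1 - y)"
        by (rule order_tendstoD) (use y in simp)
      then have "\<forall>\<^sub>F n in sequentially. (if y \<in> I n then h y else 0) = h y"
        by (rule eventually_mono) (auto simp: I_def)
      then show "(\<lambda>n. if y \<in> I n then h y else 0) \<longlonglongrightarrow> h y"
        by (rule tendsto_eventually)
    qed
    then have "(\<lambda>n. integral {0<..<1} h - integral {0<..<1} (\<lambda>y. if y \<in> I n then h y else 0)) \<longlonglongrightarrow>
        integral {0<..<1} h - integral {0<..<1} h"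
      by (intro tendsto_intros)
    then show ?thesis by (simp add: integral_unique[OF restr[OF h]])
  qed
  have "uniform_limit (cball z d) f (\<lambda>z. integral {0<..<1} (beta_kernel (p z) (q z))) sequentially"
    unfolding uniform_limit_iff
  proof (intro allI impI)
    fix e :: real assume "e > 0"
    from order_tendstoD(2)[OF lim this]
    show "\<forall>\<^sub>F n in sequentially. \<forall>w\<in>cball z d. dist (f n w)
        (integral {0<..<1} (beta_kernel (p w) (q w))) < e"
    proof eventually_elim
      case (elim n)
      show ?case
      proof
        fix w assume "w \<in> cball z d"
        from le_less_trans[OF bound[OF this] elim]
        show "dist (f n w) (integral {0<..<1} (beta_kernel (p w) (q w))) < e"
          by (simp add: dist_norm norm_minus_commute)
      qed
    qed
  qed
  then show "\<exists>d>0. cball z d \<subseteq> S \<and> uniform_limit (cball z d) f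
      (\<lambda>z. integral {0<..<1} (beta_kernel (p z) (q z))) sequentially"
    using d by blast
qed

text \<open>For real z the pair (p' z, q' z) is real and the real beta integral applies; at z = \<i>
  it is (p, q). The admissible set is convex and contains 0 and \<i>, and the difference of the two
  sides vanishes on a real segment around 0, so the identity theorem carries it to \<i>.\<close>

lemma has_integral_beta_kernel:
  assumes "Re p > 0" "Re q > 0"
  shows "(beta_kernel p q has_integral Beta p q) {0..1}"
proof -
  define p' where "p' z = of_real (Re p) + z * of_real (Im p)" for z :: complex
  define q' where "q' z = of_real (Re q) + z * of_real (Im q)" for z :: complex
  define S where "S = {z. Re (p' z) > 0 \<and> Re (q' z) > 0}"
  have "(\<lambda>z. integral {0<..<1} (beta_kernel (p' z) (q' z))) holomorphic_on S"
    unfolding S_def p'_def q'_def by (rule holomorphic_beta_integral)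
  moreover have "(\<lambda>z. Beta (p' z) (q' z)) holomorphic_on S"
    unfolding p'_def q'_def by (intro holomorphic_intros)
        (auto simp: S_def p'_def q'_def dest!: nonpos_Ints_Re)
  ultimately have hol: "(\<lambda>z. integral {0<..<1} (beta_kernel (p' z) (q' z)) - Beta (p' z) (q' z))
      holomorphic_on S"
    by (rule holomorphic_on_diff)
  have S_eq: "S = {z. 0 < Re (p' z)} \<inter> {z. 0 < Re (q' z)}" by (auto simp: S_def)
  have openS: "open S"
    unfolding S_eq p'_def q'_def by (auto intro!: open_Int open_Collect_less continuous_intros)
  have "convex {z. 0 < v + Re z * u}" for u v :: real
  proof -
    have "{z. 0 < v + Re z * u} = {z. inner (complex_of_real u) z > - v}"
      by (auto simp: inner_complex_def mult.commute)
    then show ?thesis by (simp only: convex_halfspace_gt)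
  qed
  then have "convex S"
    unfolding S_eq by (intro convex_Int) (simp_all add: p'_def q'_def)
  have S0: "0 \<in> S" and Si: "\<i> \<in> S" using assms by (auto simp: S_def p'_def q'_def)
  obtain \<rho> where \<rho>: "\<rho> > 0" "ball 0 \<rho> \<subseteq> S" using openS S0 open_contains_ball by blast
  have "integral {0<..<1} (beta_kernel (p' \<i>) (q' \<i>)) - Beta (p' \<i>) (q' \<i>) = 0"
  proof (rule analytic_continuation[OF hol openS])
    show "connected S" using \<open>convex S\<close> by (rule convex_connected)
    show "complex_of_real ` {-\<rho><..<\<rho>} \<subseteq> S" using \<rho>(2) by force
    show "0 islimpt complex_of_real ` {-\<rho><..<\<rho>}"
      unfolding islimpt_approachable
    proof (intro allI impI)
      fix e :: real assume "e > 0"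
      then show "\<exists>z\<in>complex_of_real ` {-\<rho><..<\<rho>}. z \<noteq> 0 \<and> dist z 0 < e"
        using \<rho>(1) by (intro bexI[of _ "of_real (min (\<rho> / 2) (e / 2))"] imageI) (auto simp: min_def)
    qed
    fix z assume "z \<in> complex_of_real ` {-\<rho><..<\<rho>}"
    then obtain t where t: "z = of_real t" "z \<in> S" using \<rho>(2) by force
    define u v where "u = Re p + t * Im p" and "v = Re q + t * Im q"
    have uv: "p' z = of_real u" "q' z = of_real v" "u > 0" "v > 0"
      using t by (auto simp: u_def v_def S_def p'_def q'_def)
    have "((\<lambda>y. of_real (y powr (u - 1) * (1 - y) powr (v - 1))) has_integral complex_of_real
        (Beta u v)) {0<..<1}"
      by (intro has_integral_of_real) (use has_integral_Beta_real[OF uv(3,4)] in \<open>simp add: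
          has_integral_Icc_iff_Ioo\<close>)
    then have "(beta_kernel (of_real u) (of_real v) has_integral complex_of_real (Beta u v)) {0<..<1}"
    proof (rule has_integral_cong[THEN iffD1, rotated])
      fix y :: real assume "y \<in> {0<..<1}"
      then show "of_real (y powr (u - 1) * (1 - y) powr (v - 1)) = beta_kernel (of_real u) (of_real v) y"
        using powr_of_real[of y "u - 1"] powr_of_real[of "1 - y" "v - 1"] by (simp add: beta_kernel_def)
    qed
    then show "integral {0<..<1} (beta_kernel (p' z) (q' z)) - Beta (p' z) (q' z) = 0"
      by (simp add: uv integral_unique Beta_complex_of_real)
  qed (use S0 Si in auto)
  moreover have "p' \<i> = p" "q' \<i> = q" by (simp_all add: p'_def q'_def complex_eq_iff)
  ultimately have "integral {0<..<1} (beta_kernel p q) = Beta p q" by simp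
  moreover have "beta_kernel p q integrable_on {0<..<1}"
    using absolutely_integrable_beta_kernel[OF assms] by (rule set_lebesgue_integral_eq_integral)
  ultimately have "(beta_kernel p q has_integral Beta p q) {0<..<1}"
    by (simp add: has_integral_iff)
  then show ?thesis by (simp add: has_integral_Icc_iff_Ioo)
qed

section \<open>The saddle point\<close>

text \<open>Series of 2 (psi(\<epsilon> + \<delta>) - psi(\<epsilon>)) / (psi''(\<epsilon>)
  \<delta>^2). The shift by 2 reflects the double zero at the saddle; the constant term Psi_2 = 1 is
  the leading 1 in the denominator of \<open>D_gen\<close>.\<close>

definition phase_fps :: "real \<Rightarrow> complex fps" where
  "phase_fps \<epsilon> = Abs_fps (\<lambda>n. 2 * Psi_ratio \<epsilon> (n + 2) / fact (n + 2))"

definition amp_fps :: "real \<Rightarrow> complex \<Rightarrow> complex \<Rightarrow> complex fps" where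
  "amp_fps \<epsilon> a c = Abs_fps (\<lambda>n. F_ratio \<epsilon> a c n / fact n)"

lemma not_nonpos_Reals_of_Re_pos: "Re z > 0 \<Longrightarrow> z \<notin> \<real>\<^sub>\<le>\<^sub>0"
  by (auto simp: complex_nonpos_Reals_iff)

lemma powr_half_square: "(z powr (1/2))\<^sup>2 = (z :: complex)"
  by (simp add: power2_eq_square flip: powr_add)

lemma psi_has_field_derivative:
  assumes "Re t > 1"
  shows "(psi \<epsilon> has_field_derivative (of_real \<epsilon> - 1) / (t - 1) - of_real \<epsilon> / t) (at t)"
proof -
  have "t \<notin> \<real>\<^sub>\<le>\<^sub>0" "t - 1 \<notin> \<real>\<^sub>\<le>\<^sub>0" "t \<noteq> 0" "t \<noteq> 1"
    using assms by (auto intro!: not_nonpos_Reals_of_Re_pos)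
  then show ?thesis unfolding psi_def[abs_def]
    by (auto intro!: derivative_eq_intros simp: divide_inverse mult.commute)
qed

lemma psi_holomorphic: "psi \<epsilon> holomorphic_on {t. Re t > 1}"
  using psi_has_field_derivative
  by (auto simp: holomorphic_on_def field_differentiable_def intro: has_field_derivative_at_within)

lemma famp_holomorphic: "famp a c holomorphic_on {t. Re t > 1}"
  unfolding famp_def
  by (intro holomorphic_intros) (auto intro!: not_nonpos_Reals_of_Re_pos)

text \<open>\<epsilon> - 1 is the distance from the saddle to the branch point t = 1, and so the
  radius used for both Taylor expansions.\<close>

lemma ball_subset_Re_gt_1:
  assumes "\<epsilon> > 1"
  shows "ball (of_real \<epsilon>) (\<epsilon> - 1) \<subseteq> {t. Re t > 1}"
proof safe
  fix t :: complex assume "t \<in> ball (of_real \<epsilon>) (\<epsilon> - 1)"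
  then show "Re t > 1"
    using abs_Re_le_cmod[of "of_real \<epsilon> - t"] by (simp add: dist_norm)
qed

section \<open>Taylor expansions of phase and amplitude at the saddle\<close>

context
  fixes \<epsilon> :: real
  assumes eps: "\<epsilon> > 1"
begin

lemma deriv_psi_saddle: "deriv (psi \<epsilon>) (of_real \<epsilon>) = 0"
  using DERIV_imp_deriv[OF psi_has_field_derivative[of "of_real \<epsilon>" \<epsilon>]] eps
  by (simp add: field_simps)

lemma psi2_eq: "psi2 \<epsilon> = - of_real (1 / (\<epsilon> * (\<epsilon> - 1)))"
proof -
  have ev: "\<forall>\<^sub>F t in nhds (of_real \<epsilon>). deriv (psi \<epsilon>) t = (of_real \<epsilon> - 1) / (t - 1) - of_real \<epsilon> / t"
  proof (rule eventually_mono)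
    show "\<forall>\<^sub>F t in nhds (of_real \<epsilon>). t \<in> ball (complex_of_real \<epsilon>) (\<epsilon> - 1)"
      using eps by (intro eventually_nhds_in_open) auto
  next
    fix t assume "t \<in> ball (complex_of_real \<epsilon>) (\<epsilon> - 1)"
    then have "Re t > 1" using ball_subset_Re_gt_1[OF eps] by auto
    then show "deriv (psi \<epsilon>) t = (of_real \<epsilon> - 1) / (t - 1) - of_real \<epsilon> / t"
      by (rule DERIV_imp_deriv[OF psi_has_field_derivative])
  qed
  have "((\<lambda>t. (of_real \<epsilon> - 1) / (t - 1) - of_real \<epsilon> / t) has_field_derivative
           - (of_real \<epsilon> - 1) / (of_real \<epsilon> - 1)\<^sup>2 + of_real \<epsilon> / (of_real \<epsilon>)\<^sup>2) (at (complex_of_real \<epsilon>))"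
    using eps by (auto intro!: derivative_eq_intros simp: power2_eq_square)
  from DERIV_imp_deriv[OF this]
  have "deriv (deriv (psi \<epsilon>)) (of_real \<epsilon>) = - (of_real \<epsilon> - 1) / (of_real \<epsilon> - 1)\<^sup>2 + of_real \<epsilon> /
      (of_real \<epsilon>)\<^sup>2"
    unfolding deriv_cong_ev[OF ev refl] .
  also have "\<dots> = of_real (- (\<epsilon> - 1) / (\<epsilon> - 1)\<^sup>2 + \<epsilon> / \<epsilon>\<^sup>2)"
    by simp
  also have "- (\<epsilon> - 1) / (\<epsilon> - 1)\<^sup>2 + \<epsilon> / \<epsilon>\<^sup>2 = - (1 / (\<epsilon> * (\<epsilon> - 1)))"
    using eps by (simp add: divide_simps power2_eq_square) (simp add: algebra_simps)
  finally show ?thesis by (simp add: psi2_def numeral_2_eq_2)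
qed

lemma psi2_nonzero: "psi2 \<epsilon> \<noteq> 0"
  using eps by (simp add: psi2_eq)

lemma famp_nonzero: "famp a c (of_real \<epsilon>) \<noteq> 0"
  using eps by (simp add: famp_def)

lemma phase_fps_altdef: "phase_fps \<epsilon> = fps_const (2 / psi2 \<epsilon>) * fps_shift 2
    (fps_expansion (psi \<epsilon>) (of_real \<epsilon>))"
  by (simp add: fps_eq_iff phase_fps_def fps_expansion_def Psi_ratio_def)

lemma amp_fps_altdef: "amp_fps \<epsilon> a c = fps_const (1 / famp a c (of_real \<epsilon>)) * fps_expansion
    (famp a c) (of_real \<epsilon>)"
  by (simp add: fps_eq_iff amp_fps_def fps_expansion_def F_ratio_def)

lemma phase_fps_0 [simp]: "fps_nth (phase_fps \<epsilon>) 0 = 1"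
  using psi2_nonzero by (simp add: phase_fps_def Psi_ratio_def) (simp add: psi2_def numeral_2_eq_2)

lemma amp_fps_0 [simp]: "fps_nth (amp_fps \<epsilon> a c) 0 = 1"
  using famp_nonzero by (simp add: amp_fps_def F_ratio_def)

lemma
  shows conv_radius_phase_fps: "ereal (\<epsilon> - 1) \<le> fps_conv_radius (phase_fps \<epsilon>)"
    and eval_phase_fps: "norm \<delta> < \<epsilon> - 1 \<Longrightarrow>
      psi2 \<epsilon> / 2 * \<delta>\<^sup>2 * eval_fps (phase_fps \<epsilon>) \<delta> = psi \<epsilon> (of_real \<epsilon> + \<delta>) - psi \<epsilon> (of_real \<epsilon>)"
proof -
  define P where "P = fps_expansion (psi \<epsilon>) (of_real \<epsilon>)"
  have hol: "psi \<epsilon> holomorphic_on eball (of_real \<epsilon>) (ereal (\<epsilon> - 1))"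
    using psi_holomorphic ball_subset_Re_gt_1[OF eps] by (auto intro: holomorphic_on_subset)
  have rP: "ereal (\<epsilon> - 1) \<le> fps_conv_radius P"
    unfolding P_def by (rule conv_radius_fps_expansion[OF hol])
  have nz: "2 / psi2 \<epsilon> \<noteq> 0" using psi2_nonzero by simp
  show "ereal (\<epsilon> - 1) \<le> fps_conv_radius (phase_fps \<epsilon>)"
    unfolding phase_fps_altdef fps_conv_radius_cmult_left[OF nz] using rP by (simp add: P_def)
  assume \<delta>: "norm \<delta> < \<epsilon> - 1"
  then have r: "ereal (norm \<delta>) < fps_conv_radius P"
    using rP by (metis ereal_less(1) less_ereal.simps(1) less_le_trans)
  have P01: "fps_nth P 0 = psi \<epsilon> (of_real \<epsilon>)" "fps_nth P 1 = 0"
    by (simp_all add: P_def fps_expansion_def deriv_psi_saddle)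
  \<comment> \<open>The coefficient at index 1 vanishes by the saddle point condition, so shifting
    by 2 loses nothing but the constant term.\<close>
  have "P = fps_const (fps_nth P 0) + fps_X ^ 2 * fps_shift 2 P"
  proof (rule fps_ext)
    fix n :: nat
    consider "n = 0" | "n = 1" | "n \<ge> 2" by linarith
    then show "fps_nth P n = fps_nth (fps_const (fps_nth P 0) + fps_X ^ 2 * fps_shift 2 P) n"
      using P01 le_add_diff_inverse2[of 2 n] by cases (auto simp: fps_X_power_mult_nth simp flip:
          add_2_eq_Suc')
  qed
  then have "eval_fps P \<delta> = eval_fps (fps_const (fps_nth P 0) + fps_X ^ 2 * fps_shift 2 P) \<delta>"
    by simp
  also have "\<dots> = fps_nth P 0 + \<delta>\<^sup>2 * eval_fps (fps_shift 2 P) \<delta>"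
  proof -
    have R: "ereal (norm \<delta>) < fps_conv_radius (fps_X ^ 2 * fps_shift 2 P)"
      by (rule less_le_trans[OF _ fps_conv_radius_mult]) (use r in simp)
    show ?thesis using r R by (simp add: eval_fps_add eval_fps_mult)
  qed
  also have "eval_fps P \<delta> = psi \<epsilon> (of_real \<epsilon> + \<delta>)"
    unfolding P_def by (rule eval_fps_expansion'[OF hol]) (use \<delta> in auto)
  finally have "\<delta>\<^sup>2 * eval_fps (fps_shift 2 P) \<delta> = psi \<epsilon> (of_real \<epsilon> + \<delta>) - psi \<epsilon> (of_real \<epsilon>)"
    by (simp add: P01)
  moreover have "eval_fps (phase_fps \<epsilon>) \<delta> = 2 / psi2 \<epsilon> * eval_fps (fps_shift 2 P) \<delta>"
    unfolding phase_fps_altdef using r by (simp add: P_def eval_fps_mult)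
  ultimately show "psi2 \<epsilon> / 2 * \<delta>\<^sup>2 * eval_fps (phase_fps \<epsilon>) \<delta> = psi \<epsilon> (of_real \<epsilon> + \<delta>) - psi \<epsilon>
      (of_real \<epsilon>)"
    using psi2_nonzero by simp
qed

lemma
  shows conv_radius_amp_fps: "ereal (\<epsilon> - 1) \<le> fps_conv_radius (amp_fps \<epsilon> a c)"
    and eval_amp_fps: "norm \<delta> < \<epsilon> - 1 \<Longrightarrow>
      eval_fps (amp_fps \<epsilon> a c) \<delta> = famp a c (of_real \<epsilon> + \<delta>) / famp a c (of_real \<epsilon>)"
proof -
  define P where "P = fps_expansion (famp a c) (of_real \<epsilon>)"
  have hol: "famp a c holomorphic_on eball (of_real \<epsilon>) (ereal (\<epsilon> - 1))"
    using famp_holomorphic ball_subset_Re_gt_1[OF eps] by (auto intro: holomorphic_on_subset)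
  have rP: "ereal (\<epsilon> - 1) \<le> fps_conv_radius P"
    unfolding P_def by (rule conv_radius_fps_expansion[OF hol])
  have nz: "1 / famp a c (of_real \<epsilon>) \<noteq> 0" using famp_nonzero by simp
  show "ereal (\<epsilon> - 1) \<le> fps_conv_radius (amp_fps \<epsilon> a c)"
    unfolding amp_fps_altdef fps_conv_radius_cmult_left[OF nz] using rP by (simp add: P_def)
  assume \<delta>: "norm \<delta> < \<epsilon> - 1"
  then have r: "ereal (norm \<delta>) < fps_conv_radius P"
    using rP by (metis ereal_less(1) less_ereal.simps(1) less_le_trans)
  have "eval_fps P \<delta> = famp a c (of_real \<epsilon> + \<delta>)"
    unfolding P_def by (rule eval_fps_expansion'[OF hol]) (use \<delta> in auto)
  then show "eval_fps (amp_fps \<epsilon> a c) \<delta> = famp a c (of_real \<epsilon> + \<delta>) / famp a c (of_real \<epsilon>)"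
    unfolding amp_fps_altdef using r by (simp add: P_def eval_fps_mult)
qed

lemma D_gen_eq:
  assumes "norm \<delta> < \<epsilon> - 1"
  shows "D_gen \<epsilon> a c k \<delta> = eval_fps (amp_fps \<epsilon> a c) \<delta> / eval_fps (phase_fps \<epsilon>) \<delta> powr (of_nat k + 1 / 2)"
proof -
  have *: "1 + (\<Sum>i. fps_nth F (i + 1) * \<delta> ^ (i + 1)) = eval_fps F \<delta>"
    if "fps_nth F 0 = 1" "ereal (\<epsilon> - 1) \<le> fps_conv_radius F" for F
  proof -
    have "summable (\<lambda>n. fps_nth F n * \<delta> ^ n)"
      using that(2) assms by (intro summable_fps) (metis less_ereal.simps(1) less_le_trans)
    then show ?thesis
      unfolding eval_fps_def using suminf_split_initial_segment[of "\<lambda>n. fps_nth F n * \<delta> ^ n" 1]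
          that(1) by simp
  qed
  show ?thesis
    using *[OF amp_fps_0 conv_radius_amp_fps] *[OF phase_fps_0 conv_radius_phase_fps]
    unfolding D_gen_def by (simp add: amp_fps_def phase_fps_def numeral_3_eq_3)
qed

text \<open>Half-integer powers of the phase series are handled as odd powers of this root; the
  principal branch fixes its constant term as 1.\<close>

definition root_fps :: "complex fps" where
  "root_fps = fps_expansion (\<lambda>\<delta>. eval_fps (phase_fps \<epsilon>) \<delta> powr (1/2)) 0"

lemma has_fps_expansion_phase: "eval_fps (phase_fps \<epsilon>) has_fps_expansion phase_fps \<epsilon>"
  by (rule eval_fps_has_fps_expansion, rule less_le_trans[OF _ conv_radius_phase_fps])
     (use eps in \<open>simp add: zero_ereal_def\<close>)

lemma has_fps_expansion_amp: "eval_fps (amp_fps \<epsilon> a c) has_fps_expansion amp_fps \<epsilon> a c"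
  by (rule eval_fps_has_fps_expansion, rule less_le_trans[OF _ conv_radius_amp_fps])
     (use eps in \<open>simp add: zero_ereal_def\<close>)

lemma has_fps_expansion_root:
  "(\<lambda>\<delta>. eval_fps (phase_fps \<epsilon>) \<delta> powr (1/2)) has_fps_expansion root_fps"
  unfolding root_fps_def
  by (intro analytic_at_imp_has_fps_expansion_0 analytic_intros
      has_fps_expansion_imp_analytic_0[OF has_fps_expansion_phase])
     (auto simp: eval_fps_at_0)

lemma root_fps_0: "fps_nth root_fps 0 = 1"
  using has_fps_expansion_imp_0_eq_fps_nth_0[OF has_fps_expansion_root] by (simp add: eval_fps_at_0)

lemma phase_nonzero_ev: "\<forall>\<^sub>F \<delta> in nhds 0. eval_fps (phase_fps \<epsilon>) \<delta> \<noteq> 0"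
  using has_fps_expansion_imp_continuous[OF has_fps_expansion_phase, of UNIV]
  by (intro tendsto_imp_eventually_ne[of _ 1])
     (simp_all add: isCont_def eval_fps_at_0 tendsto_nhds_iff)

lemma root_fps_square: "root_fps\<^sup>2 = phase_fps \<epsilon>"
proof (rule fps_expansion_unique_complex)
  show "(\<lambda>\<delta>. (eval_fps (phase_fps \<epsilon>) \<delta> powr (1/2))\<^sup>2) has_fps_expansion root_fps\<^sup>2"
    by (intro fps_expansion_intros has_fps_expansion_root)
  show "(\<lambda>\<delta>. (eval_fps (phase_fps \<epsilon>) \<delta> powr (1/2))\<^sup>2) has_fps_expansion phase_fps \<epsilon>"
    unfolding powr_half_square by (rule has_fps_expansion_phase)
qed

text \<open>As k is an integer, Q powr (k + 1/2) = Q^k * Q powr (1/2) holds for principal powers at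
  every nonzero Q, so the half-integer power is an odd power of the root without any branch
  condition.\<close>

lemma D_coeff_eq: "D_coeff \<epsilon> a c s k = fps_nth (amp_fps \<epsilon> a c * inverse root_fps ^ (2 * k + 1)) s"
proof -
  have "(\<lambda>\<delta>. eval_fps (amp_fps \<epsilon> a c) \<delta> * inverse (eval_fps (phase_fps \<epsilon>) \<delta> powr (1/2)) ^ (2 * k + 1))
      has_fps_expansion amp_fps \<epsilon> a c * inverse root_fps ^ (2 * k + 1)"
    by (intro fps_expansion_intros has_fps_expansion_root has_fps_expansion_amp) (simp add: root_fps_0)
  also have "?this \<longleftrightarrow> D_gen \<epsilon> a c k has_fps_expansion amp_fps \<epsilon> a c * inverse root_fps ^ (2 * k + 1)"
  proof (rule has_fps_expansion_cong[OF _ refl])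
    have "\<forall>\<^sub>F \<delta> in nhds 0. \<delta> \<in> ball (0::complex) (\<epsilon> - 1)"
      using eps by (intro eventually_nhds_in_open) auto
    with phase_nonzero_ev show "\<forall>\<^sub>F \<delta> in nhds 0. eval_fps (amp_fps \<epsilon> a c) \<delta> * inverse
        (eval_fps (phase_fps \<epsilon>) \<delta> powr (1/2)) ^ (2 * k + 1) = D_gen \<epsilon> a c k \<delta>"
    proof eventually_elim
      case (elim \<delta>)
      let ?Q = "eval_fps (phase_fps \<epsilon>) \<delta>"
      have "?Q powr (of_nat k + 1 / 2) = ?Q ^ k * ?Q powr (1/2)"
        using elim by (simp add: powr_add powr_nat')
      also have "?Q ^ k = (?Q powr (1/2)) ^ (2 * k)"
        unfolding power_mult powr_half_square ..
      finally show ?case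
        using elim by (subst D_gen_eq) (auto simp: field_simps)
    qed
  qed
  finally show ?thesis
    unfolding D_coeff_def fps_expansion_def by (simp only: fps_nth_fps_expansion fps_nth_Abs_fps)
qed

end

section \<open>Cauchy transform along the steepest path\<close>

text \<open>
  The path \<open>\<gamma>\<close> is the image of the imaginary axis under \<open>w \<mapsto> t(w)\<close>, where
  \<open>w\<^sup>2 = 2 (\<psi>(t) - \<psi>(\<epsilon>)) / \<psi>''(\<epsilon>)\<close>, and \<open>K(w) = w f(t) t'(w) / ((t - \<epsilon>) f(\<epsilon>))\<close>.
\<close>

locale saddle_path =
  fixes \<epsilon> :: real and a c :: complex and r R :: real
    and \<gamma> \<gamma>' q :: "real \<Rightarrow> complex" and K :: "complex \<Rightarrow> complex" and B :: real
  assumes eps: "\<epsilon> > 1" and r: "0 < r" "r < R"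
    and K_hol: "K holomorphic_on ball 0 R" and K0: "K 0 = 1"
    and K_odd: "\<And>k. fps_nth (fps_expansion K 0) (2 * k + 1) = D_coeff \<epsilon> a c (2 * k + 1) k"
    and q_cont: "continuous_on {-r..r} q" and q0: "q 0 = \<i>"
    and q_Im: "\<And>v. v \<in> {-r..r} \<Longrightarrow> Im (q v) \<ge> 1/2"
    and q_Lipschitz: "\<And>v. v \<in> {-r..r} \<Longrightarrow> norm (q v - \<i>) \<le> B * \<bar>v\<bar>"
    and path_eq: "\<And>v. v \<in> {-r..r} \<Longrightarrow> \<gamma> v = of_real \<epsilon> + of_real v * q v"
    and path_deriv: "\<And>v. v \<in> {-r..r} \<Longrightarrow> (\<gamma> has_vector_derivative \<gamma>' v) (at v)"
    and path_deriv_cont: "continuous_on {-r..r} \<gamma>'"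
    and path_Re: "\<And>v. v \<in> {-r..r} \<Longrightarrow> Re (\<gamma> v) > 1"
    and psi_path: "\<And>v. v \<in> {-r..r} \<Longrightarrow> psi \<epsilon> (\<gamma> v) = psi \<epsilon> (of_real \<epsilon>) - psi2 \<epsilon> / 2 * of_real v ^ 2"
    and famp_path: "\<And>v. v \<in> {-r..r} \<Longrightarrow> famp a c (\<gamma> v) * \<gamma>' v = famp a c (of_real \<epsilon>) * K
        (\<i> * of_real v) * q v"

text \<open>With u the root of the phase series, \<phi>(\<delta>) = \<delta> u(\<delta>) is
  invertible near 0, and its inverse g gives t = \<epsilon> + g(w). Then w / (t - \<epsilon>) =
  u(g(w)), which removes the apparent pole of K and shows that q v = (\<gamma> v - \<epsilon>) / v
  extends to v = 0 as \<i> / u(g(\<i> v)).\<close>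

lemma saddle_path_exists:
  assumes eps: "\<epsilon> > 1"
  shows "\<exists>r R \<gamma> \<gamma>' q K B. saddle_path \<epsilon> a c r R \<gamma> \<gamma>' q K B"
proof -
  let ?Q = "eval_fps (phase_fps \<epsilon>)"
  let ?F = "eval_fps (amp_fps \<epsilon> a c)"
  define u where "u \<delta> = ?Q \<delta> powr (1/2)" for \<delta>
  define \<phi> where "\<phi> \<delta> = \<delta> * u \<delta>" for \<delta>
  have sub: "ball (0::complex) (\<epsilon> - 1) \<subseteq> eball 0 R" if "ereal (\<epsilon> - 1) \<le> R" for R
  proof
    fix z :: complex assume "z \<in> ball 0 (\<epsilon> - 1)"
    then have "ereal (norm z) < ereal (\<epsilon> - 1)" by simp
    also note that
    finally show "z \<in> eball 0 R" by (simp add: in_eball_iff)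
  qed
  have Q_hol: "?Q holomorphic_on ball 0 (\<epsilon> - 1)" and F_hol: "?F holomorphic_on ball 0 (\<epsilon> - 1)"
    by (intro holomorphic_on_eval_fps sub conv_radius_phase_fps conv_radius_amp_fps eps)+
  have Q_cont: "isCont ?Q 0"
    using has_fps_expansion_imp_continuous[OF has_fps_expansion_phase[OF eps]] .
  have "\<forall>\<^sub>F \<delta> in nhds 0. Re (?Q \<delta>) > 0"
    using isCont_Re[OF Q_cont] phase_fps_0[OF eps]
    by (intro order_tendstoD(1)[where y = 1]) (auto simp: isCont_def tendsto_nhds_iff eval_fps_at_0)
  then obtain \<rho>0 where \<rho>0: "\<rho>0 > 0" "\<And>\<delta>. norm \<delta> < \<rho>0 \<Longrightarrow> Re (?Q \<delta>) > 0"
    by (auto simp: eventually_nhds_metric dist_norm)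
  define \<rho> where "\<rho> = min \<rho>0 (\<epsilon> - 1)"
  have \<rho>: "\<rho> > 0" "\<rho> \<le> \<epsilon> - 1" "\<And>\<delta>. \<delta> \<in> ball 0 \<rho> \<Longrightarrow> Re (?Q \<delta>) > 0"
    using \<rho>0 eps by (auto simp: \<rho>_def)
  \<comment> \<open>On this disc the phase series has positive real part and stays off the branch
    cut, so its principal root is holomorphic and nonzero.\<close>
  have u_hol: "u holomorphic_on ball 0 \<rho>"
    unfolding u_def using \<rho>
    by (intro holomorphic_intros holomorphic_on_subset[OF Q_hol])
        (auto intro!: not_nonpos_Reals_of_Re_pos)
  have u_nz: "u \<delta> \<noteq> 0" if "\<delta> \<in> ball 0 \<rho>" for \<delta>
    using \<rho>(3)[OF that] by (auto simp: u_def)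
  have u0: "u 0 = 1" using phase_fps_0[OF eps] by (simp add: u_def eval_fps_at_0)
  have F0: "?F 0 = 1" using amp_fps_0[OF eps] by (simp add: eval_fps_at_0)
  have u2: "(u \<delta>)\<^sup>2 = ?Q \<delta>" for \<delta> by (simp add: u_def powr_half_square)
  have \<phi>_hol: "\<phi> holomorphic_on ball 0 \<rho>"
    unfolding \<phi>_def by (intro holomorphic_intros u_hol)
  have \<phi>0: "\<phi> 0 = 0" by (simp add: \<phi>_def)
  have "(u has_field_derivative deriv u 0) (at 0)"
    using u_hol \<rho>(1) by (intro holomorphic_derivI) auto
  then have "(\<phi> has_field_derivative 1 * u 0 + 0 * deriv u 0) (at 0)"
    unfolding \<phi>_def[abs_def] by (auto intro!: derivative_eq_intros)
  then have \<phi>'0: "deriv \<phi> 0 = 1" by (simp add: DERIV_imp_deriv u0)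
  have "0 \<in> ball (0::complex) \<rho>" "deriv \<phi> 0 \<noteq> 0" using \<rho>(1) \<phi>'0 by simp_all
  then obtain s where s: "s > 0" "ball (0::complex) s \<subseteq> ball 0 \<rho>" "open (\<phi> ` ball 0 s)" "inj_on \<phi>
      (ball 0 s)"
    using has_complex_derivative_locally_invertible[OF \<phi>_hol _ open_ball] by metis
  obtain g where g: "g holomorphic_on (\<phi> ` ball 0 s)"
     "\<And>z. z \<in> ball 0 s \<Longrightarrow> deriv \<phi> z * deriv g (\<phi> z) = 1" "\<And>z. z \<in> ball 0 s \<Longrightarrow> g (\<phi> z) = z"
    using holomorphic_has_inverse[OF holomorphic_on_subset[OF \<phi>_hol s(2)] open_ball s(4)] by metis
  have "0 \<in> \<phi> ` ball 0 s" using \<phi>0 s(1) by (metis centre_in_ball image_eqI)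
  then obtain R where R: "R > 0" "ball 0 R \<subseteq> \<phi> ` ball 0 s"
    using s(3) open_contains_ball by blast
  have g_in: "g w \<in> ball 0 s" and \<phi>g: "\<phi> (g w) = w" if "w \<in> ball 0 R" for w
    using R(2) g(3) that by auto
  have g_hol: "g holomorphic_on ball 0 R" by (rule holomorphic_on_subset[OF g(1) R(2)])
  have g0: "g 0 = 0" using g(3)[of 0] s(1) \<phi>0 by simp
  define K where "K w = u (g w) * ?F (g w) * deriv g w" for w
  have ug_hol: "(\<lambda>w. u (g w)) holomorphic_on ball 0 R"
    by (rule holomorphic_on_compose_gen[OF g_hol u_hol, unfolded o_def]) (use g_in s(2) in blast)
  have "ball (0::complex) s \<subseteq> ball 0 (\<epsilon> - 1)"
    using s(2) subset_ball[OF \<rho>(2), of 0] by (rule subset_trans)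
  then have "g ` ball 0 R \<subseteq> ball 0 (\<epsilon> - 1)"
    using g_in by blast
  then have Fg_hol: "(\<lambda>w. ?F (g w)) holomorphic_on ball 0 R"
    by (rule holomorphic_on_compose_gen[OF g_hol F_hol, unfolded o_def])
  have K_hol: "K holomorphic_on ball 0 R"
    unfolding K_def by (intro holomorphic_intros ug_hol Fg_hol g_hol) auto
  have g'0: "deriv g 0 = 1" using g(2)[of 0] s(1) \<phi>0 \<phi>'0 by simp
  have K0: "K 0 = 1" by (simp add: K_def g0 u0 F0 g'0)

  \<comment> \<open>\<open>deriv g\<close> at \<phi>(\<delta>) cancels \<phi>'(\<delta>), so
    K(\<phi>) \<phi>' is the product of root and amplitude. The residue lemma at n = 2k + 1 divides
    by the power 2k + 2 of the root, which leaves the amplitude over the power 2k + 1.\<close>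
  have K_odd: "fps_nth (fps_expansion K 0) (2 * k + 1) = D_coeff \<epsilon> a c (2 * k + 1) k" for k
  proof -
    let ?U = "root_fps \<epsilon>" and ?A = "amp_fps \<epsilon> a c" and ?k = "fps_expansion K 0"
    have U0: "fps_nth ?U 0 = 1" by (rule root_fps_0[OF eps])
    have U: "u has_fps_expansion ?U"
      unfolding u_def by (rule has_fps_expansion_root[OF eps])
    have \<phi>_fps: "\<phi> has_fps_expansion fps_X * ?U"
      unfolding \<phi>_def by (intro fps_expansion_intros U)
    have K_fps: "K has_fps_expansion ?k"
      using K_hol R(1) by (intro has_fps_expansion_fps_expansion[of "ball 0 R"]) auto
    have "(\<lambda>\<delta>. (K \<circ> \<phi>) \<delta> * deriv \<phi> \<delta>) has_fps_expansion (fps_compose ?k (fps_X * ?U)) * fps_deriv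
        (fps_X * ?U)"
      by (intro has_fps_expansion_mult has_fps_expansion_compose has_fps_expansion_deriv K_fps
          \<phi>_fps) simp
    moreover have "(\<lambda>\<delta>. (K \<circ> \<phi>) \<delta> * deriv \<phi> \<delta>) has_fps_expansion ?U * ?A"
    proof -
      have ev: "\<forall>\<^sub>F \<delta> in nhds 0. (K \<circ> \<phi>) \<delta> * deriv \<phi> \<delta> = u \<delta> * ?F \<delta>"
        using eventually_nhds_in_open[of "ball 0 s" "0::complex"] s(1)
        by (auto elim!: eventually_mono simp: K_def g mult_ac)
      show ?thesis
        unfolding has_fps_expansion_cong[OF ev refl] by
            (rule has_fps_expansion_mult[OF U has_fps_expansion_amp[OF eps]])
    qed
    ultimately have eq: "fps_compose ?k (fps_X * ?U) * fps_deriv (fps_X * ?U) = ?U * ?A"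
      by (rule fps_expansion_unique_complex)
    have "fps_nth ?k (2 * k + 1) = fps_nth (?U * ?A * inverse ?U ^ Suc (2 * k + 1)) (2 * k + 1)"
      using fps_compose_residue[OF U0, of ?k "2 * k + 1"] unfolding eq by simp
    also have "?U * ?A * inverse ?U ^ Suc (2 * k + 1) = (?U * inverse ?U) *
        (?A * inverse ?U ^ (2 * k + 1))"
      by (simp add: mult_ac)
    also have "?U * inverse ?U = 1" using U0 by (simp add: inverse_mult_eq_1')
    finally show ?thesis by (simp add: D_coeff_eq[OF eps])
  qed

  define h where "h w = \<i> / u (g w)" for w
  have h_hol: "h holomorphic_on ball 0 R"
    unfolding h_def using g_in s(2) u_nz by (intro holomorphic_intros ug_hol) blast+
  have h0: "h 0 = \<i>" by (simp add: h_def g0 u0)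
  have "(h has_field_derivative deriv h 0) (at 0)"
    using h_hol R(1) by (intro holomorphic_derivI) auto
  then have "((\<lambda>w. norm ((h w - h 0) / (w - 0))) \<longlongrightarrow> norm (deriv h 0)) (at 0)"
    unfolding has_field_derivative_iff by (rule tendsto_norm)
  then have "\<forall>\<^sub>F w in at 0. norm ((h w - h 0) / (w - 0)) < norm (deriv h 0) + 1"
    by (rule order_tendstoD) simp
  then obtain d where d: "d > 0" "\<And>w. w \<noteq> 0 \<Longrightarrow> norm w < d \<Longrightarrow> norm ((h w - h 0) / (w - 0)) < norm
      (deriv h 0) + 1"
    by (auto simp: eventually_at dist_norm)
  define B where "B = norm (deriv h 0) + 1"
  have B: "B > 0" by (simp add: B_def add_nonneg_pos)
  have h_Lip: "norm (h w - \<i>) \<le> B * norm w" if "norm w < d" for w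
    using d(2)[of w] that h0 by (cases "w = 0") (auto simp: B_def norm_divide field_simps)
  \<comment> \<open>The three bounds keep \<i> v in the domain of g, keep it in the disc where the
    Lipschitz bound for h holds, and force B r \<le> 1/2, whence Im (q v) \<ge> 1/2.\<close>
  define r where "r = min (R / 2) (min (d / 2) (1 / (2 * B)))"
  have r: "0 < r" "r < R" "r < d" "B * r \<le> 1/2"
  proof -
    have "r \<le> R / 2" "r \<le> d / 2" "r \<le> 1 / (2 * B)" by (simp_all add: r_def)
    then show "r < R" "r < d" using R(1) d(1) by linarith+
    show "0 < r" using R(1) d(1) B by (simp add: r_def)
    have "B * r \<le> B * (1 / (2 * B))"
      using \<open>r \<le> 1 / (2 * B)\<close> B by (intro mult_left_mono) auto
    then show "B * r \<le> 1/2" using B by simp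
  qed
  define q where "q v = h (\<i> * of_real v)" for v :: real
  define \<gamma> where "\<gamma> v = of_real \<epsilon> + g (\<i> * of_real v)" for v :: real
  define \<gamma>' where "\<gamma>' v = deriv g (\<i> * of_real v) * \<i>" for v :: real
  have iv: "\<i> * of_real v \<in> ball 0 R" if "v \<in> {-r..r}" for v :: real
    using that r by (auto simp: norm_mult)
  have cont_iv: "continuous_on {-r..r} (\<lambda>v. G (\<i> * complex_of_real v))" if "G holomorphic_on ball
      0 R" for G
    by (rule continuous_on_compose2[OF holomorphic_on_imp_continuous_on[OF that]])
       (use iv in \<open>auto intro!: continuous_intros\<close>)
  have g_small: "norm (g w) < \<epsilon> - 1" if "w \<in> ball 0 R" for w
    using g_in[OF that] s(2) \<rho>(2) by force
  have "saddle_path \<epsilon> a c r R \<gamma> \<gamma>' q K B"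
  proof
    show "continuous_on {-r..r} q" unfolding q_def by (rule cont_iv[OF h_hol])
    show "q 0 = \<i>" by (simp add: q_def h0)
    show "continuous_on {-r..r} \<gamma>'" unfolding \<gamma>'_def
      by (intro continuous_intros cont_iv holomorphic_deriv g_hol) auto
  next
    fix v assume v: "v \<in> {-r..r}"
    note w = iv[OF v]
    show Lip: "norm (q v - \<i>) \<le> B * \<bar>v\<bar>"
    proof -
      have "norm (\<i> * of_real v :: complex) < d" using v r by (auto simp: norm_mult abs_le_iff)
      from h_Lip[OF this] show ?thesis by (simp add: q_def norm_mult)
    qed
    have "\<bar>Im (q v) - 1\<bar> \<le> norm (q v - \<i>)" using abs_Im_le_cmod[of "q v - \<i>"] by simp
    also note Lip
    also have "B * \<bar>v\<bar> \<le> B * r" using v B by (intro mult_left_mono) auto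
    finally show "Im (q v) \<ge> 1/2" using r(4) by linarith
    have "g (\<i> * of_real v) * u (g (\<i> * of_real v)) = \<i> * of_real v"
      using \<phi>g[OF w] by (simp add: \<phi>_def)
    moreover have unz: "u (g (\<i> * of_real v)) \<noteq> 0" using u_nz g_in[OF w] s(2) by blast
    ultimately show "\<gamma> v = of_real \<epsilon> + of_real v * q v"
      by (simp add: \<gamma>_def q_def h_def field_simps)
    have "(g has_field_derivative deriv g (\<i> * of_real v)) (at (\<i> * of_real v))"
      using g_hol w by (intro holomorphic_derivI) auto
    then have "((\<lambda>z. of_real \<epsilon> + g (\<i> * z)) has_field_derivative \<gamma>' v) (at (of_real v))"
      unfolding \<gamma>'_def by (auto intro!: derivative_eq_intros DERIV_chain2[of g])
    from has_vector_derivative_real_field[OF this]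
    show "(\<gamma> has_vector_derivative \<gamma>' v) (at v)" by (simp add: \<gamma>_def[abs_def])
    show "Re (\<gamma> v) > 1"
      using g_small[OF w] abs_Re_le_cmod[of "g (\<i> * of_real v)"] by (simp add: \<gamma>_def)
    have "(g (\<i> * of_real v))\<^sup>2 * ?Q (g (\<i> * of_real v)) = (\<phi> (g (\<i> * of_real v)))\<^sup>2"
      by (simp add: \<phi>_def power_mult_distrib u2)
    also have "\<dots> = - (of_real v)\<^sup>2" by (simp add: \<phi>g[OF w] power_mult_distrib)
    finally have "psi2 \<epsilon> / 2 * (- (of_real v)\<^sup>2) = psi \<epsilon> (\<gamma> v) - psi \<epsilon> (of_real \<epsilon>)"
      using eval_phase_fps[OF eps g_small[OF w]] by (simp add: \<gamma>_def mult.assoc)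
    then show "psi \<epsilon> (\<gamma> v) = psi \<epsilon> (of_real \<epsilon>) - psi2 \<epsilon> / 2 * of_real v ^ 2"
      by (simp add: algebra_simps)
    show "famp a c (\<gamma> v) * \<gamma>' v = famp a c (of_real \<epsilon>) * K (\<i> * of_real v) * q v"
      using eval_amp_fps[OF eps g_small[OF w], of a c] unz famp_nonzero[OF eps, of a c]
      by (simp add: K_def q_def h_def \<gamma>_def \<gamma>'_def)
  qed (use eps r K_hol K0 K_odd in auto)
  then show ?thesis by blast
qed

text \<open>X + Y differs from 2 pi \<i> by at most 2 \<delta>, so its modulus is at least 1, and
  the quotient is linear in V up to O(\<delta>). This takes the place of dividing by an asymptotic
  series.\<close>

lemma perturbed_ratio:
  fixes X Y V :: complex
  assumes X: "norm (X - (\<i> * of_real pi - V)) \<le> \<delta>" and Y: "norm (Y - (\<i> * of_real pi + V)) \<le> \<delta>"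
    and \<delta>: "2 * \<delta> \<le> 1" and V: "norm V \<le> W"
  shows "X + Y \<noteq> 0" and "norm ((Y - X) / (X + Y) - V / (\<i> * of_real pi)) \<le> (2 + W) * \<delta>"
proof -
  define e1 e2 where "e1 = X - (\<i> * of_real pi - V)" and "e2 = Y - (\<i> * of_real pi + V)"
  have e: "norm e1 \<le> \<delta>" "norm e2 \<le> \<delta>" using X Y by (simp_all add: e1_def e2_def)
  have \<delta>0: "\<delta> \<ge> 0" using e(1) norm_ge_zero order.trans by blast
  have sum: "X + Y = 2 * \<i> * of_real pi + (e1 + e2)" and diff: "Y - X = 2 * V + (e2 - e1)"
    by (simp_all add: e1_def e2_def)
  have "norm (2 * \<i> * of_real pi :: complex) \<le> norm (X + Y) + norm (e1 + e2)"
    using norm_triangle_ineq4[of "X + Y" "e1 + e2"] by (simp add: sum)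
  moreover have "norm (2 * \<i> * of_real pi :: complex) = 2 * pi" by (simp add: norm_mult)
  moreover have "norm (e1 + e2) \<le> 2 * \<delta>" "norm (e2 - e1) \<le> 2 * \<delta>"
    using norm_triangle_ineq[of e1 e2] norm_triangle_ineq4[of e2 e1] e by simp_all
  ultimately have n: "norm (X + Y) \<ge> 1" and ee: "norm (e1 + e2) \<le> 2 * \<delta>" "norm (e2 - e1) \<le> 2 * \<delta>"
    using \<delta> pi_gt3 by linarith+
  then show nz: "X + Y \<noteq> 0" by auto
  have "(Y - X) / (X + Y) - V / (\<i> * of_real pi) = ((e2 - e1) - (e1 + e2) *
      (V / (\<i> * of_real pi))) / (X + Y)"
  proof -
    define U where "U = V / (\<i> * of_real pi)"
    have "V = U * (\<i> * of_real pi)" by (simp add: U_def)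
    then have "U * (X + Y) = 2 * V + (e1 + e2) * U"
      unfolding sum by (simp add: algebra_simps)
    then have "(Y - X) - U * (X + Y) = (e2 - e1) - (e1 + e2) * U" by (simp add: diff)
    moreover have "(Y - X) / (X + Y) - U = ((Y - X) - U * (X + Y)) / (X + Y)"
      using nz by (simp add: diff_divide_distrib)
    ultimately show ?thesis by (simp add: U_def)
  qed
  also have "norm \<dots> = norm ((e2 - e1) - (e1 + e2) * (V / (\<i> * of_real pi))) / norm (X + Y)"
    by (rule norm_divide)
  also have "\<dots> \<le> norm ((e2 - e1) - (e1 + e2) * (V / (\<i> * of_real pi))) / 1"
    using n by (intro divide_left_mono) auto
  also have "\<dots> \<le> norm (e2 - e1) + norm (e1 + e2) * (norm V / pi)"
    using norm_triangle_ineq4[of "e2 - e1" "(e1 + e2) * (V / (\<i> * of_real pi))"] by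
        (simp add: norm_mult norm_divide)
  also have "\<dots> \<le> 2 * \<delta> + (2 * \<delta>) * (W / 2)"
    using ee V \<delta>0 pi_gt3 by (intro add_mono mult_mono frac_le) (auto intro: order.trans[OF norm_ge_zero])
  finally show "norm ((Y - X) / (X + Y) - V / (\<i> * of_real pi)) \<le> (2 + W) * \<delta>"
    by (simp add: algebra_simps)
qed

section \<open>Differential equation of the Cauchy transform\<close>

context saddle_path
begin

definition beta_p :: "real \<Rightarrow> complex" where "beta_p l = c + of_real l - 1"
definition beta_q :: "real \<Rightarrow> complex" where "beta_q l = 1 + a - c + (of_real \<epsilon> - 1) * of_real l"

text \<open>With p = \<open>beta_p l\<close> and q = \<open>beta_q l\<close>, so that p + q = a +
  \<epsilon> l, this is t^(p+q-1) (t-1)^(-q). The factor exp(-l psi) is kept apart because it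
  becomes Gaussian on the path.\<close>

definition \<rho> :: "real \<Rightarrow> complex \<Rightarrow> complex" where
  "\<rho> l t = famp a c t * exp (- of_real l * psi \<epsilon> t)"

lemma \<rho>_deriv:
  assumes "Re t > 1"
  shows "(\<rho> l has_field_derivative \<rho> l t * ((beta_p l + beta_q l - 1) / t - beta_q l / (t - 1))) (at t)"
proof -
  have nz: "t \<notin> \<real>\<^sub>\<le>\<^sub>0" "t - 1 \<notin> \<real>\<^sub>\<le>\<^sub>0" "t \<noteq> 0" "t - 1 \<noteq> 0"
    using assms by (auto intro!: not_nonpos_Reals_of_Re_pos)
  have pw: "((\<lambda>z. z powr s) has_field_derivative z powr s * (s / z)) (at z)" if "z \<notin> \<real>\<^sub>\<le>\<^sub>0" for s
      z :: complex
  proof -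
    have "z \<noteq> 0" using that by auto
    then show ?thesis
      using has_field_derivative_powr[OF that, of s] by (simp add: powr_diff mult.commute)
  qed
  have "((\<lambda>t. (t - 1) powr (c - a - 1)) has_field_derivative
          (t - 1) powr (c - a - 1) * ((c - a - 1) / (t - 1)) * (1 - 0)) (at t)"
    by (rule DERIV_chain2[where f = "\<lambda>z. z powr (c - a - 1)" and g = "\<lambda>t. t - 1", OF
        pw[OF nz(2)]]) (intro derivative_intros)
  from DERIV_mult[OF pw[OF nz(1), of "a - 1"] this]
  have 1: "(famp a c has_field_derivative famp a c t * ((a - 1) / t + (c - a - 1) / (t - 1))) (at t)"
    unfolding famp_def[abs_def] by (rule DERIV_cong) (simp add: algebra_simps)
  have 2: "((\<lambda>t. exp (- of_real l * psi \<epsilon> t)) has_field_derivative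
      exp (- of_real l * psi \<epsilon> t) * (- of_real l * ((of_real \<epsilon> - 1) / (t - 1) - of_real \<epsilon> / t))) (at t)"
    by (rule DERIV_chain2[OF DERIV_exp DERIV_cmult[OF psi_has_field_derivative[OF assms]]])
  have eq: "(beta_p l + beta_q l - 1) / t - beta_q l / (t - 1) =
       (a - 1) / t + (c - a - 1) / (t - 1) + (- of_real l * ((of_real \<epsilon> - 1) / (t - 1) - of_real \<epsilon> / t))"
    by (simp add: beta_p_def beta_q_def add_divide_distrib diff_divide_distrib algebra_simps)
  show ?thesis
    unfolding \<rho>_def[abs_def] eq
    by (rule DERIV_cong[OF DERIV_mult[OF 1 2]]) (simp add: algebra_simps)
qed

lemma path_cont: "continuous_on {-r..r} \<gamma>"
  by (intro continuous_at_imp_continuous_on ballI has_vector_derivative_continuous[OF path_deriv])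

lemma \<rho>_path_cont: "continuous_on {-r..r} (\<lambda>v. \<rho> l (\<gamma> v))"
proof -
  have "continuous_on {t. Re t > 1} (\<rho> l)"
    using \<rho>_deriv by (auto intro!: continuous_at_imp_continuous_on DERIV_isCont)
  then show ?thesis
    by (rule continuous_on_compose2[OF _ path_cont]) (use path_Re in auto)
qed

text \<open>The path leaves the real axis everywhere except at v = 0, where it passes through
  \<epsilon>; for real y the product of \<gamma> v and y can therefore be 1 only when y =
  1/\<epsilon>.\<close>

lemma kernel_nonzero:
  assumes "v \<in> {-r..r}" "y \<noteq> 1 / \<epsilon>"
  shows "1 - \<gamma> v * of_real y \<noteq> 0"
proof
  assume eq: "1 - \<gamma> v * of_real y = 0"
  then have "y \<noteq> 0" by auto
  moreover have "v * Im (q v) * y = 0"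
    using arg_cong[OF eq, of Im] by (simp add: path_eq[OF assms(1)])
  ultimately have "v = 0" using q_Im[OF assms(1)] by auto
  then have "complex_of_real (\<epsilon> * y) = of_real 1"
    using eq path_eq[OF assms(1)] by simp
  then have "\<epsilon> * y = 1" by (simp only: of_real_eq_iff)
  then show False using assms(2) eps by (simp add: field_simps)
qed

definition cauchy_transform :: "real \<Rightarrow> real \<Rightarrow> complex" where
  "cauchy_transform l y = integral {-r..r} (\<lambda>v. \<rho> l (\<gamma> v) * \<gamma>' v / (1 - \<gamma> v * of_real y))"

definition cauchy_transform' :: "real \<Rightarrow> real \<Rightarrow> complex" where
  "cauchy_transform' l y = integral {-r..r} (\<lambda>v. \<rho> l (\<gamma> v) * \<gamma>' v * \<gamma> v / (1 - \<gamma> v * of_real y)\<^sup>2)"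

definition mass :: "real \<Rightarrow> complex" where
  "mass l = integral {-r..r} (\<lambda>v. \<rho> l (\<gamma> v) * \<gamma>' v)"

text \<open>The polynomial t (t - 1) clears both poles of the logarithmic derivative of \<rho>; the
  numerator is chosen so that the v-derivative is exactly the integrand of the differential
  expression in \<open>cauchy_transform_ode\<close>.\<close>

definition boundary_term :: "real \<Rightarrow> real \<Rightarrow> real \<Rightarrow> complex" where
  "boundary_term l y v = of_real y * \<gamma> v * (\<gamma> v - 1) * \<rho> l (\<gamma> v) / (1 - \<gamma> v * of_real y)"

lemma cauchy_transform_deriv:
  assumes "y \<noteq> 1 / \<epsilon>"
  shows "(cauchy_transform l has_vector_derivative cauchy_transform' l y) (at y)"
proof -
  \<comment> \<open>The open half-line on the side of 1/\<epsilon> that contains y: convex, as the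
    Leibniz rule requires, and free of the pole.\<close>
  obtain U where U: "open U" "convex U" "y \<in> U" "1 / \<epsilon> \<notin> U"
  proof (cases "y < 1 / \<epsilon>")
    case True then show ?thesis by (intro that[of "{..<1 / \<epsilon>}"]) auto
  next
    case False then show ?thesis using assms by (intro that[of "{1 / \<epsilon><..}"]) auto
  qed
  have nz: "1 - \<gamma> v * of_real z \<noteq> 0" if "v \<in> {-r..r}" "z \<in> U" for v z
    using that U(4) by (intro kernel_nonzero) auto
  have comp: "continuous_on (U \<times> cbox (-r) r) (\<lambda>z. h (snd z))" if "continuous_on {-r..r} h" for h
      :: "real \<Rightarrow> complex"
    by (rule continuous_on_compose2[OF that]) (auto intro!: continuous_intros)
  have "((\<lambda>y. integral (cbox (-r) r) (\<lambda>v. \<rho> l (\<gamma> v) * \<gamma>' v / (1 - \<gamma> v * of_real y)))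
      has_vector_derivative
          integral (cbox (-r) r) (\<lambda>v. \<rho> l (\<gamma> v) * \<gamma>' v * \<gamma> v / (1 - \<gamma> v * of_real y)\<^sup>2)) (at y within U)"
  proof (rule leibniz_rule_vector_derivative)
    fix z v assume zv: "z \<in> U" "v \<in> cbox (-r) r"
    then have "1 - \<gamma> v * of_real z \<noteq> 0" by (intro nz) auto
    then have "((\<lambda>z. \<rho> l (\<gamma> v) * \<gamma>' v / (1 - \<gamma> v * z)) has_field_derivative
        \<rho> l (\<gamma> v) * \<gamma>' v * \<gamma> v / (1 - \<gamma> v * of_real z)\<^sup>2) (at (of_real z))"
      by (auto intro!: derivative_eq_intros simp: power2_eq_square)
    from has_vector_derivative_real_field[OF this]
    show "((\<lambda>z. \<rho> l (\<gamma> v) * \<gamma>' v / (1 - \<gamma> v * of_real z)) has_vector_derivative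
        \<rho> l (\<gamma> v) * \<gamma>' v * \<gamma> v / (1 - \<gamma> v * of_real z)\<^sup>2) (at z within U)" .
  next
    fix z assume "z \<in> U"
    then show "(\<lambda>v. \<rho> l (\<gamma> v) * \<gamma>' v / (1 - \<gamma> v * of_real z)) integrable_on cbox (-r) r"
      using nz by (intro integrable_continuous) (auto intro!: continuous_intros \<rho>_path_cont
          path_deriv_cont path_cont)
  next
    show "continuous_on (U \<times> cbox (- r) r) (\<lambda>(z, v). \<rho> l (\<gamma> v) * \<gamma>' v * \<gamma> v / (1 - \<gamma> v * of_real z)\<^sup>2)"
      unfolding case_prod_beta using nz
      by (intro continuous_intros comp[OF \<rho>_path_cont] comp[OF path_deriv_cont] comp[OF path_cont]) auto
  qed (use U in auto)
  then show ?thesis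
    unfolding at_within_open[OF U(3,1)] cauchy_transform_def[abs_def] cauchy_transform'_def by
        (simp only: cbox_interval)
qed

text \<open>The weight \<open>\<rho>\<close> satisfies a Pearson equation, which turns the integrand of the differential
  expression into a \<open>v\<close>-derivative; the boundary terms are exponentially small.\<close>

lemma cauchy_transform_ode:
  assumes "y \<noteq> 1 / \<epsilon>"
  shows "of_real (y * (1 - y)) * cauchy_transform' l y +
      (beta_p l - (beta_p l + beta_q l) * of_real y) * cauchy_transform l y
           = beta_p l * mass l + (boundary_term l y r - boundary_term l y (-r))"
proof -
  let ?p = "beta_p l" and ?q = "beta_q l" and ?D = "\<lambda>v. 1 - \<gamma> v * of_real y"
  let ?w = "\<lambda>v. \<rho> l (\<gamma> v) * \<gamma>' v"
  have nz: "?D v \<noteq> 0" if "v \<in> {-r..r}" for v by (rule kernel_nonzero[OF that assms])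
  have I1: "((\<lambda>v. ?w v * \<gamma> v / (?D v)\<^sup>2) has_integral cauchy_transform' l y) {-r..r}"
    unfolding cauchy_transform'_def
    by (intro integrable_integral integrable_continuous_real continuous_intros \<rho>_path_cont
        path_deriv_cont path_cont)
       (use nz in auto)
  have I2: "((\<lambda>v. ?w v / ?D v) has_integral cauchy_transform l y) {-r..r}"
    unfolding cauchy_transform_def
    by (intro integrable_integral integrable_continuous_real continuous_intros \<rho>_path_cont
        path_deriv_cont path_cont)
       (use nz in auto)
  have I3: "(?w has_integral mass l) {-r..r}"
    unfolding mass_def
    by (intro integrable_integral integrable_continuous_real continuous_intros \<rho>_path_cont
        path_deriv_cont)
  have I4: "((\<lambda>v. of_real (y * (1 - y)) * (?w v * \<gamma> v / (?D v)\<^sup>2) + (?p - (?p + ?q) * of_real y) *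
      (?w v / ?D v) - ?p * ?w v)
          has_integral of_real (y * (1 - y)) * cauchy_transform' l y +
              (?p - (?p + ?q) * of_real y) * cauchy_transform l y - ?p * mass l) {-r..r}"
    by (intro has_integral_diff has_integral_add has_integral_mult_right I1 I2 I3)
  have "((\<lambda>v. of_real (y * (1 - y)) * (?w v * \<gamma> v / (?D v)\<^sup>2) + (?p - (?p + ?q) * of_real y) *
      (?w v / ?D v) - ?p * ?w v)
          has_integral boundary_term l y r - boundary_term l y (-r)) {-r..r}"
  proof (rule fundamental_theorem_of_calculus)
    fix v assume v: "v \<in> {-r..r}"
    define t where "t = \<gamma> v"
    have t: "Re t > 1" using path_Re[OF v] by (simp add: t_def)
    have tnz: "t \<noteq> 0" "t - 1 \<noteq> 0" "1 - t * of_real y \<noteq> 0"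
      using t nz[OF v] by (auto simp: t_def)
    define Y where "Y = complex_of_real y"
    define D where "D = 1 - t * Y"
    define L where "L = (?p + ?q - 1) * (t - 1) - ?q * t"
    define \<rho>' where "\<rho>' = \<rho> l t * ((?p + ?q - 1) / t - ?q / (t - 1))"
    have D: "D \<noteq> 0" using tnz(3) by (simp add: D_def Y_def)
    have num: "((\<lambda>t. Y * t * (t - 1) * \<rho> l t) has_field_derivative Y * (2 * t - 1) * \<rho> l t + Y *
        (t * (t - 1) * \<rho>')) (at t)"
    proof (rule DERIV_cong[OF DERIV_mult[OF _ \<rho>_deriv[OF t, of l, folded \<rho>'_def]]])
      show "((\<lambda>t. Y * t * (t - 1)) has_field_derivative Y * (2 * t - 1)) (at t)"
        by (auto intro!: derivative_eq_intros simp: algebra_simps)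
    qed (simp add: algebra_simps)
    have den: "((\<lambda>t. 1 - t * Y) has_field_derivative - Y) (at t)"
      by (auto intro!: derivative_eq_intros)
    \<comment> \<open>The Pearson equation: t (t - 1) times the logarithmic derivative of \<rho> is
      the linear polynomial L.\<close>
    have e: "t * (t - 1) * \<rho>' = \<rho> l t * L"
    proof -
      have "t * s * (u / t - w / s) = u * s - w * t" if "s \<noteq> 0" for s u w
        using tnz(1) that by (simp add: field_simps)
      from this[OF tnz(2)] show ?thesis
        by (simp only: \<rho>'_def L_def mult.left_commute[of "t * (t - 1)" "\<rho> l t"])
    qed
    have "(Y * (2 * t - 1) * \<rho> l t + Y * (\<rho> l t * L)) * D - Y * t * (t - 1) * \<rho> l t * - Y
        = \<rho> l t * (Y * (1 - Y) * t + (?p - (?p + ?q) * Y) * D - ?p * (D * D))"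
      unfolding D_def L_def by (simp add: algebra_simps)
    then have eq: "((Y * (2 * t - 1) * \<rho> l t + Y * (\<rho> l t * L)) * D - Y * t * (t - 1) * \<rho> l t * -
        Y) / (D * D)
        = Y * (1 - Y) * (\<rho> l t * t / D\<^sup>2) + (?p - (?p + ?q) * Y) * (\<rho> l t / D) - ?p * \<rho> l t"
      using D by (simp add: divide_simps power2_eq_square) (simp add: algebra_simps)
    have "((\<lambda>t. Y * t * (t - 1) * \<rho> l t / (1 - t * Y)) has_field_derivative
        Y * (1 - Y) * (\<rho> l t * t / D\<^sup>2) + (?p - (?p + ?q) * Y) * (\<rho> l t / D) - ?p * \<rho> l t) (at t)"
      using DERIV_divide[OF num den] D unfolding e eq[symmetric] by (simp add: D_def)
    note der = this[unfolded D_def Y_def t_def]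
    from field_vector_diff_chain_at[OF path_deriv[OF v] der]
    show "(boundary_term l y has_vector_derivative of_real (y * (1 - y)) * (?w v * \<gamma> v / (?D v)\<^sup>2)
            + (?p - (?p + ?q) * of_real y) * (?w v / ?D v) - ?p * ?w v) (at v within {-r..r})"
      unfolding boundary_term_def[abs_def] o_def
      by (rule has_vector_derivative_at_within[OF has_vector_derivative_eq_rhs])
         (simp add: algebra_simps)
  qed (use r in auto)
  from has_integral_unique[OF I4 this] show ?thesis by (simp add: algebra_simps)
qed

section \<open>Gaussian form on the path and one-sided limits at the pole\<close>

text \<open>Half of |psi''(\<epsilon>)|, the rate of the Gaussian on the path: psi(\<gamma> v) =
  psi(\<epsilon>) + \<mu> v^2.\<close>

definition \<mu> :: real where "\<mu> = 1 / (2 * \<epsilon> * (\<epsilon> - 1))"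

lemma \<mu>_pos: "\<mu> > 0" and psi2_\<mu>: "psi2 \<epsilon> = - of_real (2 * \<mu>)"
  using eps by (simp_all add: \<mu>_def psi2_eq)

definition gauss_weight :: "real \<Rightarrow> real \<Rightarrow> complex" where
  "gauss_weight l v = of_real (exp (- (l * \<mu>) * v\<^sup>2)) * K (\<i> * of_real v)"

text \<open>Principal value of the integral of \<open>gauss_weight l v / v\<close>: the subtracted 1
  is the weight at v = 0, and 1/v has principal value 0 on a symmetric interval.\<close>

definition pv_integral :: "real \<Rightarrow> complex" where
  "pv_integral l = integral {-r..r} (\<lambda>v. (gauss_weight l v - 1) / of_real v)"

lemma exp_psi_path:
  assumes "v \<in> {-r..r}"
  shows "exp (- of_real l * psi \<epsilon> (\<gamma> v)) = exp (- of_real l * psi \<epsilon> (of_real \<epsilon>)) * of_real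
      (exp (- (l * \<mu>) * v\<^sup>2))"
  unfolding psi_path[OF assms] psi2_\<mu> by (simp add: exp_of_real[symmetric] algebra_simps
      exp_add[symmetric])

lemma \<rho>_path:
  assumes "v \<in> {-r..r}"
  shows "\<rho> l (\<gamma> v) * \<gamma>' v = \<rho> l (of_real \<epsilon>) * gauss_weight l v * q v"
proof -
  have "\<rho> l (\<gamma> v) * \<gamma>' v = (famp a c (\<gamma> v) * \<gamma>' v) * exp (- of_real l * psi \<epsilon> (\<gamma> v))"
    by (simp add: \<rho>_def)
  then show ?thesis
    unfolding famp_path[OF assms] exp_psi_path[OF assms] by (simp add: \<rho>_def gauss_weight_def)
qed

lemma iv_in_ball: "v \<in> {-r..r} \<Longrightarrow> \<i> * complex_of_real v \<in> ball 0 R"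
  using r by (auto simp: norm_mult)

lemma K_path_cont: "continuous_on {-r..r} (\<lambda>v. K (\<i> * complex_of_real v))"
  by (rule continuous_on_compose2[OF holomorphic_on_imp_continuous_on[OF K_hol]])
     (use iv_in_ball in \<open>auto intro!: continuous_intros\<close>)

lemma gauss_weight_cont: "continuous_on {-r..r} (gauss_weight l)"
  unfolding gauss_weight_def by (intro continuous_intros K_path_cont)

lemma K_Lipschitz: "\<exists>C\<ge>0. \<forall>v\<in>{-r..r}. norm (K (\<i> * of_real v) - 1) \<le> C * \<bar>v\<bar>"
proof -
  have sub: "cball 0 r \<subseteq> ball (0::complex) R" using r by auto
  have "continuous_on (cball 0 r) (deriv K)"
    using K_hol by (intro holomorphic_on_imp_continuous_on
        holomorphic_on_subset[OF holomorphic_deriv sub]) auto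
  then have "bounded (deriv K ` cball 0 r)"
    by (intro compact_imp_bounded compact_continuous_image) auto
  then obtain C where C: "\<And>w. w \<in> cball 0 r \<Longrightarrow> norm (deriv K w) \<le> C"
    unfolding bounded_iff by blast
  have C0: "C \<ge> 0" using order.trans[OF norm_ge_zero C[of 0]] r by simp
  have "norm (K w - K 0) \<le> C * norm (w - 0)" if "w \<in> cball 0 r" for w
  proof (rule field_differentiable_bound[OF convex_cball[of 0 r]])
    fix z :: complex assume "z \<in> cball 0 r"
    then have "z \<in> ball 0 R" using sub by blast
    then show "(K has_field_derivative deriv K z) (at z within cball 0 r)"
      by (rule has_field_derivative_at_within[OF holomorphic_derivI[OF K_hol open_ball]])
  qed (use that C r in auto)
  note Lip = this
  show ?thesis
  proof (intro exI[of _ C] conjI ballI C0)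
    fix v assume "v \<in> {-r..r}"
    then have "\<i> * of_real v \<in> cball (0::complex) r" by (auto simp: norm_mult)
    from Lip[OF this] show "norm (K (\<i> * of_real v) - 1) \<le> C * \<bar>v\<bar>"
      by (simp add: K0 norm_mult)
  qed
qed

text \<open>This bounds the integrand of \<open>pv_integral\<close>. The constant may depend on l,
  because l stays fixed while y tends to 1/\<epsilon>.\<close>

lemma gauss_weight_Lipschitz:
  assumes "l \<ge> 0"
  shows "\<exists>C\<ge>0. \<forall>v\<in>{-r..r}. norm (gauss_weight l v - 1) \<le> C * \<bar>v\<bar>"
proof -
  obtain C where C: "C \<ge> 0" "\<And>v. v \<in> {-r..r} \<Longrightarrow> norm (K (\<i> * of_real v) - 1) \<le> C * \<bar>v\<bar>"
    using K_Lipschitz by blast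
  have "norm (gauss_weight l v - 1) \<le> (C + l * \<mu> * r) * \<bar>v\<bar>" if v: "v \<in> {-r..r}" for v
  proof -
    let ?e = "exp (- (l * \<mu>) * v\<^sup>2)"
    have e1: "?e \<le> 1" using assms \<mu>_pos by simp
    have e2: "1 - ?e \<le> l * \<mu> * v\<^sup>2" using exp_ge_add_one_self[of "- (l * \<mu>) * v\<^sup>2"] by simp
    have "gauss_weight l v - 1 = of_real ?e * (K (\<i> * of_real v) - 1) - of_real (1 - ?e)"
      by (simp add: gauss_weight_def algebra_simps)
    then have "norm (gauss_weight l v - 1) \<le> ?e * norm (K (\<i> * of_real v) - 1) + \<bar>1 - ?e\<bar>"
      using norm_triangle_ineq4[of "of_real ?e * (K (\<i> * of_real v) - 1)" "of_real (1 - ?e)"]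
      by (simp only: norm_mult norm_of_real abs_exp_cancel)
    also have "\<dots> \<le> 1 * (C * \<bar>v\<bar>) + l * \<mu> * v\<^sup>2"
      using e1 e2 C(2)[OF v] by (intro add_mono mult_mono) auto
    also have "v\<^sup>2 = \<bar>v\<bar> * \<bar>v\<bar>" by (simp add: power2_eq_square)
    also have "l * \<mu> * (\<bar>v\<bar> * \<bar>v\<bar>) \<le> l * \<mu> * (r * \<bar>v\<bar>)"
      using v assms \<mu>_pos by (intro mult_left_mono mult_right_mono) auto
    finally show ?thesis by (simp add: algebra_simps)
  qed
  moreover have "C + l * \<mu> * r \<ge> 0" using C(1) assms \<mu>_pos r by simp
  ultimately show ?thesis by blast
qed

lemma q_bound: "v \<in> {-r..r} \<Longrightarrow> norm (q v) \<le> 1 + \<bar>B\<bar> * r"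
proof -
  assume v: "v \<in> {-r..r}"
  have "norm (q v) \<le> norm (q v - \<i>) + norm \<i>" using norm_triangle_ineq[of "q v - \<i>" \<i>] by simp
  also have "norm (q v - \<i>) \<le> \<bar>B\<bar> * \<bar>v\<bar>"
    using q_Lipschitz[OF v] by (rule order.trans) (simp add: mult_right_mono)
  also have "\<dots> \<le> \<bar>B\<bar> * r" using v by (intro mult_left_mono) auto
  finally show ?thesis by simp
qed

text \<open>Only the imaginary part v * Im (q v) enters, so the bound is uniform in \<eta>.\<close>

lemma norm_pole_ge:
  assumes "v \<in> {-r..r}"
  shows "norm (of_real \<eta> - of_real v * q v) \<ge> \<bar>v\<bar> / 2"
proof -
  have "\<bar>v\<bar> / 2 \<le> \<bar>v\<bar> * \<bar>Im (q v)\<bar>" using q_Im[OF assms]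
      mult_left_mono[of "1/2" "\<bar>Im (q v)\<bar>" "\<bar>v\<bar>"] by simp
  also have "\<dots> = \<bar>Im (of_real \<eta> - of_real v * q v)\<bar>" by (simp add: abs_mult)
  also have "\<dots> \<le> norm (of_real \<eta> - of_real v * q v)" by (rule abs_Im_le_cmod)
  finally show ?thesis .
qed

text \<open>Near the saddle the Cauchy kernel is compared with the explicit kernel \<open>\<i> / (\<eta> - \<i> v)\<close>;
  the difference is dominated uniformly in \<open>\<eta>\<close>, so it converges to a principal value.\<close>

lemma kernel_difference_tendsto:
  assumes l: "l \<ge> 0"
  shows "((\<lambda>\<eta>. integral {-r..r} (\<lambda>v. gauss_weight l v * q v / (of_real \<eta> - of_real v * q v) - \<i> /
      (of_real \<eta> - \<i> * of_real v)))
           \<longlongrightarrow> - pv_integral l) (at 0)"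
proof -
  obtain C where C: "C \<ge> 0" "\<And>v. v \<in> {-r..r} \<Longrightarrow> norm (gauss_weight l v - 1) \<le> C * \<bar>v\<bar>"
    using gauss_weight_Lipschitz[OF l] by blast
  define D where "D = 1 + \<bar>B\<bar> * r"
  have D: "D \<ge> 0" using r by (simp add: D_def)
  define G where "G \<eta> v = gauss_weight l v * q v / (of_real \<eta> - of_real v * q v) - \<i> /
      (of_real \<eta> - \<i> * of_real v)" for \<eta> v :: real
  define H where "H v = - ((gauss_weight l v - 1) / of_real v)" for v :: real
  have nz: "of_real \<eta> - of_real v * q v \<noteq> 0" "of_real \<eta> - \<i> * of_real v \<noteq> 0" if "\<eta> \<noteq> 0" "v \<in>
      {-r..r}" for \<eta> v
  proof -
    show "of_real \<eta> - of_real v * q v \<noteq> 0"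
      using norm_pole_ge[OF that(2), of \<eta>] that(1) by (cases "v = 0") auto
    show "of_real \<eta> - \<i> * of_real v \<noteq> 0" using that(1) by (auto simp: complex_eq_iff)
  qed
  have bound: "norm (G \<eta> v) \<le> 2 * (C * D + \<bar>B\<bar>) + 2 * D * C" if \<eta>: "\<eta> \<noteq> 0" and v: "v \<in> {-r..r}" for \<eta> v
  proof (cases "v = 0")
    case True
    have "gauss_weight l 0 = 1" using C(2)[of 0] r by simp
    then have "G \<eta> v = 0" using True by (simp add: G_def q0)
    then show ?thesis using C D by simp
  next
    case False
    let ?d1 = "of_real \<eta> - of_real v * q v" and ?d2 = "of_real \<eta> - \<i> * of_real v"
    \<comment> \<open>The numerator over the common denominator is split by its order in v. The
      first part is \<eta> times O(v), matched by |d1| \<ge> |v|/2 and |d2| \<ge> |\<eta>|; the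
      second is O(v^2), matched by |d1| \<ge> |v|/2 and |d2| \<ge> |v|.\<close>
    have G_eq: "G \<eta> v = (of_real \<eta> * (gauss_weight l v * q v - \<i>)) / (?d1 * ?d2) -
        (\<i> * of_real v * (q v * (gauss_weight l v - 1))) / (?d1 * ?d2)"
      using nz[OF \<eta> v] by (simp add: G_def divide_simps) (simp add: algebra_simps)
    have d1: "norm ?d1 \<ge> \<bar>v\<bar> / 2" by (rule norm_pole_ge[OF v])
    have d2: "norm ?d2 \<ge> \<bar>\<eta>\<bar>" "norm ?d2 \<ge> \<bar>v\<bar>"
      using abs_Re_le_cmod[of ?d2] abs_Im_le_cmod[of ?d2] by simp_all
    have "gauss_weight l v * q v - \<i> = (gauss_weight l v - 1) * q v + (q v - \<i>)" by
        (simp add: algebra_simps)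
    then have "norm (gauss_weight l v * q v - \<i>) \<le> norm (gauss_weight l v - 1) * norm (q v) + norm
        (q v - \<i>)"
      by (metis norm_triangle_ineq norm_mult)
    also have "\<dots> \<le> (C * \<bar>v\<bar>) * D + \<bar>B\<bar> * \<bar>v\<bar>"
    proof (intro add_mono mult_mono)
      show "norm (q v - \<i>) \<le> \<bar>B\<bar> * \<bar>v\<bar>"
        using q_Lipschitz[OF v] by (rule order.trans) (simp add: mult_right_mono)
    qed (use C(1) C(2)[OF v] q_bound[OF v] D in \<open>simp_all add: D_def\<close>)
    finally have n1: "norm (gauss_weight l v * q v - \<i>) \<le> (C * D + \<bar>B\<bar>) * \<bar>v\<bar>" by
        (simp add: algebra_simps)
    have "norm (of_real \<eta> * (gauss_weight l v * q v - \<i>) / (?d1 * ?d2)) \<le>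
        (\<bar>\<eta>\<bar> * ((C * D + \<bar>B\<bar>) * \<bar>v\<bar>)) / (\<bar>v\<bar> / 2 * \<bar>\<eta>\<bar>)"
      unfolding norm_mult norm_divide norm_of_real
      using n1 d1 d2 False \<eta> C(1) D by (intro frac_le mult_mono mult_left_mono) auto
    also have "\<dots> = 2 * (C * D + \<bar>B\<bar>)" using False \<eta> by simp
    finally have 1: "norm (of_real \<eta> * (gauss_weight l v * q v - \<i>) / (?d1 * ?d2)) \<le> 2 * (C * D + \<bar>B\<bar>)" .
    have "norm ((\<i> * of_real v * (q v * (gauss_weight l v - 1))) / (?d1 * ?d2)) \<le>
        (\<bar>v\<bar> * (D * (C * \<bar>v\<bar>))) / (\<bar>v\<bar> / 2 * \<bar>v\<bar>)"
      unfolding norm_mult norm_divide norm_of_real norm_ii mult_1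
      using q_bound[OF v] C(1) C(2)[OF v] d1 d2 False D by
          (intro frac_le mult_mono mult_left_mono mult_pos_pos) (auto simp: D_def)
    also have "\<dots> = 2 * D * C"
    proof -
      have "w * (D * (C * w)) / (w / 2 * w) = 2 * D * C" if "w \<noteq> 0" for w :: real
        using that by (simp add: field_simps)
      from this[of "\<bar>v\<bar>"] False show ?thesis by simp
    qed
    finally have 2: "norm ((\<i> * of_real v * (q v * (gauss_weight l v - 1))) / (?d1 * ?d2)) \<le> 2 * D * C" .
    show ?thesis unfolding G_eq using norm_triangle_ineq4 1 2 by (meson add_mono order.trans)
  qed
  have int: "G \<eta> integrable_on {-r..r}" if "\<eta> \<noteq> 0" for \<eta>
    unfolding G_def[abs_def] using nz[OF that]
    by (intro integrable_continuous_real continuous_intros gauss_weight_cont q_cont) auto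
  have lim: "(\<lambda>n. G (X n) v) \<longlonglongrightarrow> H v" if X: "X \<longlonglongrightarrow> 0" "\<And>n. X n \<noteq> 0" and v: "v \<in> {-r..r}" for X v
  proof (cases "v = 0")
    case True
    have "gauss_weight l 0 = 1" using C(2)[of 0] r by simp
    then show ?thesis using True by (simp add: G_def H_def q0)
  next
    case False
    have qnz: "q v \<noteq> 0" using q_Im[OF v] by auto
    have "(\<lambda>n. G (X n) v) \<longlonglongrightarrow> gauss_weight l v * q v / (of_real 0 - of_real v * q v) - \<i> /
        (of_real 0 - \<i> * of_real v)"
      unfolding G_def using False qnz by (intro tendsto_intros X) auto
    also have "gauss_weight l v * q v / (of_real 0 - of_real v * q v) - \<i> /
        (of_real 0 - \<i> * of_real v) = H v"
      using False qnz by (simp add: H_def divide_simps)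
    finally show ?thesis .
  qed
  have "((\<lambda>\<eta>. integral {-r..r} (G \<eta>)) \<longlongrightarrow> integral {-r..r} H) (at 0)"
    unfolding tendsto_at_iff_sequentially o_def
  proof (intro allI impI)
    fix X :: "nat \<Rightarrow> real" assume X: "\<forall>i. X i \<in> UNIV - {0}" "X \<longlonglongrightarrow> 0"
    show "(\<lambda>n. integral {-r..r} (G (X n))) \<longlonglongrightarrow> integral {-r..r} H"
    proof (rule dominated_convergence(2))
      show "norm (G (X k) v) \<le> 2 * (C * D + \<bar>B\<bar>) + 2 * D * C" if "v \<in> {-r..r}" for k v
        using X(1) by (intro bound that) auto
    qed (use X in \<open>auto intro!: int lim\<close>)
  qed
  also have "integral {-r..r} H = - pv_integral l"
    unfolding H_def[abs_def] pv_integral_def by simp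
  finally show ?thesis unfolding G_def[abs_def] .
qed

text \<open>The primitive consists of an arctan and a logarithm, and the logarithm takes the same
  value at v = r and v = -r. As \<eta> tends to 0 from above or below the integral tends to \<i> pi
  or -\<i> pi: this is the source of the jump.\<close>

lemma explicit_kernel_integral:
  assumes "\<eta> \<noteq> 0"
  shows "((\<lambda>v. \<i> / (of_real \<eta> - \<i> * of_real v)) has_integral \<i> * of_real (2 * arctan (r / \<eta>))) {-r..r}"
proof -
  have "((\<lambda>v. \<i> / (of_real \<eta> - \<i> * of_real v)) has_integral
     (\<i> * of_real (arctan (r / \<eta>)) - of_real (ln (\<eta>\<^sup>2 + r\<^sup>2) / 2)) -
         (\<i> * of_real (arctan ((-r) / \<eta>)) - of_real (ln (\<eta>\<^sup>2 + (-r)\<^sup>2) / 2))) {-r..r}"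
  proof (rule fundamental_theorem_of_calculus)
    fix v assume "v \<in> {-r..r}"
    have pos: "\<eta>\<^sup>2 + v\<^sup>2 > 0" using assms by (simp add: add_pos_nonneg)
    have "((\<lambda>v. arctan (v / \<eta>)) has_real_derivative \<eta> / (\<eta>\<^sup>2 + v\<^sup>2)) (at v)"
      using assms pos by (auto intro!: derivative_eq_intros simp: divide_simps power2_eq_square)
    moreover have "((\<lambda>v. ln (\<eta>\<^sup>2 + v\<^sup>2) / 2) has_real_derivative v / (\<eta>\<^sup>2 + v\<^sup>2)) (at v)"
    proof -
      have "((\<lambda>v. ln (\<eta>\<^sup>2 + v\<^sup>2)) has_real_derivative 2 * v / (\<eta>\<^sup>2 + v\<^sup>2)) (at v)"
        using pos by (auto intro!: derivative_eq_intros)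
      moreover have "2 * v / D / 2 = v / D" for D by simp
      ultimately show ?thesis by (metis DERIV_cdivide)
    qed
    ultimately have "((\<lambda>v. \<i> * of_real (arctan (v / \<eta>)) - of_real (ln (\<eta>\<^sup>2 + v\<^sup>2) / 2))
        has_vector_derivative
        \<i> * of_real (\<eta> / (\<eta>\<^sup>2 + v\<^sup>2)) - of_real (v / (\<eta>\<^sup>2 + v\<^sup>2))) (at v)"
      by (intro derivative_intros) (auto simp: has_real_derivative_iff_has_vector_derivative)
    also have "\<i> * of_real (\<eta> / (\<eta>\<^sup>2 + v\<^sup>2)) - of_real (v / (\<eta>\<^sup>2 + v\<^sup>2)) = \<i> /
        (of_real \<eta> - \<i> * of_real v)"
      by (simp add: complex_eq_iff Re_divide Im_divide power2_eq_square)
    finally show "((\<lambda>v. \<i> * of_real (arctan (v / \<eta>)) - of_real (ln (\<eta>\<^sup>2 + v\<^sup>2) / 2))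
        has_vector_derivative
        \<i> / (of_real \<eta> - \<i> * of_real v)) (at v within {-r..r})"
      by (rule has_vector_derivative_at_within)
  qed (use r in auto)
  then show ?thesis by (simp add: arctan_minus algebra_simps)
qed

text \<open>From 1 - \<gamma> v * y = y (\<eta> - v * q v): the variable \<eta> moves the pole from
  y = 1/\<epsilon> to \<eta> = 0 and brings the kernel into the form compared above.\<close>

lemma cauchy_transform_decomp:
  assumes "l \<ge> 0" "y \<noteq> 1 / \<epsilon>" "y \<noteq> 0"
  defines "\<eta> \<equiv> (1 - \<epsilon> * y) / y"
  shows "cauchy_transform l y = \<rho> l (of_real \<epsilon>) / of_real y *
     (integral {-r..r} (\<lambda>v. gauss_weight l v * q v / (of_real \<eta> - of_real v * q v) - \<i> /
         (of_real \<eta> - \<i> * of_real v))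
      + \<i> * of_real (2 * arctan (r / \<eta>)))"
proof -
  have \<eta>: "\<eta> \<noteq> 0" using assms eps by (simp add: \<eta>_def field_simps)
  have nz: "of_real \<eta> - of_real v * q v \<noteq> 0" if "v \<in> {-r..r}" for v
    using norm_pole_ge[OF that, of \<eta>] \<eta> by (cases "v = 0") auto
  have "cauchy_transform l y = integral {-r..r} (\<lambda>v. \<rho> l (of_real \<epsilon>) / of_real y *
      (gauss_weight l v * q v / (of_real \<eta> - of_real v * q v)))"
    unfolding cauchy_transform_def
  proof (rule integral_cong)
    fix v assume v: "v \<in> {-r..r}"
    have "y * \<eta> = 1 - \<epsilon> * y" using assms(3) by (simp add: \<eta>_def)
    then have "complex_of_real y * of_real \<eta> = 1 - of_real \<epsilon> * of_real y"
      by (metis of_real_1 of_real_diff of_real_mult)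
    then have "1 - \<gamma> v * of_real y = of_real y * (of_real \<eta> - of_real v * q v)"
      unfolding path_eq[OF v] by (simp add: algebra_simps)
    then show "\<rho> l (\<gamma> v) * \<gamma>' v / (1 - \<gamma> v * of_real y) = \<rho> l (of_real \<epsilon>) / of_real y *
        (gauss_weight l v * q v / (of_real \<eta> - of_real v * q v))"
      unfolding \<rho>_path[OF v] by simp
  qed
  also have "\<dots> = \<rho> l (of_real \<epsilon>) / of_real y * integral {-r..r}
      (\<lambda>v. gauss_weight l v * q v / (of_real \<eta> - of_real v * q v))"
    by (rule integral_mult_right)
  also have "integral {-r..r} (\<lambda>v. gauss_weight l v * q v / (of_real \<eta> - of_real v * q v))
     = integral {-r..r} (\<lambda>v. gauss_weight l v * q v / (of_real \<eta> - of_real v * q v) - \<i> /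
         (of_real \<eta> - \<i> * of_real v))
       + integral {-r..r} (\<lambda>v. \<i> / (of_real \<eta> - \<i> * of_real v))"
  proof -
    have "(\<lambda>v. gauss_weight l v * q v / (of_real \<eta> - of_real v * q v)) integrable_on {-r..r}"
      using nz by (intro integrable_continuous_real continuous_intros gauss_weight_cont q_cont) auto
    then show ?thesis
      using explicit_kernel_integral[OF \<eta>] by (subst integral_diff) auto
  qed
  finally show ?thesis
    by (simp add: integral_unique[OF explicit_kernel_integral[OF \<eta>]])
qed

text \<open>Near 1/\<epsilon>, \<eta> is positive on the left and negative on the right, so arctan
  (r / \<eta>) tends to pi/2 and -pi/2, while the kernel difference has the same limit from both
  sides.\<close>

lemma
  assumes l: "l \<ge> 0"
  shows cauchy_transform_tendsto_left: "(cauchy_transform l \<longlongrightarrow> of_real \<epsilon> * \<rho> l (of_real \<epsilon>) *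
      (\<i> * of_real pi - pv_integral l)) (at_left (1 / \<epsilon>))"
    and cauchy_transform_tendsto_right: "(cauchy_transform l \<longlongrightarrow> of_real \<epsilon> * \<rho> l (of_real \<epsilon>) *
        (- \<i> * of_real pi - pv_integral l)) (at_right (1 / \<epsilon>))"
proof -
  define \<eta> where "\<eta> y = (1 - \<epsilon> * y) / y" for y
  define J where "J \<eta> = integral {-r..r} (\<lambda>v. gauss_weight l v * q v /
      (of_real \<eta> - of_real v * q v) - \<i> / (of_real \<eta> - \<i> * of_real v))" for \<eta> :: real
  have J: "(J \<longlongrightarrow> - pv_integral l) (at 0)" unfolding J_def by (rule kernel_difference_tendsto[OF l])
  have *: "(cauchy_transform l \<longlongrightarrow> of_real \<epsilon> * \<rho> l (of_real \<epsilon>) * (\<i> * of_real (2 * s) - pv_integral l)) F"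
    if F: "F \<le> at (1 / \<epsilon>)" and s: "((\<lambda>y. arctan (r / \<eta> y)) \<longlongrightarrow> s) F" for F s
  proof -
    have ev: "\<forall>\<^sub>F y in F. y \<noteq> 1 / \<epsilon> \<and> y \<noteq> 0"
    proof (rule filter_leD[OF F])
      have "\<forall>\<^sub>F y in at (1 / \<epsilon>). y \<noteq> 0"
        using eps by (intro tendsto_imp_eventually_ne[OF tendsto_ident_at]) auto
      then show "\<forall>\<^sub>F y in at (1 / \<epsilon>). y \<noteq> 1 / \<epsilon> \<and> y \<noteq> 0"
        by (rule eventually_conj[OF eventually_neq_at_within])
    qed
    have id: "((\<lambda>y. y) \<longlongrightarrow> 1 / \<epsilon>) F" using F by (rule tendsto_mono) (rule tendsto_ident_at)
    have "(\<eta> \<longlongrightarrow> (1 - \<epsilon> * (1 / \<epsilon>)) / (1 / \<epsilon>)) F"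
      unfolding \<eta>_def[abs_def] using eps by (intro tendsto_intros id) auto
    then have "filterlim \<eta> (at 0) F"
      using ev eps by (auto simp: filterlim_at \<eta>_def field_simps elim!: eventually_mono)
    then have "((\<lambda>y. J (\<eta> y)) \<longlongrightarrow> - pv_integral l) F" by (rule filterlim_compose[OF J])
    then have "((\<lambda>y. \<rho> l (of_real \<epsilon>) / of_real y * (J (\<eta> y) + \<i> * of_real (2 * arctan (r / \<eta> y)))) \<longlongrightarrow>
        \<rho> l (of_real \<epsilon>) / of_real (1 / \<epsilon>) * (- pv_integral l + \<i> * of_real (2 * s))) F"
      using eps by (intro tendsto_intros id s) auto
    also have "\<rho> l (of_real \<epsilon>) / of_real (1 / \<epsilon>) * (- pv_integral l + \<i> * of_real (2 * s)) =
        of_real \<epsilon> * \<rho> l (of_real \<epsilon>) * (\<i> * of_real (2 * s) - pv_integral l)"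
      by (simp add: algebra_simps)
    finally show ?thesis
    proof (rule Lim_transform_eventually)
      show "\<forall>\<^sub>F y in F. \<rho> l (of_real \<epsilon>) / of_real y * (J (\<eta> y) + \<i> * of_real
          (2 * arctan (r / \<eta> y))) = cauchy_transform l y"
        using ev by eventually_elim (use l in \<open>simp add: cauchy_transform_decomp \<eta>_def J_def\<close>)
    qed
  qed
  have \<eta>0: "(\<eta> \<longlongrightarrow> 0) (at (1 / \<epsilon>) within S)" for S
  proof -
    have "(\<eta> \<longlongrightarrow> (1 - \<epsilon> * (1 / \<epsilon>)) / (1 / \<epsilon>)) (at (1 / \<epsilon>) within S)"
      unfolding \<eta>_def[abs_def] using eps by (intro tendsto_intros) auto
    then show ?thesis using eps by simp
  qed
  have "\<forall>\<^sub>F y in at_left (1 / \<epsilon>). 0 < \<eta> y"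
    using eps by (intro eventually_at_leftI[of 0]) (auto simp: \<eta>_def field_simps)
  then have "filterlim (\<lambda>y. r * inverse (\<eta> y)) at_top (at_left (1 / \<epsilon>))"
    by (intro filterlim_tendsto_pos_mult_at_top[OF tendsto_const r(1)] filterlim_inverse_at_top \<eta>0)
  then have "((\<lambda>y. arctan (r / \<eta> y)) \<longlongrightarrow> pi / 2) (at_left (1 / \<epsilon>))"
    unfolding divide_inverse[of r] by (rule filterlim_compose[OF tendsto_arctan_at_top])
  from *[OF _ this] show "(cauchy_transform l \<longlongrightarrow> of_real \<epsilon> * \<rho> l (of_real \<epsilon>) *
      (\<i> * of_real pi - pv_integral l)) (at_left (1 / \<epsilon>))"
    by (simp add: at_le)
  have "\<forall>\<^sub>F y in at_right (1 / \<epsilon>). \<eta> y < 0"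
  proof (rule eventually_at_rightI)
    fix y assume "y \<in> {1 / \<epsilon><..<1}"
    then have y: "1 / \<epsilon> < y" by simp
    have "0 < 1 / \<epsilon>" using eps by simp
    then have "0 < y" using y by (rule less_trans)
    then show "\<eta> y < 0" using y eps by (auto simp: \<eta>_def field_simps intro!: divide_neg_pos)
  qed (use eps in simp)
  then have "filterlim (\<lambda>y. r * inverse (\<eta> y)) at_bot (at_right (1 / \<epsilon>))"
    by (intro filterlim_tendsto_pos_mult_at_bot[OF tendsto_const r(1)] filterlim_inverse_at_bot \<eta>0)
  then have "((\<lambda>y. arctan (r / \<eta> y)) \<longlongrightarrow> - (pi / 2)) (at_right (1 / \<epsilon>))"
    unfolding divide_inverse[of r] by (rule filterlim_compose[OF tendsto_arctan_at_bot])
  from *[OF _ this] show "(cauchy_transform l \<longlongrightarrow> of_real \<epsilon> * \<rho> l (of_real \<epsilon>) *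
      (- \<i> * of_real pi - pv_integral l)) (at_right (1 / \<epsilon>))"
    by (simp add: at_le)
qed

section \<open>The two halves of the beta integral\<close>

definition \<psi>0 :: real where "\<psi>0 = (\<epsilon> - 1) * ln (\<epsilon> - 1) - \<epsilon> * ln \<epsilon>"

lemma psi_saddle: "psi \<epsilon> (of_real \<epsilon>) = of_real \<psi>0"
  using eps Ln_of_real[of "\<epsilon> - 1"] Ln_of_real[of \<epsilon>] by (simp add: psi_def \<psi>0_def)

text \<open>All powers of \<epsilon> and \<epsilon> - 1 cancel, including those with exponents
  proportional to l. The integrating factor at 1/\<epsilon> thus removes exactly the factor in front
  of the one-sided limits of the Cauchy transform.\<close>

lemma saddle_factor:
  "of_real (1 / \<epsilon>) powr beta_p l * of_real (1 - 1 / \<epsilon>) powr beta_q l * (of_real \<epsilon> * \<rho> l (of_real \<epsilon>)) = 1"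
proof -
  define L L1 where "L = complex_of_real (ln \<epsilon>)" and "L1 = complex_of_real (ln (\<epsilon> - 1))"
  have 1: "complex_of_real (1 / \<epsilon>) powr s = exp (- s * L)" for s
    using eps Ln_of_real[of "1 / \<epsilon>"] by (simp add: powr_def L_def ln_div)
  have 2: "complex_of_real (1 - 1 / \<epsilon>) powr s = exp (s * (L1 - L))" for s
  proof -
    have "1 - 1 / \<epsilon> = (\<epsilon> - 1) / \<epsilon>" using eps by (simp add: field_simps)
    then have "ln (1 - 1 / \<epsilon>) = ln (\<epsilon> - 1) - ln \<epsilon>" using eps by (simp add: ln_div)
    moreover have "1 - 1 / \<epsilon> > 0" using eps by simp
    ultimately show ?thesis using eps Ln_of_real[of "1 - 1 / \<epsilon>"] unfolding powr_def L_def L1_def by auto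
  qed
  have 3: "complex_of_real \<epsilon> powr s = exp (s * L)" for s
    using eps Ln_of_real[of \<epsilon>] by (simp add: powr_def L_def)
  have 4: "(complex_of_real \<epsilon> - 1) powr s = exp (s * L1)" for s
    using eps Ln_of_real[of "\<epsilon> - 1"] by (simp add: powr_def L1_def)
  have 5: "complex_of_real \<epsilon> = exp L"
    using eps unfolding L_def by (simp add: exp_of_real)
  have 6: "psi \<epsilon> (of_real \<epsilon>) = (of_real \<epsilon> - 1) * L1 - of_real \<epsilon> * L"
    by (simp add: psi_saddle \<psi>0_def L_def L1_def)
  have "of_real (1 / \<epsilon>) powr beta_p l * of_real (1 - 1 / \<epsilon>) powr beta_q l *
      (of_real \<epsilon> * \<rho> l (of_real \<epsilon>)) =
     exp (- beta_p l * L + beta_q l * (L1 - L) + L + (a - 1) * L + (c - a - 1) * L1 - of_real l *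
         ((of_real \<epsilon> - 1) * L1 - of_real \<epsilon> * L))"
    unfolding \<rho>_def famp_def 1 2 3 4 6 by (subst (1) 5)
        (simp add: exp_add exp_diff exp_minus divide_inverse mult_ac)
  also have "- beta_p l * L + beta_q l * (L1 - L) + L + (a - 1) * L + (c - a - 1) * L1 - of_real l
      * ((of_real \<epsilon> - 1) * L1 - of_real \<epsilon> * L) = 0"
    unfolding beta_p_def beta_q_def by (simp add: algebra_simps)
  finally show ?thesis by simp
qed

definition boundary :: "real \<Rightarrow> real \<Rightarrow> complex" where
  "boundary l y = boundary_term l y r - boundary_term l y (-r)"

definition scaled_transform :: "real \<Rightarrow> real \<Rightarrow> complex" where
  "scaled_transform l y = of_real y powr beta_p l * of_real (1 - y) powr beta_q l * cauchy_transform l y"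

lemma scaled_transform_deriv:
  assumes "0 < y" "y < 1" "y \<noteq> 1 / \<epsilon>"
  shows "(scaled_transform l has_vector_derivative beta_kernel (beta_p l) (beta_q l) y *
      (beta_p l * mass l + boundary l y)) (at y)"
  unfolding scaled_transform_def[abs_def] boundary_def
  by (rule beta_kernel_ode[OF cauchy_transform_deriv[OF assms(3)] assms(1,2)
      cauchy_transform_ode[OF assms(3)]])

lemma cauchy_transform_isCont: "y \<noteq> 1 / \<epsilon> \<Longrightarrow> isCont (cauchy_transform l) y"
  by (rule has_vector_derivative_continuous[OF cauchy_transform_deriv])

lemma scaled_transform_tendsto_0: "Re (beta_p l) > 0 \<Longrightarrow> (scaled_transform l \<longlongrightarrow> 0) (at_right 0)"
proof -
  assume "Re (beta_p l) > 0"
  have "(cauchy_transform l \<longlongrightarrow> cauchy_transform l 0) (at_right 0)"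
    using cauchy_transform_isCont[of 0 l] eps by (auto simp: isCont_def intro: tendsto_within_subset)
  then have "(scaled_transform l \<longlongrightarrow> 0 * of_real (1 - 0) powr beta_q l * cauchy_transform l 0)
      (at_right 0)"
    unfolding scaled_transform_def[abs_def] using \<open>Re (beta_p l) > 0\<close>
    by (intro tendsto_intros tendsto_powr_0) (auto simp: complex_nonpos_Reals_iff)
  then show ?thesis by simp
qed

lemma scaled_transform_tendsto_1: "Re (beta_q l) > 0 \<Longrightarrow> (scaled_transform l \<longlongrightarrow> 0) (at_left 1)"
proof -
  assume "Re (beta_q l) > 0"
  have "(cauchy_transform l \<longlongrightarrow> cauchy_transform l 1) (at_left 1)"
    using cauchy_transform_isCont[of 1 l] eps by (auto simp: isCont_def intro: tendsto_within_subset)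
  moreover have "((\<lambda>y::real. of_real (1 - y) powr beta_q l) \<longlongrightarrow> 0) (at_left 1)"
  proof (rule filterlim_compose[OF tendsto_powr_0[OF \<open>Re (beta_q l) > 0\<close>]])
    show "filterlim (\<lambda>y::real. 1 - y) (at_right 0) (at_left 1)"
      by (auto simp: filterlim_at eventually_at_filter intro!: tendsto_eq_intros)
  qed
  ultimately have "(scaled_transform l \<longlongrightarrow> of_real 1 powr beta_p l * 0 * cauchy_transform l 1) (at_left 1)"
    unfolding scaled_transform_def[abs_def] by (intro tendsto_intros)
        (auto simp: complex_nonpos_Reals_iff)
  then show ?thesis by simp
qed

lemma
  assumes l: "l \<ge> 0"
  shows scaled_transform_tendsto_left: "(scaled_transform l \<longlongrightarrow> \<i> * of_real pi - pv_integral l)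
      (at_left (1 / \<epsilon>))"
    and scaled_transform_tendsto_right: "(scaled_transform l \<longlongrightarrow> - \<i> * of_real pi - pv_integral l)
        (at_right (1 / \<epsilon>))"
proof -
  have x: "0 < 1 / \<epsilon>" "1 / \<epsilon> < 1" using eps by simp_all
  have *: "(scaled_transform l \<longlongrightarrow> w) (at (1 / \<epsilon>) within S)" if
      "(cauchy_transform l \<longlongrightarrow> of_real \<epsilon> * \<rho> l (of_real \<epsilon>) * w) (at (1 / \<epsilon>) within S)" for w S
  proof -
    have "(scaled_transform l \<longlongrightarrow> of_real (1 / \<epsilon>) powr beta_p l * of_real (1 - 1 / \<epsilon>) powr beta_q l
        * (of_real \<epsilon> * \<rho> l (of_real \<epsilon>) * w)) (at (1 / \<epsilon>) within S)"
      unfolding scaled_transform_def[abs_def] using x by (intro tendsto_intros that)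
          (auto simp: complex_nonpos_Reals_iff)
    also have "of_real (1 / \<epsilon>) powr beta_p l * of_real (1 - 1 / \<epsilon>) powr beta_q l *
        (of_real \<epsilon> * \<rho> l (of_real \<epsilon>) * w) = w"
      using saddle_factor[of l] by (simp only: mult.assoc[symmetric]) (simp only: mult.assoc mult_1_left)
    finally show ?thesis .
  qed
  show "(scaled_transform l \<longlongrightarrow> \<i> * of_real pi - pv_integral l) (at_left (1 / \<epsilon>))" by
      (rule *[OF cauchy_transform_tendsto_left[OF l]])
  show "(scaled_transform l \<longlongrightarrow> - \<i> * of_real pi - pv_integral l) (at_right (1 / \<epsilon>))" by
      (rule *[OF cauchy_transform_tendsto_right[OF l]])
qed

text \<open>The derivative of \<open>scaled_transform\<close> is integrated on each side of the
  jump. The transform vanishes at 0 and at 1, so only the limits at 1/\<epsilon> remain, the right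
  one with reversed sign.\<close>

lemma
  assumes l: "l \<ge> 0"
  shows has_integral_left: "Re (beta_p l) > 0 \<Longrightarrow>
      ((\<lambda>y. beta_kernel (beta_p l) (beta_q l) y * (beta_p l * mass l + boundary l y)) has_integral
          \<i> * of_real pi - pv_integral l) {0..1 / \<epsilon>}"
    and has_integral_right: "Re (beta_q l) > 0 \<Longrightarrow>
      ((\<lambda>y. beta_kernel (beta_p l) (beta_q l) y * (beta_p l * mass l + boundary l y)) has_integral
          \<i> * of_real pi + pv_integral l) {1 / \<epsilon>..1}"
proof -
  have x: "0 < 1 / \<epsilon>" "1 / \<epsilon> < 1" using eps by simp_all
  show "((\<lambda>y. beta_kernel (beta_p l) (beta_q l) y * (beta_p l * mass l + boundary l y))
      has_integral \<i> * of_real pi - pv_integral l) {0..1 / \<epsilon>}"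
    if "Re (beta_p l) > 0"
    using has_integral_FTC_limits[OF x(1) scaled_transform_deriv
        scaled_transform_tendsto_0[OF that] scaled_transform_tendsto_left[OF l]] x by simp
  show "((\<lambda>y. beta_kernel (beta_p l) (beta_q l) y * (beta_p l * mass l + boundary l y))
      has_integral \<i> * of_real pi + pv_integral l) {1 / \<epsilon>..1}"
    if "Re (beta_q l) > 0"
    using has_integral_FTC_limits[OF x(2) scaled_transform_deriv
        scaled_transform_tendsto_right[OF l] scaled_transform_tendsto_1[OF that]] x
    by (simp add: algebra_simps)
qed

section \<open>Exponential smallness of the boundary terms\<close>

text \<open>At v = r and v = -r the path is off the real axis, so the kernel has no pole for real y,
  and l enters only through exp(-l psi), whose modulus there is explicit.\<close>

lemma boundary_bound: "\<exists>D\<ge>0. \<forall>l. \<forall>y\<in>{0..1}. norm (boundary l y) \<le> D * exp (- l * (\<psi>0 + \<mu> * r\<^sup>2))"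
proof -
  define h where "h v y = of_real y * \<gamma> v * (\<gamma> v - 1) * famp a c (\<gamma> v) / (1 - \<gamma> v * of_real y)"
      for v y :: real
  have "\<exists>D. \<forall>y\<in>{0..1}. norm (h v y) \<le> D" if "v = r \<or> v = -r" for v
  proof -
    have v: "v \<in> {-r..r}" "v \<noteq> 0" using that r by auto
    have "1 - \<gamma> v * of_real y \<noteq> 0" for y
    proof
      assume eq: "1 - \<gamma> v * of_real y = 0"
      have "v * Im (q v) * y = 0" using arg_cong[OF eq, of Im] by (simp add: path_eq[OF v(1)])
      then have "y = 0" using v q_Im[OF v(1)] by auto
      then show False using eq by simp
    qed
    then have "continuous_on {0..1} (h v)"
      unfolding h_def by (intro continuous_intros) auto
    then have "bounded (h v ` {0..1})"
      by (intro compact_imp_bounded compact_continuous_image) auto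
    then show ?thesis by (auto simp: bounded_iff)
  qed
  from this[of r] this[of "-r"]
  obtain D1 D2 where D: "\<And>y. y \<in> {0..1} \<Longrightarrow> norm (h r y) \<le> D1" "\<And>y. y \<in> {0..1} \<Longrightarrow> norm (h (-r) y) \<le> D2"
    by blast
  have term_eq: "norm (boundary_term l y v) = norm (h v y) * exp (- l * (\<psi>0 + \<mu> * r\<^sup>2))" if "v = r
      \<or> v = -r" for l y v
  proof -
    have v: "v \<in> {-r..r}" "v\<^sup>2 = r\<^sup>2" using that r by auto
    have "boundary_term l y v = h v y * exp (- of_real l * psi \<epsilon> (\<gamma> v))"
      by (simp add: boundary_term_def h_def \<rho>_def)
    also have "exp (- of_real l * psi \<epsilon> (\<gamma> v)) = of_real (exp (- l * (\<psi>0 + \<mu> * r\<^sup>2)))"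
      unfolding exp_psi_path[OF v(1)] psi_saddle v(2)
      by (simp add: exp_of_real[symmetric] exp_add[symmetric] algebra_simps)
    finally show ?thesis by (simp add: norm_mult)
  qed
  have "norm (boundary l y) \<le> (D1 + D2) * exp (- l * (\<psi>0 + \<mu> * r\<^sup>2))" if "y \<in> {0..1}" for l y
  proof -
    have "norm (boundary l y) \<le> norm (boundary_term l y r) + norm (boundary_term l y (-r))"
      unfolding boundary_def by (rule norm_triangle_ineq4)
    also have "\<dots> = (norm (h r y) + norm (h (-r) y)) * exp (- l * (\<psi>0 + \<mu> * r\<^sup>2))"
      by (simp add: term_eq distrib_right)
    also have "\<dots> \<le> (D1 + D2) * exp (- l * (\<psi>0 + \<mu> * r\<^sup>2))"
      using D that by (intro mult_right_mono add_mono) auto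
    finally show ?thesis .
  qed
  moreover have "D1 + D2 \<ge> 0" using D[of 0] norm_ge_zero[of "h r 0"] norm_ge_zero[of "h (-r) 0"]
      by (meson add_nonneg_nonneg atLeastAtMost_iff order.refl order.trans zero_le_one)
  ultimately show ?thesis by blast
qed

text \<open>The tangent inequality ln z \<le> z - 1 is applied to z = y \<epsilon> and z = (1 - y)
  \<epsilon> / (\<epsilon> - 1), both equal to 1 at y = 1/\<epsilon>; with the weights 1 and
  \<epsilon> - 1 the linear terms cancel. So y (1-y)^(\<epsilon>-1) peaks at 1/\<epsilon> with value
  exp(\<open>\<psi>0\<close>).\<close>

lemma kernel_base_le:
  assumes "0 < y" "y < 1"
  shows "ln y + (\<epsilon> - 1) * ln (1 - y) \<le> \<psi>0"
proof -
  have x: "0 < 1 / \<epsilon>" "0 < 1 - 1 / \<epsilon>" using eps by simp_all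
  have 1: "ln (y * \<epsilon>) \<le> y * \<epsilon> - 1"
    using assms eps by (intro ln_le_minus_one) simp
  have "ln ((1 - y) * (\<epsilon> / (\<epsilon> - 1))) \<le> (1 - y) * (\<epsilon> / (\<epsilon> - 1)) - 1"
    using assms eps by (intro ln_le_minus_one) simp
  then have "(\<epsilon> - 1) * ln ((1 - y) * (\<epsilon> / (\<epsilon> - 1))) \<le> (\<epsilon> - 1) * ((1 - y) * (\<epsilon> / (\<epsilon> - 1)) - 1)"
    using eps by (intro mult_left_mono) auto
  also have "(\<epsilon> - 1) * ((1 - y) * (\<epsilon> / (\<epsilon> - 1)) - 1) = 1 - y * \<epsilon>"
    using eps by (simp add: field_simps)
  finally have "(\<epsilon> - 1) * ln ((1 - y) * (\<epsilon> / (\<epsilon> - 1))) \<le> 1 - y * \<epsilon>" .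
  with 1 have 2: "ln (y * \<epsilon>) + (\<epsilon> - 1) * ln ((1 - y) * (\<epsilon> / (\<epsilon> - 1))) \<le> 0" by linarith
  have 3: "ln (y * \<epsilon>) = ln y + ln \<epsilon>" using assms eps by (simp add: ln_mult)
  have 4: "ln ((1 - y) * (\<epsilon> / (\<epsilon> - 1))) = ln (1 - y) + ln \<epsilon> - ln (\<epsilon> - 1)"
    using assms eps by (simp add: ln_mult ln_div)
  show ?thesis using 2 unfolding 3 4 \<psi>0_def by (simp add: algebra_simps)
qed

lemma Re_beta_pq: "Re (beta_p l) = Re c + l - 1" "Re (beta_q l) = 1 + Re a - Re c + (\<epsilon> - 1) * l"
  by (simp_all add: beta_p_def beta_q_def)

text \<open>The kernel at l is the kernel at l0 times a factor whose modulus is the power l - l0 of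
  the base just estimated; the former supplies a majorant independent of l.\<close>

lemma kernel_bound:
  assumes "l0 \<le> l" "0 < y" "y < 1"
  shows "norm (beta_kernel (beta_p l) (beta_q l) y) \<le>
    exp (\<psi>0 * (l - l0)) * (y powr (Re (beta_p l0) - 1) * (1 - y) powr (Re (beta_q l0) - 1))"
proof -
  have "norm (beta_kernel (beta_p l) (beta_q l) y) = exp
      ((l - l0) * (ln y + (\<epsilon> - 1) * ln (1 - y))) * (y powr (Re (beta_p l0) - 1) * (1 - y) powr
      (Re (beta_q l0) - 1))"
    unfolding norm_beta_kernel[OF assms(2,3)] Re_beta_pq using assms(2,3)
    by (simp add: powr_def exp_add[symmetric] algebra_simps)
  also have "\<dots> \<le> exp (\<psi>0 * (l - l0)) * (y powr (Re (beta_p l0) - 1) * (1 - y) powr (Re (beta_q l0) - 1))"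
    using mult_left_mono[OF kernel_base_le[OF assms(2,3)], of "l - l0"] assms(1)
    by (intro mult_right_mono) (auto simp: mult.commute)
  finally show ?thesis .
qed

text \<open>The kernel is O(exp(\<open>\<psi>0\<close> l)) and the boundary terms are
  O(exp(-(\<open>\<psi>0\<close> + \<mu> r^2) l)). The factors exp(\<open>\<psi>0\<close> l) cancel,
  and exp(-\<mu> r^2 l) remains as the error of dropping the boundary terms.\<close>

lemma incomplete_beta_asymp:
  "\<exists>D l0. \<forall>l\<ge>l0. l \<ge> 0 \<and> Re (beta_p l) > 0 \<and> Re (beta_q l) > 0 \<and>
     norm (beta_p l * mass l * integral {0..1 / \<epsilon>} (beta_kernel (beta_p l) (beta_q l)) -
         (\<i> * of_real pi - pv_integral l)) \<le> D * exp (- (\<mu> * r\<^sup>2) * l) \<and>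
     norm (beta_p l * mass l * integral {1 / \<epsilon>..1} (beta_kernel (beta_p l) (beta_q l)) -
         (\<i> * of_real pi + pv_integral l)) \<le> D * exp (- (\<mu> * r\<^sup>2) * l)"
proof -
  obtain D where D: "D \<ge> 0" "\<And>l y. y \<in> {0..1} \<Longrightarrow> norm (boundary l y) \<le> D * exp (- l * (\<psi>0 + \<mu> * r\<^sup>2))"
    using boundary_bound by blast
  \<comment> \<open>2 - Re c yields Re (\<open>beta_p l\<close>) \<ge> 1, and (Re c - Re a) /
    (\<epsilon> - 1) yields Re (\<open>beta_q l\<close>) \<ge> 1.\<close>
  define l0 where "l0 = max 0 (max (2 - Re c) ((Re c - Re a) / (\<epsilon> - 1)))"
  have Re_pos: "l \<ge> 0" "Re (beta_p l) > 0" "Re (beta_q l) > 0" if "l \<ge> l0" for l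
  proof -
    have l: "l \<ge> 0" "l \<ge> 2 - Re c" "l \<ge> (Re c - Re a) / (\<epsilon> - 1)" using that by (auto simp: l0_def)
    then have "(\<epsilon> - 1) * l \<ge> Re c - Re a" using eps by (simp add: field_simps)
    then show "l \<ge> 0" "Re (beta_p l) > 0" "Re (beta_q l) > 0" using l by (simp_all add: Re_beta_pq)
  qed
  define g where "g y = y powr (Re (beta_p l0) - 1) * (1 - y) powr (Re (beta_q l0) - 1)" for y :: real
  have g: "g integrable_on {0..1}"
    unfolding g_def[abs_def] by (intro integrable_Beta' Re_pos) auto
  define D' where "D' = D * exp (- \<psi>0 * l0) * integral {0..1} g"
  have main: "norm (beta_p l * mass l * integral {u..v} (beta_kernel (beta_p l) (beta_q l)) - w) \<le>
      D' * exp (- (\<mu> * r\<^sup>2) * l)"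
    if l: "l \<ge> l0" and uv: "0 \<le> u" "u \<le> v" "v \<le> 1"
      and I: "((\<lambda>y. beta_kernel (beta_p l) (beta_q l) y * (beta_p l * mass l + boundary l y))
          has_integral w) {u..v}" for l u v w
  proof -
    let ?k = "beta_kernel (beta_p l) (beta_q l)"
    have sub: "{u..v} \<subseteq> {0..1}" using uv by auto
    have "?k integrable_on {0..1}"
      using has_integral_beta_kernel[OF Re_pos(2,3)[OF l]] by blast
    then have k: "(?k has_integral integral {u..v} ?k) {u..v}"
      using integrable_on_subinterval[OF _ sub] by blast
    have guv: "g integrable_on {u..v}" by (rule integrable_on_subinterval[OF g sub])
    from has_integral_diff[OF has_integral_mult_right[OF k, of "beta_p l * mass l"] I]
    have b: "((\<lambda>y. - (?k y * boundary l y)) has_integral beta_p l * mass l * integral {u..v} ?k -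
        w) {u..v}"
      by (simp add: algebra_simps)
    let ?C = "D * exp (- l * (\<psi>0 + \<mu> * r\<^sup>2)) * exp (\<psi>0 * (l - l0))"
    have "norm (beta_p l * mass l * integral {u..v} ?k - w) \<le> integral {u..v} (\<lambda>y. ?C * g y)"
      unfolding b[THEN integral_unique, symmetric]
    proof (rule integral_norm_bound_integral)
      show "(\<lambda>y. - (?k y * boundary l y)) integrable_on {u..v}" using b by blast
      show "(\<lambda>y. ?C * g y) integrable_on {u..v}" using integrable_on_cmult_left[OF guv, of ?C] by simp
      fix y assume "y \<in> {u..v}"
      then have y: "y \<in> {0..1}" using sub by blast
      have "norm (?k y) \<le> exp (\<psi>0 * (l - l0)) * g y"
      proof (cases "0 < y \<and> y < 1")
        case True then show ?thesis using kernel_bound[OF l] by (simp add: g_def)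
      next
        case False
        then have "y = 0 \<or> y = 1" using y by auto
        then have "?k y = 0" by (auto simp: beta_kernel_def)
        then show ?thesis by (simp add: g_def)
      qed
      then have "norm (?k y * boundary l y) \<le> (exp (\<psi>0 * (l - l0)) * g y) *
          (D * exp (- l * (\<psi>0 + \<mu> * r\<^sup>2)))"
        unfolding norm_mult using D(2)[OF y, of l] by (intro mult_mono) (auto simp: g_def)
      then show "norm (- (?k y * boundary l y)) \<le> ?C * g y" by (simp add: mult_ac)
    qed
    also have "\<dots> = ?C * integral {u..v} g" by (rule integral_mult_right)
    also have "\<dots> \<le> ?C * integral {0..1} g"
      using D(1) by (intro mult_left_mono integral_subset_le sub guv g) (auto simp: g_def)
    also have "?C = D * exp (- \<psi>0 * l0) * exp (- (\<mu> * r\<^sup>2) * l)"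
      by (simp add: mult.assoc exp_add[symmetric] algebra_simps)
    finally show ?thesis by (simp add: D'_def mult_ac)
  qed
  have x: "0 < 1 / \<epsilon>" "1 / \<epsilon> < 1" using eps by simp_all
  have "l \<ge> 0 \<and> Re (beta_p l) > 0 \<and> Re (beta_q l) > 0 \<and>
     norm (beta_p l * mass l * integral {0..1 / \<epsilon>} (beta_kernel (beta_p l) (beta_q l)) -
         (\<i> * of_real pi - pv_integral l)) \<le> D' * exp (- (\<mu> * r\<^sup>2) * l) \<and>
     norm (beta_p l * mass l * integral {1 / \<epsilon>..1} (beta_kernel (beta_p l) (beta_q l)) -
         (\<i> * of_real pi + pv_integral l)) \<le> D' * exp (- (\<mu> * r\<^sup>2) * l)"
    if l: "l \<ge> l0" for l
    using Re_pos[OF l] x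
    by (intro conjI main[OF l] has_integral_left has_integral_right) auto
  then show ?thesis by blast
qed

section \<open>Asymptotic expansion\<close>

text \<open>Only the odd part of \<open>K\<close> survives in the principal value, and there the powers of \<open>\<i>\<close>
  turn \<open>K (\<i> v)\<close> into a real Gaussian moment problem.\<close>

lemma odd_part_expansion:
  "\<exists>G. continuous_on {-r..r} G \<and> (\<forall>v. v \<noteq> 0 \<longrightarrow> G v = (K (\<i> * of_real v) - K (- (\<i> * of_real v))) /
      (2 * of_real v)) \<and>
     (\<forall>m. \<exists>C. \<forall>v\<in>{-r..r}. norm (G v - (\<Sum>k<m. \<i> * (-1) ^ k * D_coeff \<epsilon> a c (2 * k + 1) k * of_real
         v ^ (2 * k))) \<le> C * v ^ (2 * m))"
proof -
  define F where "F = fps_expansion K 0"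
  define O' where "O' w = (K w - K (- w)) / 2" for w
  have K: "K has_fps_expansion F"
    unfolding F_def using K_hol r by (intro has_fps_expansion_fps_expansion[of "ball 0 R"]) auto
  have "(K \<circ> (\<lambda>w. - w)) has_fps_expansion fps_compose F (- fps_X)"
    by (intro has_fps_expansion_compose K fps_expansion_intros) simp
  then have O'_fps: "O' has_fps_expansion fps_const (1/2) * (F - fps_compose F (- fps_X))"
    using has_fps_expansion_cmult_left[OF has_fps_expansion_diff[OF K], of _ _ "1/2"]
    unfolding O'_def[abs_def] o_def by simp
  define FO where "FO = fps_const (1/2) * (F - fps_compose F (- fps_X))"
  have FO_nth: "fps_nth FO n = (if odd n then fps_nth F n else 0)" for n
    by (simp add: FO_def fps_compose_uminus')
  \<comment> \<open>The odd part has no constant term, so it can be divided by w; the value at 0 is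
    the one that keeps L analytic.\<close>
  define L where "L w = (if w = 0 then fps_nth FO 1 else O' w / w ^ 1)" for w
  have L_fps: "L has_fps_expansion fps_shift 1 FO"
  proof (cases "FO = 0")
    case True
    have "\<forall>\<^sub>F w in nhds 0. O' w = 0"
      using O'_fps True by (simp add: FO_def has_fps_expansion_0_iff)
    then have "\<forall>\<^sub>F w in nhds 0. L w = 0" by eventually_elim (simp add: L_def True)
    then show ?thesis by (simp add: True has_fps_expansion_0_iff)
  next
    case False
    then have "1 \<le> subdegree FO" by (intro subdegree_geI) (auto simp: FO_nth)
    then show ?thesis unfolding L_def[abs_def] FO_def by (intro has_fps_expansion_shift O'_fps) auto
  qed
  have sub: "cball 0 r \<subseteq> ball (0::complex) R" using r by auto
  have Kc: "continuous_on (cball 0 r) K"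
    using holomorphic_on_imp_continuous_on[OF K_hol] sub by (rule continuous_on_subset)
  have Kc': "continuous_on (cball 0 r) (\<lambda>w. K (- w))"
    by (rule continuous_on_compose2[OF Kc]) (auto intro!: continuous_intros)
  have L0: "isCont L 0" using has_fps_expansion_imp_continuous[OF L_fps, of UNIV] .
  have "continuous_on (cball 0 r - {0}) (\<lambda>w. O' w / w ^ 1)"
    unfolding O'_def by (intro continuous_intros continuous_on_subset[OF Kc]
        continuous_on_subset[OF Kc']) auto
  then have cont': "continuous_on (cball 0 r - {0}) L"
    by (rule continuous_on_cong[THEN iffD1, rotated 2]) (auto simp: L_def)
  have Lc: "continuous_on (cball 0 r) L"
    by (rule continuous_on_punctured[OF L0 cont'])
  define G where "G v = \<i> * L (\<i> * of_real v)" for v :: real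
  have iv: "\<i> * of_real v \<in> cball 0 r" if "v \<in> {-r..r}" for v :: real
    using that by (auto simp: norm_mult)
  have "continuous_on {-r..r} G"
    unfolding G_def by (intro continuous_intros continuous_on_compose2[OF Lc]) (use iv in auto)
  moreover have "G v = (K (\<i> * of_real v) - K (- (\<i> * of_real v))) / (2 * of_real v)" if "v \<noteq> 0" for v
    using that by (simp add: G_def L_def O'_def)
  moreover have "\<exists>C. \<forall>v\<in>{-r..r}. norm (G v - (\<Sum>k<m. \<i> * (-1) ^ k * D_coeff \<epsilon> a c (2 * k + 1) k *
      of_real v ^ (2 * k))) \<le> C * v ^ (2 * m)" for m
  proof -
    obtain C where C: "\<And>w. w \<in> cball 0 r \<Longrightarrow> norm (L w - (\<Sum>n<2 * m. fps_nth (fps_shift 1 FO) n * w ^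
        n)) \<le> C * norm w ^ (2 * m)"
      using has_fps_expansion_remainder_bound[OF L_fps Lc r(1), of "2 * m"] by blast
    have "norm (G v - (\<Sum>k<m. \<i> * (-1) ^ k * D_coeff \<epsilon> a c (2 * k + 1) k * of_real v ^ (2 * k))) \<le>
        C * v ^ (2 * m)"
      if v: "v \<in> {-r..r}" for v
    proof -
      \<comment> \<open>After the shift the odd coefficients of K sit at even indices and the others
        vanish, so 2m terms in n are m terms in k.\<close>
      have "(\<Sum>n<2 * m. fps_nth (fps_shift 1 FO) n * (\<i> * of_real v) ^ n) =
          (\<Sum>k<m. fps_nth F (2 * k + 1) * (\<i> * of_real v) ^ (2 * k))"
        by (induction m) (simp_all add: FO_nth)
      also have "\<dots> = (\<Sum>k<m. (-1) ^ k * D_coeff \<epsilon> a c (2 * k + 1) k * of_real v ^ (2 * k))"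
      proof (intro sum.cong refl)
        fix k
        have "(\<i> * of_real v) ^ (2 * k) = (-1) ^ k * (of_real v :: complex) ^ (2 * k)"
          by (simp only: power_mult_distrib power_mult[of \<i> 2 k] power2_i)
        then show "fps_nth F (2 * k + 1) * (\<i> * of_real v) ^ (2 * k) = (-1) ^ k * D_coeff \<epsilon> a c
            (2 * k + 1) k * of_real v ^ (2 * k)"
          using K_odd[of k] unfolding F_def by simp
      qed
      finally have eq: "(\<Sum>k<m. \<i> * (-1) ^ k * D_coeff \<epsilon> a c (2 * k + 1) k * of_real v ^ (2 * k)) =
         \<i> * (\<Sum>n<2 * m. fps_nth (fps_shift 1 FO) n * (\<i> * of_real v) ^ n)"
        by (simp add: sum_distrib_left mult.assoc)
      show ?thesis
        using C[OF iv[OF v]] unfolding eq G_def right_diff_distrib[symmetric] norm_mult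
        by (simp add: norm_mult power_mult)
    qed
    then show ?thesis by blast
  qed
  ultimately show ?thesis by blast
qed

text \<open>Averaging the integrand over v and -v cancels the subtracted 1 and the even part of K,
  so the principal value becomes an ordinary Gaussian integral of a continuous function.\<close>

lemma pv_integral_symmetrize:
  assumes G: "continuous_on {-r..r} G"
    and G_eq: "\<And>v. v \<noteq> 0 \<Longrightarrow> G v = (K (\<i> * of_real v) - K (- (\<i> * of_real v))) / (2 * of_real v)"
        and l: "l \<ge> 0"
  shows "pv_integral l = integral {-r..r} (\<lambda>v. of_real (exp (- (l * \<mu>) * v\<^sup>2)) * G v)"
proof -
  let ?f = "\<lambda>v. (gauss_weight l v - 1) / complex_of_real v"
  have int: "?f integrable_on {-r..r}"
  proof -
    obtain C where C: "\<And>v. v \<in> {-r..r} \<Longrightarrow> norm (gauss_weight l v - 1) \<le> C * \<bar>v\<bar>" and C0: "C \<ge> 0"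
      using gauss_weight_Lipschitz[OF l] by blast
    show ?thesis
    \<comment> \<open>Division by 0 sets the integrand to 0 at v = 0, where it may be discontinuous;
      integrability therefore comes from measurability and the Lipschitz bound.\<close>
    proof (rule measurable_bounded_by_integrable_imp_integrable)
      show "?f \<in> borel_measurable (lebesgue_on {-r..r})"
        by (intro borel_measurable_divide continuous_imp_measurable_on_sets_lebesgue
            continuous_intros gauss_weight_cont) auto
      show "norm (?f v) \<le> C" if "v \<in> {-r..r}" for v
        using C[OF that] C0 by (cases "v = 0") (simp_all add: norm_divide field_simps)
    qed auto
  qed
  have "((\<lambda>v. ?f (- v)) has_integral pv_integral l) {-r..r}"
    using has_integral_reflect_real[of ?f "pv_integral l" r "-r"] integrable_integral[OF int] by
        (simp add: pv_integral_def)
  from has_integral_add[OF integrable_integral[OF int] this]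
  have "((\<lambda>v. (?f v + ?f (- v)) / 2) has_integral (pv_integral l + pv_integral l) / 2) {-r..r}"
    unfolding pv_integral_def by (rule has_integral_divide)
  then have "((\<lambda>v. (?f v + ?f (- v)) / 2) has_integral pv_integral l) {-r..r}" by simp
  then have "((\<lambda>v. of_real (exp (- (l * \<mu>) * v\<^sup>2)) * G v) has_integral pv_integral l) {-r..r}"
    by (rule has_integral_spike_finite[of "{0}", rotated 2])
       (auto simp: G_eq gauss_weight_def divide_simps algebra_simps)
  then show ?thesis by (simp add: integral_unique)
qed

lemma pv_integral_asymp:
  "\<exists>D. \<forall>l>0. norm (pv_integral l - \<i> * (\<Sum>k<m. (-1) ^ k * D_coeff \<epsilon> a c (2 * k + 1) k * of_real
      (Gamma (real k + 1/2) * (l * \<mu>) powr (- real k - 1/2))))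
     \<le> D * l powr (- real m - 1/2)"
proof -
  obtain G where G: "continuous_on {-r..r} G"
     "\<And>v. v \<noteq> 0 \<Longrightarrow> G v = (K (\<i> * of_real v) - K (- (\<i> * of_real v))) / (2 * of_real v)"
     "\<And>m. \<exists>C. \<forall>v\<in>{-r..r}. norm (G v - (\<Sum>k<m. \<i> * (-1) ^ k * D_coeff \<epsilon> a c (2 * k + 1) k * of_real
         v ^ (2 * k))) \<le> C * v ^ (2 * m)"
    using odd_part_expansion by blast
  obtain C where C: "\<And>v. v \<in> {-r..r} \<Longrightarrow> norm (G v - (\<Sum>k<m. \<i> * (-1) ^ k * D_coeff \<epsilon> a c (2 * k + 1)
      k * of_real v ^ (2 * k))) \<le> C * v ^ (2 * m)"
    using G(3)[of m] by blast
  obtain D where D: "\<And>s. s > 0 \<Longrightarrow> norm (integral {-r..r} (\<lambda>v. of_real (exp (- s * v\<^sup>2)) * G v)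
              - (\<Sum>k<m. \<i> * (-1) ^ k * D_coeff \<epsilon> a c (2 * k + 1) k * of_real
                  (Gamma (real k + 1/2) * s powr (- real k - 1/2))))
            \<le> D * s powr (- real m - 1/2)"
    using gaussian_Watson[OF r(1) G(1) C] by blast
  have "norm (pv_integral l - \<i> * (\<Sum>k<m. (-1) ^ k * D_coeff \<epsilon> a c (2 * k + 1) k * of_real
      (Gamma (real k + 1/2) * (l * \<mu>) powr (- real k - 1/2))))
     \<le> D * \<mu> powr (- real m - 1/2) * l powr (- real m - 1/2)" if "l > 0" for l
    using D[of "l * \<mu>"] that \<mu>_pos pv_integral_symmetrize[OF G(1,2), of l]
    by (simp add: powr_mult sum_distrib_left mult_ac)
  then show ?thesis by blast
qed

section \<open>The quotient of the two halves and the full expansion\<close>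

definition beta_upper :: "real \<Rightarrow> complex" where "beta_upper l = integral {1 / \<epsilon>..1}
    (beta_kernel (beta_p l) (beta_q l))"
definition beta_lower :: "real \<Rightarrow> complex" where "beta_lower l = integral {0..1 / \<epsilon>}
    (beta_kernel (beta_p l) (beta_q l))"

text \<open>Multiplied by the common factor \<open>beta_p l * mass l\<close>, the halves are \<i> pi
  + pv and \<i> pi - pv up to an exponentially small error, with pv the value of
  \<open>pv_integral l\<close>. The factor cancels in the quotient, and its being nonzero follows
  from the perturbed sum being nonzero.\<close>

lemma ratio_asymp:
  "\<exists>C. \<forall>\<^sub>F l in at_top. beta_upper l + beta_lower l \<noteq> 0 \<and>
     norm ((beta_upper l - beta_lower l) / (beta_upper l + beta_lower l) - pv_integral l /
         (\<i> * of_real pi)) \<le> C * exp (- (\<mu> * r\<^sup>2) * l)"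
proof -
  define \<eta> where "\<eta> = \<mu> * r\<^sup>2"
  have \<eta>: "\<eta> > 0" using \<mu>_pos r by (simp add: \<eta>_def)
  obtain D l0 where D: "\<And>l. l \<ge> l0 \<Longrightarrow> norm (beta_p l * mass l * beta_lower l -
      (\<i> * of_real pi - pv_integral l)) \<le> D * exp (- \<eta> * l)"
      "\<And>l. l \<ge> l0 \<Longrightarrow> norm (beta_p l * mass l * beta_upper l - (\<i> * of_real pi + pv_integral l)) \<le> D
          * exp (- \<eta> * l)"
    using incomplete_beta_asymp unfolding beta_upper_def beta_lower_def \<eta>_def by blast
  \<comment> \<open>The expansion with no terms: \<open>pv_integral l\<close> is O(l^(-1/2)), in
    particular bounded for l \<ge> 1.\<close>
  obtain W where W: "\<And>l. l > 0 \<Longrightarrow> norm (pv_integral l) \<le> W * l powr (- 1/2)"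
    using pv_integral_asymp[of 0] by auto
  have lim: "((\<lambda>l. 2 * (D * exp (- \<eta> * l))) \<longlongrightarrow> 0) at_top"
    using \<eta> by real_asymp
  have "\<forall>\<^sub>F l in at_top. beta_upper l + beta_lower l \<noteq> 0 \<and>
     norm ((beta_upper l - beta_lower l) / (beta_upper l + beta_lower l) - pv_integral l /
         (\<i> * of_real pi)) \<le> (2 + \<bar>W\<bar>) * D * exp (- \<eta> * l)"
    using order_tendstoD(2)[OF lim zero_less_one] eventually_ge_at_top[of l0] eventually_ge_at_top[of 1]
  proof eventually_elim
    case (elim l)
    let ?s = "beta_p l * mass l"
    have "norm (pv_integral l) \<le> \<bar>W\<bar>"
    proof -
      have "norm (pv_integral l) \<le> W * l powr (- 1/2)" using W[of l] elim by simp
      also have "\<dots> \<le> \<bar>W\<bar> * l powr 0" using elim by (intro mult_mono powr_mono) auto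
      finally show ?thesis using elim by simp
    qed
    note P = perturbed_ratio[OF D[OF elim(2)] less_imp_le[OF elim(1)] this]
    have eqs: "?s * beta_lower l + ?s * beta_upper l = ?s * (beta_upper l + beta_lower l)" "?s *
        beta_upper l - ?s * beta_lower l = ?s * (beta_upper l - beta_lower l)"
      by (simp_all add: algebra_simps)
    from P(1) have nz: "?s \<noteq> 0" "beta_upper l + beta_lower l \<noteq> 0" unfolding eqs by auto
    have "(?s * (beta_upper l - beta_lower l)) / (?s * (beta_upper l + beta_lower l)) =
        (beta_upper l - beta_lower l) / (beta_upper l + beta_lower l)"
      using nz(1) by (rule mult_divide_mult_cancel_left)
    then show ?case using P(2) nz(2) unfolding eqs by (simp add: mult.assoc)
  qed
  then show ?thesis unfolding \<eta>_def by blast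
qed

text \<open>An exact identity. \<open>Gfactor\<close> is \<open>beta_p l\<close> times the whole
  beta integral, since Gamma C = (C - 1) Gamma (C - 1), and the bracket is twice the lower half over
  the whole; \<open>saddle_factor\<close> absorbs the powers of 1/\<epsilon> and 1 -
  1/\<epsilon>.\<close>

lemma Gauss_2F1_eq:
  assumes "Re (beta_p l) > 0" "Re (beta_q l) > 0" "Re (a + of_real \<epsilon> * of_real l) > 0" "beta_upper
      l + beta_lower l \<noteq> 0"
  shows "Gauss_2F1 (a + of_real \<epsilon> * of_real l) 1 (c + of_real l) (of_real (1 / \<epsilon>)) =
     Gfactor \<epsilon> a c l * exp (- of_real l * psi \<epsilon> (of_real \<epsilon>)) / (2 * of_real (1 / \<epsilon>)) * famp a c
         (of_real \<epsilon>)
       * (1 - (beta_upper l - beta_lower l) / (beta_upper l + beta_lower l))"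
proof -
  let ?A = "a + of_real \<epsilon> * of_real l" and ?C = "c + of_real l" and ?p = "beta_p l" and ?q = "beta_q l"
  let ?k = "beta_kernel ?p ?q"
  have pq: "?C - 1 = ?p" "?A - ?C + 1 = ?q" "?p + ?q = ?A"
    by (simp_all add: beta_p_def beta_q_def algebra_simps)
  have x: "0 < 1 / \<epsilon>" "1 / \<epsilon> < 1" using eps by simp_all
  have k: "(?k has_integral Beta ?p ?q) {0..1}" by (rule has_integral_beta_kernel[OF assms(1,2)])
  have k1: "?k integrable_on {0..1/\<epsilon>}" "?k integrable_on {1/\<epsilon>..1}"
    by (rule integrable_on_subinterval[OF has_integral_integrable[OF k]]; use x in simp)+
  have Beta: "beta_upper l + beta_lower l = Beta ?p ?q"
    using Henstock_Kurzweil_Integration.integral_combine[OF less_imp_le[OF x(1)]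
        less_imp_le[OF x(2)] has_integral_integrable[OF k]] integral_unique[OF k]
    by (simp add: beta_upper_def beta_lower_def add.commute)
  have "Re ?C > 1" using assms(1) by (simp add: beta_p_def)
  from Gauss_2F1_has_integral[OF x assms(3) this]
  have "((\<lambda>y. ?k y * ?p) has_integral of_real (1/\<epsilon>) powr ?p * of_real (1 - 1/\<epsilon>) powr ?q *
      Gauss_2F1 ?A 1 ?C (of_real (1/\<epsilon>))) {0..1/\<epsilon>}"
    unfolding pq .
  moreover have "((\<lambda>y. ?k y * ?p) has_integral beta_lower l * ?p) {0..1/\<epsilon>}"
    unfolding beta_lower_def by (intro has_integral_mult_left integrable_integral k1)
  ultimately have F: "of_real (1/\<epsilon>) powr ?p * of_real (1 - 1/\<epsilon>) powr ?q * Gauss_2F1 ?A 1 ?C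
      (of_real (1/\<epsilon>)) = beta_lower l * ?p"
    by (rule has_integral_unique)
  have "Gauss_2F1 ?A 1 ?C (of_real (1/\<epsilon>)) =
     (of_real (1 / \<epsilon>) powr ?p * of_real (1 - 1 / \<epsilon>) powr ?q * (of_real \<epsilon> * \<rho> l (of_real \<epsilon>))) *
         Gauss_2F1 ?A 1 ?C (of_real (1/\<epsilon>))"
    unfolding saddle_factor by simp
  also have "\<dots> = of_real \<epsilon> * \<rho> l (of_real \<epsilon>) * (beta_lower l * ?p)"
    unfolding F[symmetric] by (simp add: mult_ac)
  finally have 1: "Gauss_2F1 ?A 1 ?C (of_real (1/\<epsilon>)) = of_real \<epsilon> * \<rho> l (of_real \<epsilon>) *
      (beta_lower l * ?p)" .
  have "?p \<notin> \<int>\<^sub>\<le>\<^sub>0" using assms(1) nonpos_Ints_Re[of ?p] by auto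
  then have "Gamma ?C = ?p * Gamma ?p" using Gamma_plus1[of ?p] by (simp add: beta_p_def)
  then have G: "Gfactor \<epsilon> a c l = ?p * (beta_upper l + beta_lower l)"
    unfolding Beta Gfactor_def Beta_def pq beta_q_def[symmetric] by simp
  have "1 - (beta_upper l - beta_lower l) / (beta_upper l + beta_lower l) = 2 * beta_lower l /
      (beta_upper l + beta_lower l)"
    using assms(4) by (simp add: field_simps)
  then have 2: "Gfactor \<epsilon> a c l * (1 - (beta_upper l - beta_lower l) /
      (beta_upper l + beta_lower l)) = 2 * (beta_lower l * ?p)"
    unfolding G using assms(4) by simp
  have 3: "of_real \<epsilon> * \<rho> l (of_real \<epsilon>) = exp (- of_real l * psi \<epsilon> (of_real \<epsilon>)) / of_real (1 / \<epsilon>) *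
      famp a c (of_real \<epsilon>)"
    using eps by (simp add: \<rho>_def)
  have 4: "g * e / (2 * x) * f * t = (g * t) * (e / x * f) / 2" for g e x f t :: complex
    by (cases "x = 0") (simp_all add: field_simps)
  show ?thesis unfolding 1 4 2 3[symmetric] by simp
qed

text \<open>The sign comes from 2/psi''(\<epsilon>) = -1/\<mu>, the prefactor from
  |psi''(\<epsilon>)| = 2 \<mu>, and the Pochhammer symbol from Gamma(k + 1/2) = sqrt(pi)
  (1/2)_k.\<close>

lemma coefficient_eq:
  assumes "l > 0"
  shows "2 / of_real (sqrt (2 * pi * norm (psi2 \<epsilon>))) * (D_even \<epsilon> a c k * pochhammer (1 / 2) k /
      of_real (l powr (real k + 1 / 2)))
     = (-1) ^ k * D_coeff \<epsilon> a c (2 * k + 1) k * of_real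
         (Gamma (real k + 1/2) * (l * \<mu>) powr (- real k - 1/2)) / of_real pi"
proof -
  have "(1/2::real) \<notin> \<int>\<^sub>\<le>\<^sub>0" using nonpos_Ints_nonpos[of "1/2::real"] by auto
  from pochhammer_Gamma[OF this, of k]
  have "Gamma (real k + 1/2) = sqrt pi * pochhammer (1/2) k"
    by (simp add: add.commute Gamma_one_half_real)
  then have "complex_of_real (Gamma (real k + 1/2)) = of_real (sqrt pi) * of_real (pochhammer (1/2) k)"
    by simp
  also have "complex_of_real (pochhammer (1/2) k) = pochhammer (1/2) k" by
      (simp flip: pochhammer_of_real)
  finally have G: "complex_of_real (Gamma (real k + 1/2)) = of_real (sqrt pi) * pochhammer (1/2) k" .
  have "norm (psi2 \<epsilon>) = 2 * \<mu>" using \<mu>_pos unfolding psi2_\<mu> by (simp add: norm_mult)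
  then have s: "2 / sqrt (2 * pi * norm (psi2 \<epsilon>)) = 1 / (sqrt pi * sqrt \<mu>)"
    by (simp add: real_sqrt_mult mult_ac)
  have D: "D_even \<epsilon> a c k = (-1) ^ k * of_real (inverse \<mu> ^ k) * D_coeff \<epsilon> a c (2 * k + 1) k"
  proof -
    have "2 / (- complex_of_real (2 * \<mu>)) = (-1) * of_real (inverse \<mu>)"
      using \<mu>_pos by (simp add: field_simps)
    then show ?thesis
      unfolding D_even_def psi2_\<mu> by (simp only: power_mult_distrib of_real_power)
  qed
  have p: "(l * \<mu>) powr (- real k - 1/2) = inverse (l powr (real k + 1/2)) *
      (inverse \<mu> ^ k * inverse (sqrt \<mu>))"
  proof -
    have "(l * \<mu>) powr (- real k - 1/2) = inverse ((l * \<mu>) powr (real k + 1/2))"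
      using powr_minus[of "l * \<mu>" "real k + 1/2"] by simp
    also have "(l * \<mu>) powr (real k + 1/2) = l powr (real k + 1/2) * (\<mu> ^ k * sqrt \<mu>)"
      using assms \<mu>_pos by (simp add: powr_mult powr_add powr_realpow powr_half_sqrt)
    finally show ?thesis by (simp add: power_inverse)
  qed
  have "1 / (sqrt pi * sqrt \<mu>) = sqrt pi * inverse pi * inverse (sqrt \<mu>)"
    using \<mu>_pos by (simp add: field_simps)
  then have h: "2 / complex_of_real (sqrt (2 * pi * norm (psi2 \<epsilon>))) = of_real (sqrt pi) * of_real
      (inverse pi) * of_real (inverse (sqrt \<mu>))"
    using s by (metis of_real_divide of_real_mult of_real_numeral)
  have gen: "A * x * y * (s * m * d * P / W) = s * d * (A * P * (inverse W * (m * y))) * x"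
    for A x y s m d P W :: complex
    by (cases "W = 0") (simp_all add: field_simps)
  have "2 / complex_of_real (sqrt (2 * pi * norm (psi2 \<epsilon>))) *
      (D_even \<epsilon> a c k * pochhammer (1 / 2) k / of_real (l powr (real k + 1 / 2)))
     = (-1) ^ k * D_coeff \<epsilon> a c (2 * k + 1) k * of_real
         (Gamma (real k + 1/2) * (l * \<mu>) powr (- real k - 1/2)) * of_real (inverse pi)"
    unfolding h D p of_real_mult of_real_inverse G by (rule gen)
  then show ?thesis by (simp only: divide_inverse of_real_inverse)
qed

lemma Gauss_2F1_asymp:
  "\<exists>R. R \<in> O[at_top](\<lambda>l. complex_of_real (l powr (- real m - 1 / 2))) \<and>
     (\<forall>\<^sub>F l in at_top. Gauss_2F1 (a + of_real \<epsilon> * of_real l) 1 (c + of_real l) (of_real (1 / \<epsilon>)) =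
        Gfactor \<epsilon> a c l * exp (- of_real l * psi \<epsilon> (of_real \<epsilon>)) / (2 * of_real (1 / \<epsilon>)) * famp a c
            (of_real \<epsilon>)
          * (1 - 2 / of_real (sqrt (2 * pi * norm (psi2 \<epsilon>)))
               * (\<Sum>k<m. D_even \<epsilon> a c k * pochhammer (1 / 2) k / of_real (l powr (real k + 1 / 2)))
                   + R l))"
proof -
  define S where "S l = 2 / complex_of_real (sqrt (2 * pi * norm (psi2 \<epsilon>)))
      * (\<Sum>k<m. D_even \<epsilon> a c k * pochhammer (1 / 2) k / of_real (l powr (real k + 1 / 2)))" for l
  \<comment> \<open>R is defined so that the identity is exact; only its size is at stake. It
    consists of the exponentially small error of the quotient and the remainder of Watson's
    lemma.\<close>
  define R where "R l = S l - (beta_upper l - beta_lower l) / (beta_upper l + beta_lower l)" for l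
  obtain C where C: "\<forall>\<^sub>F l in at_top. beta_upper l + beta_lower l \<noteq> 0 \<and>
     norm ((beta_upper l - beta_lower l) / (beta_upper l + beta_lower l) - pv_integral l /
         (\<i> * of_real pi)) \<le> C * exp (- (\<mu> * r\<^sup>2) * l)"
    using ratio_asymp by blast
  obtain D where D: "\<And>l. l > 0 \<Longrightarrow> norm (pv_integral l - \<i> *
      (\<Sum>k<m. (-1) ^ k * D_coeff \<epsilon> a c (2 * k + 1) k * of_real
      (Gamma (real k + 1/2) * (l * \<mu>) powr (- real k - 1/2))))
     \<le> D * l powr (- real m - 1/2)"
    using pv_integral_asymp[of m] by blast
  obtain l0 where l0: "\<And>l. l \<ge> l0 \<Longrightarrow> Re (beta_p l) > 0 \<and> Re (beta_q l) > 0"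
    using incomplete_beta_asymp by blast
  have \<eta>: "\<mu> * r\<^sup>2 > 0" using \<mu>_pos r by simp
  have "\<forall>\<^sub>F l in at_top. exp (- (\<mu> * r\<^sup>2) * l) \<le> l powr (- real m - 1 / 2)"
  proof -
    have "\<forall>\<^sub>F l in at_top. exp (- \<eta> * l) \<le> l powr b" if "\<eta> > 0" for \<eta> b :: real
    proof -
      have "((\<lambda>l. l powr (- b) / exp (\<eta> * l)) \<longlongrightarrow> 0) at_top"
        using that by real_asymp
      then have "\<forall>\<^sub>F l in at_top. l powr (- b) / exp (\<eta> * l) < 1"
        by (rule order_tendstoD) simp
      then show ?thesis
        using eventually_gt_at_top[of 0]
        by eventually_elim (simp add: powr_minus exp_minus field_simps)
    qed
    from this[OF \<eta>] show ?thesis .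
  qed
  then have "\<forall>\<^sub>F l in at_top. norm (R l) \<le> (\<bar>C\<bar> + D / pi) * norm
      (complex_of_real (l powr (- real m - 1 / 2)))"
    using C eventually_gt_at_top[of 0]
  proof eventually_elim
    case (elim l)
    let ?T = "\<Sum>k<m. (-1) ^ k * D_coeff \<epsilon> a c (2 * k + 1) k * complex_of_real
        (Gamma (real k + 1/2) * (l * \<mu>) powr (- real k - 1/2))"
    have S: "S l = ?T / of_real pi"
      unfolding S_def sum_distrib_left sum_divide_distrib by (intro sum.cong refl coefficient_eq elim)
    have "pv_integral l / (\<i> * of_real pi) - S l = (pv_integral l - \<i> * ?T) / (\<i> * of_real pi)"
      unfolding S by (simp add: field_simps)
    then have "norm (pv_integral l / (\<i> * of_real pi) - S l) = norm (pv_integral l - \<i> * ?T) / pi"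
      by (simp add: norm_divide norm_mult)
    also have "\<dots> \<le> D * l powr (- real m - 1/2) / pi"
      by (intro divide_right_mono D elim) auto
    finally have 1: "norm (pv_integral l / (\<i> * of_real pi) - S l) \<le> D / pi * l powr
        (- real m - 1/2)" by simp
    have "C * exp (- (\<mu> * r\<^sup>2) * l) \<le> \<bar>C\<bar> * exp (- (\<mu> * r\<^sup>2) * l)" by (intro mult_right_mono) auto
    also have "\<dots> \<le> \<bar>C\<bar> * l powr (- real m - 1 / 2)" using elim(1) by (intro mult_left_mono) auto
    finally have 2: "norm ((beta_upper l - beta_lower l) / (beta_upper l + beta_lower l) -
        pv_integral l / (\<i> * of_real pi)) \<le> \<bar>C\<bar> * l powr (- real m - 1 / 2)"
      using elim(2) by linarith
    have "norm (R l) = norm (((beta_upper l - beta_lower l) / (beta_upper l + beta_lower l) -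
        pv_integral l / (\<i> * of_real pi)) + (pv_integral l / (\<i> * of_real pi) - S l))"
      by (simp add: R_def norm_minus_commute)
    also have "\<dots> \<le> \<bar>C\<bar> * l powr (- real m - 1 / 2) + D / pi * l powr (- real m - 1/2)"
      using norm_triangle_ineq 1 2 by (meson add_mono order.trans)
    finally show ?case by (simp add: algebra_simps)
  qed
  then have "R \<in> O[at_top](\<lambda>l. complex_of_real (l powr (- real m - 1 / 2)))"
    by (rule bigoI)
  moreover have "\<forall>\<^sub>F l in at_top. Gauss_2F1 (a + of_real \<epsilon> * of_real l) 1 (c + of_real l)
      (of_real (1 / \<epsilon>)) =
        Gfactor \<epsilon> a c l * exp (- of_real l * psi \<epsilon> (of_real \<epsilon>)) / (2 * of_real (1 / \<epsilon>)) * famp a c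
            (of_real \<epsilon>)
          * (1 - S l + R l)"
    using C eventually_ge_at_top[of l0] eventually_gt_at_top[of "- Re a / \<epsilon>"]
  proof eventually_elim
    case (elim l)
    have A: "Re (a + of_real \<epsilon> * of_real l) > 0" using elim(3) eps by (simp add: field_simps)
    have e: "1 - S l + R l = 1 - (beta_upper l - beta_lower l) / (beta_upper l + beta_lower l)" by
        (simp add: R_def)
    show ?case
      unfolding e using l0[OF elim(2)] elim(1) by (intro Gauss_2F1_eq A) simp_all
  qed
  ultimately show ?thesis unfolding S_def by blast
qed

end

section \<open>Closed forms of the first three coefficients\<close>

lemma D_even_first_values:
  fixes \<epsilon> :: real and a c :: complex
  assumes eps: "\<epsilon> > 1"
  defines "F \<equiv> F_ratio \<epsilon> a c" and "P \<equiv> Psi_ratio \<epsilon>"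
  shows "D_even \<epsilon> a c 0 = F 1 - 1/6 * P 3"
    and "D_even \<epsilon> a c 1 = 1 / psi2 \<epsilon> *
              (1/3 * F 3 - 1/2 * F 2 * P 3 + 1/4 * F 1 * (5/3 * P 3 ^ 2 - P 4)
               - 1/4 * (35/54 * P 3 ^ 3 - 5/6 * P 3 * P 4 + 1/5 * P 5))"
    and "D_even \<epsilon> a c 2 = 1 / psi2 \<epsilon> ^ 2 *
              (1/30 * F 5 - 5/36 * F 4 * P 3 + 5/36 * F 3 * (7/3 * P 3 ^ 2 - P 4)
               + 1/12 * F 2 * (- 35/6 * P 3 ^ 3 + 35/6 * P 3 * P 4 - P 5)
               + 1/36 * F 1 * (385/24 * P 3 ^ 4 - 105/4 * P 3 ^ 2 * P 4 + 7 * P 3 * P 5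
                               + 35/8 * P 4 ^ 2 - P 6)
               - 1/48 * (1001/108 * P 3 ^ 5 - 385/18 * P 3 ^ 3 * P 4
                         + 35/4 * P 3 * (P 4 ^ 2 + 4/5 * P 3 * P 5)
                         - 7/3 * (P 4 * P 5 + 2/3 * P 3 * P 6) + 4/21 * P 7))"
proof -
  let ?A = "amp_fps \<epsilon> a c" and ?Q = "phase_fps \<epsilon>" and ?U = "root_fps \<epsilon>"
  have Q: "fps_nth ?Q n = 2 * P (n + 2) / fact (n + 2)" and A: "fps_nth ?A n = F n / fact n" for n
    by (simp_all add: phase_fps_def amp_fps_def F_def P_def)
  note coeffs = root_fps_square[OF eps] root_fps_0[OF eps] amp_fps_0[OF eps, of a c] Q A
  show "D_even \<epsilon> a c 0 = F 1 - 1/6 * P 3"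
    unfolding D_even_def D_coeff_eq[OF eps] half_power_coeff_1[OF coeffs] by simp
  show "D_even \<epsilon> a c 1 = 1 / psi2 \<epsilon> *
              (1/3 * F 3 - 1/2 * F 2 * P 3 + 1/4 * F 1 * (5/3 * P 3 ^ 2 - P 4)
               - 1/4 * (35/54 * P 3 ^ 3 - 5/6 * P 3 * P 4 + 1/5 * P 5))"
    unfolding D_even_def D_coeff_eq[OF eps] half_power_coeff_3[OF coeffs, symmetric] by simp
  show "D_even \<epsilon> a c 2 = 1 / psi2 \<epsilon> ^ 2 *
              (1/30 * F 5 - 5/36 * F 4 * P 3 + 5/36 * F 3 * (7/3 * P 3 ^ 2 - P 4)
               + 1/12 * F 2 * (- 35/6 * P 3 ^ 3 + 35/6 * P 3 * P 4 - P 5)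
               + 1/36 * F 1 * (385/24 * P 3 ^ 4 - 105/4 * P 3 ^ 2 * P 4 + 7 * P 3 * P 5
                               + 35/8 * P 4 ^ 2 - P 6)
               - 1/48 * (1001/108 * P 3 ^ 5 - 385/18 * P 3 ^ 3 * P 4
                         + 35/4 * P 3 * (P 4 ^ 2 + 4/5 * P 3 * P 5)
                         - 7/3 * (P 4 * P 5 + 2/3 * P 3 * P 6) + 4/21 * P 7))"
    unfolding D_even_def D_coeff_eq[OF eps] half_power_coeff_5[OF coeffs, symmetric] by
        (simp add: power_divide)
qed

theorem theorem2:
  fixes \<epsilon> x :: real and a c :: complex
  assumes "\<epsilon> > 1" and "x = 1 / \<epsilon>"
  shows "(\<forall>N::nat. \<exists>R :: real \<Rightarrow> complex.
            R \<in> O[at_top](\<lambda>l. of_real (l powr (- real N - 1 / 2))) \<and>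
            (\<forall>\<^sub>F l in at_top.
               Gauss_2F1 (a + of_real \<epsilon> * of_real l) 1 (c + of_real l) (of_real x) =
                 Gfactor \<epsilon> a c l * exp (- of_real l * psi \<epsilon> (of_real \<epsilon>)) / (2 * of_real x)
                   * famp a c (of_real \<epsilon>)
                   * (1 - 2 / of_real (sqrt (2 * pi * norm (psi2 \<epsilon>)))
                          * (\<Sum>k<N. D_even \<epsilon> a c k * pochhammer (1 / 2) k
                                      / of_real (l powr (real k + 1 / 2)))
                        + R l)))
       \<and> (let F = F_ratio \<epsilon> a c; P = Psi_ratio \<epsilon> in
            D_even \<epsilon> a c 0 = F 1 - 1/6 * P 3 \<and>
            D_even \<epsilon> a c 1 = 1 / psi2 \<epsilon> *
              (1/3 * F 3 - 1/2 * F 2 * P 3 + 1/4 * F 1 * (5/3 * P 3 ^ 2 - P 4)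
               - 1/4 * (35/54 * P 3 ^ 3 - 5/6 * P 3 * P 4 + 1/5 * P 5)) \<and>
            D_even \<epsilon> a c 2 = 1 / psi2 \<epsilon> ^ 2 *
              (1/30 * F 5 - 5/36 * F 4 * P 3 + 5/36 * F 3 * (7/3 * P 3 ^ 2 - P 4)
               + 1/12 * F 2 * (- 35/6 * P 3 ^ 3 + 35/6 * P 3 * P 4 - P 5)
               + 1/36 * F 1 * (385/24 * P 3 ^ 4 - 105/4 * P 3 ^ 2 * P 4 + 7 * P 3 * P 5
                               + 35/8 * P 4 ^ 2 - P 6)
               - 1/48 * (1001/108 * P 3 ^ 5 - 385/18 * P 3 ^ 3 * P 4
                         + 35/4 * P 3 * (P 4 ^ 2 + 4/5 * P 3 * P 5)
                         - 7/3 * (P 4 * P 5 + 2/3 * P 3 * P 6) + 4/21 * P 7)))"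
proof (intro conjI allI)
  fix m
  obtain r R \<gamma> \<gamma>' q K B where "saddle_path \<epsilon> a c r R \<gamma> \<gamma>' q K B"
    using saddle_path_exists[OF assms(1)] by blast
  then interpret saddle_path \<epsilon> a c r R \<gamma> \<gamma>' q K B .
  from Gauss_2F1_asymp[of m]
  show "\<exists>R :: real \<Rightarrow> complex.
            R \<in> O[at_top](\<lambda>l. of_real (l powr (- real m - 1 / 2))) \<and>
            (\<forall>\<^sub>F l in at_top.
               Gauss_2F1 (a + of_real \<epsilon> * of_real l) 1 (c + of_real l) (of_real x) =
                 Gfactor \<epsilon> a c l * exp (- of_real l * psi \<epsilon> (of_real \<epsilon>)) / (2 * of_real x)
                   * famp a c (of_real \<epsilon>)
                   * (1 - 2 / of_real (sqrt (2 * pi * norm (psi2 \<epsilon>)))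
                          * (\<Sum>k<m. D_even \<epsilon> a c k * pochhammer (1 / 2) k
                                      / of_real (l powr (real k + 1 / 2)))
                        + R l))"
    unfolding assms(2) .
qed (unfold Let_def, intro conjI D_even_first_values[OF assms(1)])

end
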